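(* Let $\beta\in\mathbb{Q}\cap(0,1)$ with $v_2(\beta)\leq 0$, let $\alpha\in(0,1)$ satisfy $\beta<2\alpha$, and let $g_0=\min\{g\geq 1: g\beta \text{ is an odd integer}\}$. Then there exists a set $A\subset\mathbb{N}$ such that $\mathrm{d}(A)=\alpha$ and $\mathrm{d}(A+A)=\beta$ (both densities existing) if and only if $$\frac{\beta}{2}<\alpha\leq\frac{\beta}{2}+\frac{1}{2g_0}.$$
   Context: For $A\subset\mathbb{N}$, $\mathrm{d}(A)=\lim_{t\to\infty}|A\cap[1,t]|/t$ is the asymptotic density when the limit exists. $v_2$ is the $2$-adic valuation, extended to nonzero rationals by $v_2(p/q)=v_2(p)-v_2(q)$. $A+A=\{a+b:a,b\in A\}$. *)

theory Defs
  imports Complex_Main "HOL-Library.Set_Algebras" "HOL-Computational_Algebra.Primes"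
begin

text \<open>The sumset \<open>A + A\<close> is that of \<^theory>\<open>HOL-Library.Set_Algebras\<close>. Natural numbers
  here include \<open>0\<close>; since densities of \<open>A\<close> and \<open>A + A\<close> are invariant under translating \<open>A\<close>,
  this makes no difference to which pairs of densities are realizable.\<close>

definition has_density :: "nat set \<Rightarrow> real \<Rightarrow> bool" where
  "has_density A d \<longleftrightarrow> (\<lambda>t::nat. real (card (A \<inter> {1..t})) / real t) \<longlonglongrightarrow> d"

text \<open>On rationals, \<open>v2\<close> is computed from the reduced fraction; by \<open>v2_Fract\<close> below, any
  other representation gives the same value. It is only meaningful for nonzero arguments.\<close>

definition v2 :: "rat \<Rightarrow> int" where
  "v2 x = (case quotient_of x of (p, q) \<Rightarrow>
     int (multiplicity (2::int) p) - int (multiplicity (2::int) q))"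

lemma v2_Fract:
  fixes p q :: int
  assumes "p \<noteq> 0" "q \<noteq> 0"
  shows "v2 (Fract p q) = int (multiplicity 2 p) - int (multiplicity 2 q)"
proof -
  obtain a b where ab: "quotient_of (Fract p q) = (a, b)" by fastforce
  have b: "b > 0" by (rule quotient_of_denom_pos[OF ab])
  have eq: "Fract p q = Fract a b"
    using quotient_of_div[OF ab] by (simp add: Fract_of_int_quotient)
  hence cross: "p * b = a * q" using assms b by (simp add: eq_rat)
  hence a: "a \<noteq> 0" using assms b by auto
  have "multiplicity 2 (p * b) = multiplicity 2 (a * q)" using cross by simp
  hence "multiplicity 2 p + multiplicity 2 b = multiplicity 2 a + multiplicity 2 q"
    using assms a b by (simp add: prime_elem_multiplicity_mult_distrib)
  thus ?thesis by (simp add: v2_def ab)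
qed

end

theory Submission
  imports Defs "HOL-Complex_Analysis.Great_Picard"
begin

text \<open>Necessity. Split the integers into windows \<open>[p k!/d, (p + 1) k!/d)\<close> and these into residue classes
  modulo \<open>G\<close>; the densities of \<open>A\<close> and \<open>A + A\<close> on the pieces converge along a subsequence of \<open>k\<close>. An
  energy increment gives a window and a modulus such that on most classes these densities stay the same
  under further refinement. The sum of two classes on which \<open>A\<close> has such stable densities \<open>a\<close> and \<open>b\<close> has density about
  \<open>min 1 (a + b)\<close>, since the only obstructions are congruences to small moduli. This turns
  \<open>\<beta> < 2 \<alpha>\<close> into a statement about weights on \<open>\<int>/G\<close>, where Kneser's theorem yields a union \<open>P\<close> of \<open>s\<close> classes
  modulo a bounded \<open>g\<close> such that \<open>P + P\<close> has \<open>2 s - 1\<close> classes and \<open>A\<close> is almost contained in \<open>P\<close> on the window. As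
  \<open>A\<close> and \<open>A + A\<close> have a density, the containment is exact and propagates down to \<open>0\<close>, so that
  \<open>\<beta> \<approx> (2 s - 1)/g\<close> and \<open>\<alpha> \<lesssim> s/g\<close>. As \<open>g\<close> is bounded, \<open>\<beta> = (2 s - 1)/g\<close>, hence \<open>g \<ge> g\<^sub>0\<close>
  and \<open>\<alpha> \<le> \<beta>/2 + 1/(2 g\<^sub>0)\<close>.

  Sufficiency. For \<open>\<beta> = (2 s - 1)/g\<^sub>0\<close>, take \<open>s - 1\<close> consecutive classes modulo \<open>g\<^sub>0\<close> and more than
  half of the next one.\<close>

section \<open>Kneser's theorem for periodic sets of integers\<close>

text \<open>The order of choices is what makes the argument close. The statement on sums of two
  classes fixes its resolution \<open>Q\<close>, \<open>T\<close> and accuracy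
  \<open>\<theta>\<close> from the tolerance alone; only afterwards are the window and
  \<open>G\<close> selected, regular at exactly this resolution. Factorials as units make all
  subdivisions of windows exact for large \<open>k\<close>, so refined densities average to coarse
  ones without rounding, as the energy argument demands. The odd number \<open>2 s - 1\<close>
  arises since \<open>\<beta> < 2 \<alpha>\<close> forces \<open>|P + P| < 2 |P|\<close>, while
  Kneser gives \<open>|P + P| \<ge> 2 |P| - 1\<close>. The same inequalities yield
  \<open>g \<le> 2 / (2 \<alpha> - \<beta>)\<close>. This bound is known in advance, so
  \<open>G\<close> is taken divisible by all such \<open>g\<close>, and \<open>P\<close> is then a
  union of classes modulo \<open>G\<close>. It does not depend on the tolerance either, so shrinking
  the tolerance turns an approximation between integers into an equality. Confinement on one window
  would not bound \<open>A + A\<close> from above, because sums below \<open>w\<close> use summands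
  from all of \<open>[0, w)\<close>; hence the descent to \<open>0\<close>.\<close>

definition periodic :: "int \<Rightarrow> int set \<Rightarrow> bool" where
  "periodic n S \<longleftrightarrow> (\<forall>x. x \<in> S \<longleftrightarrow> x + n \<in> S)"

definition cnt :: "int set \<Rightarrow> int \<Rightarrow> int \<Rightarrow> nat" where
  "cnt S a b = card (S \<inter> {a..<b})"

lemma cnt_mono: "S \<subseteq> T \<Longrightarrow> cnt S a b \<le> cnt T a b"
  unfolding cnt_def by (intro card_mono) auto

lemma cnt_mono_window: "S \<inter> {a..<b} \<subseteq> T \<inter> {c..<d} \<Longrightarrow> cnt S a b \<le> cnt T c d"
  unfolding cnt_def by (intro card_mono) auto

lemma cnt_Un_disjoint: "S \<inter> T = {} \<Longrightarrow> cnt (S \<union> T) a b = cnt S a b + cnt T a b"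
  unfolding cnt_def Int_Un_distrib2 by (intro card_Un_disjoint) auto

lemma cnt_Un_Diff: "cnt (S \<union> T) a b = cnt S a b + cnt (T - S) a b"
  using cnt_Un_disjoint[of S "T - S"] by simp

lemma cnt_split: "a \<le> b \<Longrightarrow> b \<le> c \<Longrightarrow> cnt S a c = cnt S a b + cnt S b c"
proof -
  assume "a \<le> b" "b \<le> c"
  then have "S \<inter> {a..<c} = (S \<inter> {a..<b}) \<union> (S \<inter> {b..<c})" by auto
  then show ?thesis unfolding cnt_def by (simp only:) (intro card_Un_disjoint, auto)
qed

lemma cnt_le: "cnt S a b \<le> nat (b - a)"
  unfolding cnt_def using card_mono[of "{a..<b}" "S \<inter> {a..<b}"] by simp

lemma cnt_shift: "cnt {x. x - e \<in> S} a b = cnt S (a - e) (b - e)"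
proof -
  have "bij_betw (\<lambda>x. x + e) (S \<inter> {a - e..<b - e}) ({x. x - e \<in> S} \<inter> {a..<b})"
    by (rule bij_betw_byWitness[where f' = "\<lambda>x. x - e"]) auto
  then show ?thesis unfolding cnt_def by (metis bij_betw_same_card)
qed

lemma periodic_mult:
  assumes "periodic n S" shows "x + n * k \<in> S \<longleftrightarrow> x \<in> S"
proof (induction k rule: int_induct[where k = 0])
  case (step1 i)
  then show ?case using assms[unfolded periodic_def, rule_format, of "x + n * i"]
    by (simp add: algebra_simps)
next
  case (step2 i)
  then show ?case using assms[unfolded periodic_def, rule_format, of "x + n * (i - 1)"]
    by (simp add: algebra_simps)
qed simp

lemma periodic_dvd: "periodic n S \<Longrightarrow> n dvd m \<Longrightarrow> periodic m S"
  unfolding periodic_def[of m] by (auto simp: periodic_mult elim!: dvdE)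

lemma periodic_dvd_diff: "periodic n S \<Longrightarrow> n dvd x - y \<Longrightarrow> x \<in> S \<longleftrightarrow> y \<in> S"
  by (metis add_diff_cancel_left' diff_add_cancel dvdE periodic_mult add.commute)

lemma periodic_mod: "periodic n S \<Longrightarrow> x mod n \<in> S \<longleftrightarrow> x \<in> S"
  by (rule periodic_dvd_diff) (auto simp: mod_eq_dvd_iff[symmetric])

lemma cnt_periodic_window:
  assumes "periodic n S" "n > 0" shows "cnt S a (a + n) = cnt S 0 n"
proof -
  have "bij_betw (\<lambda>x. x mod n) (S \<inter> {a..<a + n}) (S \<inter> {0..<n})"
  proof (rule bij_betw_byWitness[where f' = "\<lambda>y. a + (y - a) mod n"])
    show "\<forall>x\<in>S \<inter> {a..<a + n}. a + (x mod n - a) mod n = x"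
      by (auto simp: mod_diff_left_eq)
    show "\<forall>y\<in>S \<inter> {0..<n}. (a + (y - a) mod n) mod n = y"
      by (auto simp: mod_add_right_eq)
    show "(\<lambda>x. x mod n) ` (S \<inter> {a..<a + n}) \<subseteq> S \<inter> {0..<n}"
      using assms by (auto simp: periodic_mod)
    have "a + (y - a) mod n \<in> S" if "y \<in> S" for y
    proof -
      have "(a + (y - a) mod n) - y = n * (- ((y - a) div n))"
        using mult_div_mod_eq[of n "y - a"] by (simp add: algebra_simps)
      then have "n dvd (a + (y - a) mod n) - y" by (rule dvdI)
      then show ?thesis using periodic_dvd_diff[OF assms(1)] that by blast
    qed
    then show "(\<lambda>y. a + (y - a) mod n) ` (S \<inter> {0..<n}) \<subseteq> S \<inter> {a..<a + n}"
      using assms by auto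
  qed
  then show ?thesis unfolding cnt_def by (metis bij_betw_same_card)
qed

lemma cnt_periodic_mult:
  assumes "periodic m S" "m > 0" shows "cnt S 0 (m * int k) = k * cnt S 0 m"
proof (induction k)
  case (Suc k)
  have "cnt S 0 (m * int (Suc k)) = cnt S 0 (m * int k) + cnt S (m * int k) (m * int k + m)"
    using cnt_split[of 0 "m * int k" "m * int k + m" S] assms(2) by (simp add: algebra_simps)
  then show ?case using Suc cnt_periodic_window[OF assms, of "m * int k"] by simp
qed (simp add: cnt_def)

text \<open>The periods form a subgroup of the integers, nonzero because of \<open>n\<close>; it is
  generated by the least positive one. This generator stands for the stabiliser of
  \<open>S\<close>.\<close>

lemma periods_principal:
  assumes "periodic n S" "n > 0"
  shows "\<exists>g>0. \<forall>h. periodic h S \<longleftrightarrow> g dvd h"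
proof -
  define P where "P m \<longleftrightarrow> m > 0 \<and> periodic (int m) S" for m :: nat
  have "P (nat n)" using assms by (simp add: P_def)
  then have PL: "P (LEAST m. P m)" by (rule LeastI)
  define g where "g = int (LEAST m. P m)"
  have g: "g > 0" "periodic g S" using PL by (auto simp: P_def g_def)
  have "g dvd h" if h: "periodic h S" for h
  proof (rule ccontr)
    assume "\<not> g dvd h"
    then have r: "h mod g > 0" using g(1) by (simp add: dvd_eq_mod_eq_0 order_less_le)
    have "periodic (h mod g) S"
      unfolding periodic_def
    proof
      fix x
      have "(x + h mod g) + g * (h div g) = x + h" by (simp add: add.assoc)
      then show "x \<in> S \<longleftrightarrow> x + h mod g \<in> S"
        using periodic_mult[OF g(2), of "x + h mod g"] h unfolding periodic_def by metis
    qed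
    then have "P (nat (h mod g))" using r by (simp add: P_def)
    then have "(LEAST m. P m) \<le> nat (h mod g)" by (rule Least_le)
    then show False using pos_mod_bound[OF g(1), of h] r by (simp add: g_def)
  qed
  then show ?thesis using g periodic_dvd by blast
qed

text \<open>Among the pairs of sets reachable by Dyson transforms that keep \<open>a\<close> and \<open>b\<close> in place, one with
  smallest second set \<open>B'\<close> satisfies \<open>A' + (B' - b) = A'\<close>.\<close>

lemma kneser_point:
  fixes A B :: "int set"
  assumes n: "n > 0" and A: "periodic n A" and B: "periodic n B" and a: "a \<in> A" and b: "b \<in> B"
  shows "\<exists>C g. C \<subseteq> A + B \<and> a + b \<in> C \<and> g > 0 \<and> g dvd n \<and> periodic g C \<and>
    int (cnt A 0 n) + int (cnt B 0 n) \<le> int (cnt C 0 n) + n div g"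
proof -
  define Inv where "Inv = (\<lambda>(A',B'). periodic n A' \<and> periodic n B' \<and> a \<in> A' \<and> b \<in> B' \<and> A' + B' \<subseteq> A + B
    \<and> cnt A' 0 n + cnt B' 0 n = cnt A 0 n + cnt B 0 n)"
  have "Inv (A, B)" using assms by (simp add: Inv_def)
  then obtain A' B' where inv: "Inv (A', B')"
    and min: "\<And>A'' B''. Inv (A'', B'') \<Longrightarrow> cnt B' 0 n \<le> cnt B'' 0 n"
    using ex_has_least_nat[of Inv "(A,B)" "\<lambda>p. cnt (snd p) 0 n"] by (metis prod.collapse snd_conv)
  have pA: "periodic n A'" and pB: "periodic n B'" and aA: "a \<in> A'" and bB: "b \<in> B'"
    and sub: "A' + B' \<subseteq> A + B" and eq: "cnt A' 0 n + cnt B' 0 n = cnt A 0 n + cnt B 0 n"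
    using inv by (auto simp: Inv_def)
  have step: "x + y - b \<in> A'" if x: "x \<in> A'" and y: "y \<in> B'" for x y
  proof (rule ccontr)
    assume no: "x + y - b \<notin> A'"
    \<comment> \<open>This shift keeps both base points: \<open>a\<close> stays in the larger set,
      and \<open>b + e = x\<close> lies in \<open>A'\<close>, so \<open>b\<close> survives in
      \<open>B2\<close>. The point \<open>y\<close> does not survive, as \<open>y + e\<close> is
      missing from \<open>A'\<close>.\<close>
    define e where "e = x - b"
    define A2 where "A2 = A' \<union> {z. z - e \<in> B'}"
    define B2 where "B2 = B' \<inter> {z. z + e \<in> A'}"
    have p1: "periodic n A2"
      unfolding periodic_def
    proof
      fix z
      show "z \<in> A2 \<longleftrightarrow> z + n \<in> A2"
        using pA[unfolded periodic_def, rule_format, of z]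
          pB[unfolded periodic_def, rule_format, of "z - e"]
        by (simp add: A2_def algebra_simps)
    qed
    have p2: "periodic n B2"
      unfolding periodic_def
    proof
      fix z
      show "z \<in> B2 \<longleftrightarrow> z + n \<in> B2"
        using pB[unfolded periodic_def, rule_format, of z]
          pA[unfolded periodic_def, rule_format, of "z + e"]
        by (simp add: B2_def algebra_simps)
    qed
    have sub2: "A2 + B2 \<subseteq> A' + B'"
    proof
      fix s assume "s \<in> A2 + B2"
      then obtain p q where s: "s = p + q" "p \<in> A2" "q \<in> B2" by (auto elim!: set_plus_elim)
      have "s \<in> A' + B'" if "p \<in> A'" using s that by (auto simp: B2_def)
      moreover have "s \<in> A' + B'" if "p - e \<in> B'"
      proof -
        have "(q + e) + (p - e) \<in> A' + B'"
          using s(3) that by (intro set_plus_intro) (auto simp: B2_def)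
        moreover have "(q + e) + (p - e) = s" using s(1) by simp
        ultimately show ?thesis by metis
      qed
      ultimately show "s \<in> A' + B'" using s(2) by (auto simp: A2_def)
    qed
    have c1: "cnt A2 0 n = cnt A' 0 n + cnt ({z. z - e \<in> B'} - A') 0 n"
      unfolding A2_def by (rule cnt_Un_Diff)
    have B'eq: "B' = B2 \<union> (B' - B2)" by (auto simp: B2_def)
    have c2: "cnt B' 0 n = cnt B2 0 n + cnt (B' - B2) 0 n"
      by (subst B'eq, rule cnt_Un_disjoint) auto
    \<comment> \<open>What \<open>B'\<close> loses is, shifted by \<open>e\<close>, exactly what
      \<open>A'\<close> gains; so the sum of the counts is kept.\<close>
    have "{z. z - e \<in> B'} - A' = {z. z - e \<in> B' - B2}" by (auto simp: B2_def)
    moreover have "cnt {z. z - e \<in> B' - B2} 0 n = cnt (B' - B2) (-e) (-e + n)"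
      by (simp only: cnt_shift) simp
    moreover have "periodic n (B' - B2)" using pB p2 by (auto simp: periodic_def)
    ultimately have c3: "cnt ({z. z - e \<in> B'} - A') 0 n = cnt (B' - B2) 0 n"
      using cnt_periodic_window[OF _ n, of "B' - B2" "-e"] by simp
    have "Inv (A2, B2)"
      using p1 p2 sub sub2 eq c1 c2 c3 aA bB x by (auto simp: Inv_def A2_def B2_def e_def)
    then have "cnt (B' - B2) 0 n = 0" using min[of A2 B2] c2 by simp
    then have "(B' - B2) \<inter> {0..<n} = {}" by (simp add: cnt_def)
    moreover have "y mod n \<in> (B' - B2) \<inter> {0..<n}"
    proof -
      have "y \<in> B' - B2" using y no by (auto simp: B2_def e_def algebra_simps)
      then have "y mod n \<in> B' - B2"
        using periodic_mod[of n "B' - B2" y] pB p2 by (auto simp: periodic_def)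
      then show ?thesis using n by simp
    qed
    ultimately show False by blast
  qed
  have per: "periodic (y - b) A'" if y: "y \<in> B'" for y
    unfolding periodic_def
  proof safe
    fix x assume "x \<in> A'" then show "x + (y - b) \<in> A'" using step[OF _ y] by (simp add: algebra_simps)
  next
    fix x assume x: "x + (y - b) \<in> A'"
    \<comment> \<open>So far \<open>A'\<close> is closed only under adding \<open>y - b\<close>. To
      go back, add it \<open>n - 1\<close> more times: this ends at \<open>x + n * (y - b)\<close>,
      equal to \<open>x\<close> up to a multiple of the period \<open>n\<close>.\<close>
    have it: "x + (y - b) + int k * (y - b) \<in> A'" for k
    proof (induction k)
      case (Suc k)
      then show ?case using step[OF Suc y] by (simp add: algebra_simps)
    qed (use x in simp)
    have "x + n * (y - b) \<in> A'" using it[of "nat (n - 1)"] n by (simp add: algebra_simps)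
    then show "x \<in> A'" using periodic_mult[OF pA] by blast
  qed
  obtain g where g: "g > 0" "\<And>h. periodic h A' \<longleftrightarrow> g dvd h" using periods_principal[OF pA n] by blast
  have gn: "g dvd n" using g pA by blast
  \<comment> \<open>All \<open>y - b\<close> are periods of \<open>A'\<close>, hence multiples of
    \<open>g\<close>: \<open>B'\<close> lies in a single class modulo \<open>g\<close>.\<close>
  have "cnt B' 0 n \<le> nat (n div g)"
  proof -
    let ?P = "{x. g dvd x - b}"
    have pb: "periodic g ?P" by (simp add: periodic_def diff_add_eq[symmetric])
    have "B' \<inter> {0..<n} \<subseteq> ?P \<inter> {0..<n}" using per g by auto
    then have "cnt B' 0 n \<le> cnt ?P 0 n" by (rule cnt_mono_window)
    moreover have "g * int (nat (n div g)) = n"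
      using gn g(1) n by (simp add: pos_imp_zdiv_nonneg_iff)
    then have "cnt ?P 0 n = nat (n div g) * cnt ?P 0 g"
      using cnt_periodic_mult[OF pb g(1), of "nat (n div g)"] by simp
    moreover have "cnt ?P 0 g = 1"
    proof -
      have "x = b" if "g dvd x - b" "b \<le> x" "x < b + g" for x
        using zdvd_not_zless[of "x - b" g] that by force
      then have "?P \<inter> {b..<b + g} = {b}" using g(1) by auto
      then show ?thesis
        using cnt_periodic_window[OF pb g(1), of b] by (simp add: cnt_def)
    qed
    ultimately show ?thesis by simp
  qed
  moreover define C where "C = {z. z - b \<in> A'}"
  have "cnt C 0 n = cnt A' 0 n"
    unfolding C_def cnt_shift using cnt_periodic_window[OF pA n, of "-b"] by simp
  moreover have "C \<subseteq> A + B"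
  proof
    fix z assume "z \<in> C"
    then have "(z - b) + b \<in> A' + B'" using bB unfolding C_def by blast
    then show "z \<in> A + B" using sub by auto
  qed
  moreover have "a + b \<in> C" using aA by (simp add: C_def)
  moreover have "periodic g C" using g(2)[of g] unfolding C_def periodic_def by (simp add: diff_add_eq[symmetric])
  moreover have "n div g \<ge> 0" using n g by (simp add: pos_imp_zdiv_nonneg_iff)
  ultimately show ?thesis using g(1) gn eq by (intro exI[of _ C] exI[of _ g]) auto
qed

section \<open>Unions of periodic sets\<close>

text \<open>For sets \<open>C1\<close>, \<open>C2\<close> of periods \<open>g1\<close>,
  \<open>g2\<close> with gcd \<open>e\<close>, a class modulo \<open>e\<close> is a grid with sides
  \<open>m2 = g1/e\<close> and \<open>m1 = g2/e\<close>, on which both sets are cylinders. The pairs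
  \<open>u\<close>, \<open>v\<close> count the lines inside and outside the sets in the class of a
  point of \<open>C2 - C1\<close>, the pairs \<open>x\<close>, \<open>y\<close> those in the class
  of a point of \<open>C1 - C2\<close>; the index names the set. The products are sizes of
  differences of the sets.\<close>

lemma grid_arith:
  fixes u1 v1 u2 v2 x1 y1 x2 y2 m1 m2 :: int
  assumes nn: "u1 \<ge> 0" "v2 \<ge> 0" "y1 \<ge> 0" "x2 \<ge> 0"
    and pos: "u2 \<ge> 1" "v1 \<ge> 1" "x1 \<ge> 1" "y2 \<ge> 1"
    and sums: "u1 + v1 = m2" "x1 + y1 = m2" "u2 + v2 = m1" "x2 + y2 = m1"
    and le: "v1 * u2 \<le> m1 - 2" "u1 * v2 \<le> m2 - 2" "y1 * x2 \<le> m1 - 2" "x1 * y2 \<le> m2 - 2"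
  shows False
proof -
  \<comment> \<open>Neither class can meet both sets, since \<open>b - 1 \<le> d - 2\<close> and
    \<open>d - 1 \<le> b - 2\<close> would follow. Each difference then contains a full line of the
    grid, and \<open>m2 \<le> m1 - 2\<close> clashes with \<open>m1 \<le> m2 - 2\<close>.\<close>
  have key: False
    if "a \<ge> 1" "b \<ge> 1" "c \<ge> 1" "d \<ge> 0" "b * c \<le> c + d - 2" "a * d \<le> a + b - 2"
    for a b c d :: int
  proof -
    have 1: "(b - 1) * c \<le> d - 2" and 2: "a * (d - 1) \<le> b - 2" using that by (simp_all add: algebra_simps)
    have "(b - 1) * c \<ge> b - 1" using mult_left_mono[of 1 c "b - 1"] that by simp
    then have d: "b - 1 \<le> d - 2" using 1 by (rule order_trans)
    then have "a * (d - 1) \<ge> d - 1" using mult_right_mono[of 1 a "d - 1"] that by simp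
    then have "d - 1 \<le> b - 2" using 2 by (rule order_trans)
    then show False using d by simp
  qed
  have u1: "u1 = 0" using key[of u1 v1 u2 v2] nn pos sums le by (cases "u1 = 0") auto
  have x2: "x2 = 0" using key[of x2 y2 x1 y1] nn pos sums le by (cases "x2 = 0") (auto simp: mult.commute)
  have v: "v1 = m2" "y2 = m1" using u1 x2 sums by auto
  have "m2 * 1 \<le> m2 * u2" using v pos by (intro mult_left_mono) auto
  then have "m2 \<le> m1 - 2" using le(1) unfolding v(1) by linarith
  moreover have "1 * m1 \<le> x1 * m1" using v pos by (intro mult_right_mono) auto
  then have "m1 \<le> m2 - 2" using le(4) unfolding v(2) by linarith
  ultimately show False by linarith
qed

lemma card_residue_class:
  fixes e :: int
  assumes "e > 0" "m \<ge> 0"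
  shows "int (card {i \<in> {0..<e * m}. i mod e = r mod e}) = m"
proof -
  let ?P = "{x. x mod e = r mod e}"
  have p: "periodic e ?P" by (simp add: periodic_def)
  have "?P \<inter> {0..<e} = {r mod e}" using assms by (auto simp: mod_pos_pos_trivial)
  then have "cnt ?P 0 e = 1" by (simp add: cnt_def)
  moreover have "{i \<in> {0..<e * m}. i mod e = r mod e} = ?P \<inter> {0..<e * m}" by auto
  ultimately show ?thesis
    using cnt_periodic_mult[OF p assms(1), of "nat m"] assms(2) by (simp add: cnt_def)
qed

lemma chinese_remainder_gcd:
  fixes g1 g2 i j :: int
  assumes "gcd g1 g2 dvd i - j"
  shows "\<exists>z. g1 dvd z - i \<and> g2 dvd z - j"
proof -
  obtain u v where uv: "u * g1 + v * g2 = gcd g1 g2" using bezout_int by blast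
  obtain k where k: "i - j = gcd g1 g2 * k" using assms by (rule dvdE)
  have "i - u * g1 * k - j = v * g2 * k"
    using k by (simp add: uv[symmetric] algebra_simps)
  then have "g1 dvd (i - u * g1 * k) - i" "g2 dvd (i - u * g1 * k) - j" by auto
  then show ?thesis by blast
qed

text \<open>By the Chinese remainder theorem, residues modulo \<open>g1\<close> and
  \<open>g2\<close> that agree modulo the gcd have a common representative modulo the lcm, from
  which the pair can be recovered.\<close>

lemma crt_card_le:
  fixes g1 g2 :: int
  assumes g: "g1 > 0" "g2 > 0" and p: "periodic g1 S1" "periodic g2 S2"
  shows "card {i \<in> {0..<g1}. i mod gcd g1 g2 = r \<and> i \<in> S1} *
    card {j \<in> {0..<g2}. j mod gcd g1 g2 = r \<and> j \<in> S2} \<le> cnt (S1 \<inter> S2) 0 (lcm g1 g2)"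
proof -
  let ?e = "gcd g1 g2" and ?l = "lcm g1 g2"
  let ?I = "{i \<in> {0..<g1}. i mod ?e = r \<and> i \<in> S1}" and ?J = "{j \<in> {0..<g2}. j mod ?e = r \<and> j \<in> S2}"
  have l: "?l > 0" using g by (simp add: lcm_pos_int)
  have "?I \<times> ?J \<subseteq> (\<lambda>z. (z mod g1, z mod g2)) ` ((S1 \<inter> S2) \<inter> {0..<?l})"
  proof
    fix q assume "q \<in> ?I \<times> ?J"
    then obtain i j where q: "q = (i, j)" and i: "0 \<le> i" "i < g1" "i \<in> S1" and j: "0 \<le> j" "j < g2" "j \<in> S2"
      and "i mod ?e = j mod ?e" by auto
    then have "?e dvd i - j" by (simp add: mod_eq_dvd_iff)
    then obtain z where z: "g1 dvd z - i" "g2 dvd z - j" using chinese_remainder_gcd by blast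
    have d: "?l dvd z - z mod ?l" by (simp add: dvd_minus_mod)
    have z1: "g1 dvd z mod ?l - i" "g2 dvd z mod ?l - j"
      using dvd_diff[OF z(1) dvd_trans[OF dvd_lcm1 d]] dvd_diff[OF z(2) dvd_trans[OF dvd_lcm2 d]] by simp_all
    then have "z mod ?l \<in> S1" "z mod ?l \<in> S2" using periodic_dvd_diff p i j by blast+
    moreover have "(z mod ?l) mod g1 = i" "(z mod ?l) mod g2 = j"
      using z1 i j by (metis mod_eq_dvd_iff mod_pos_pos_trivial)+
    ultimately show "q \<in> (\<lambda>z. (z mod g1, z mod g2)) ` ((S1 \<inter> S2) \<inter> {0..<?l})"
      using q l by (intro image_eqI[of _ _ "z mod ?l"]) auto
  qed
  then have "card (?I \<times> ?J) \<le> card ((S1 \<inter> S2) \<inter> {0..<?l})"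
    by (intro surj_card_le) auto
  then show ?thesis by (simp add: cnt_def card_cartesian_product)
qed

text \<open>Modulo the lcm, \<open>lcm g1 g2 div gi\<close> is the order of the subgroup generated
  by \<open>gi\<close>. The union exceeds one of the two sets by at least this order minus
  \<open>1\<close>, which pays for the stabiliser term dropping to \<open>1\<close>.\<close>

lemma periodic_Un_lcm:
  fixes g1 g2 :: int
  assumes g: "g1 > 0" "g2 > 0" and p: "periodic g1 C1" "periodic g2 C2"
    and x: "x \<in> C2" "x \<notin> C1" and y: "y \<in> C1" "y \<notin> C2"
  shows "lcm g1 g2 div g1 - 1 \<le> int (cnt (C2 - C1) 0 (lcm g1 g2)) \<or>
         lcm g1 g2 div g2 - 1 \<le> int (cnt (C1 - C2) 0 (lcm g1 g2))"
proof (rule ccontr)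
  assume neg: "\<not> ?thesis"
  let ?e = "gcd g1 g2" and ?l = "lcm g1 g2"
  define U where "U g S r = int (card {i \<in> {0..<g}. i mod ?e = r \<and> i \<in> S})" for g S r
  have e: "?e > 0" using g by simp
  have lg: "?l * ?e = g1 * g2" using g by (simp add: mult.commute prod_gcd_lcm_int[symmetric] abs_mult)
  obtain a1 where a1: "g1 = ?e * a1" by (meson dvdE gcd_dvd1)
  obtain a2 where a2: "g2 = ?e * a2" by (meson dvdE gcd_dvd2)
  have apos: "a1 > 0" "a2 > 0" using g e a1 a2 by (metis zero_less_mult_pos)+
  have l: "?l = g1 * a2" "?l = g2 * a1"
    using lg a1 a2 e by (metis mult.assoc mult.commute mult_cancel_left order_less_irrefl)+
  then have m: "?l div g1 = a2" "?l div g2 = a1" using g by (metis nonzero_mult_div_cancel_left order_less_irrefl)+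
  define F where "F g r = {i \<in> {0..<g}. i mod ?e = r}" for g r
  have finF: "finite (F g r)" for g r unfolding F_def by (rule finite_subset[of _ "{0..<g}"]) blast+
  have U: "U g S r = int (card (F g r \<inter> S))" for g S r
  proof -
    have "{i \<in> {0..<g}. i mod ?e = r \<and> i \<in> S} = F g r \<inter> S" unfolding F_def by blast
    then show ?thesis by (simp only: U_def)
  qed
  have compl: "U g S (r mod ?e) + U g (- S) (r mod ?e) = a" if "g = ?e * a" "a > 0" for g S r a
  proof -
    have "card (F g (r mod ?e)) = card (F g (r mod ?e) \<inter> S) + card (F g (r mod ?e) \<inter> - S)"
      using card_Int_Diff[OF finF] by (simp only: Diff_eq)
    moreover have "int (card (F g (r mod ?e))) = a"
      unfolding F_def that(1) using card_residue_class[OF e] that(2) by simp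
    ultimately show ?thesis by (simp only: U)
  qed
  have pos: "U g S (z mod ?e) \<ge> 1" if "g > 0" "periodic g S" "z \<in> S" "?e dvd g" for g S z
  proof -
    have "z mod g \<in> F g (z mod ?e) \<inter> S"
      using that by (simp add: F_def periodic_mod mod_mod_cancel)
    then have "F g (z mod ?e) \<inter> S \<noteq> {}" by blast
    then have "card (F g (z mod ?e) \<inter> S) > 0" using finF by (meson card_gt_0_iff finite_Int)
    then show ?thesis by (simp only: U)
  qed
  have pc: "periodic g (- S)" if "periodic g S" for g S using that by (auto simp: periodic_def)
  have b1: "U g1 (- C1) r * U g2 C2 r \<le> int (cnt (C2 - C1) 0 ?l)" for r
    using crt_card_le[OF g pc[OF p(1)] p(2), of r]
    by (simp add: U_def Diff_eq Int_commute of_nat_mult[symmetric] del: of_nat_mult)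
  have b2: "U g1 C1 r * U g2 (- C2) r \<le> int (cnt (C1 - C2) 0 ?l)" for r
    using crt_card_le[OF g p(1) pc[OF p(2)], of r]
    by (simp add: U_def Diff_eq Int_commute of_nat_mult[symmetric] del: of_nat_mult)
  have "int (cnt (C2 - C1) 0 ?l) \<le> a2 - 2" "int (cnt (C1 - C2) 0 ?l) \<le> a1 - 2" using neg m by auto
  then show False
    using grid_arith[of "U g1 C1 (x mod ?e)" "U g2 (- C2) (x mod ?e)" "U g1 (- C1) (y mod ?e)" "U g2 C2 (y mod ?e)"
      "U g2 C2 (x mod ?e)" "U g1 (- C1) (x mod ?e)" "U g1 C1 (y mod ?e)" "U g2 (- C2) (y mod ?e)" a1 a2]
      b1[of "x mod ?e"] b2[of "x mod ?e"] b1[of "y mod ?e"] b2[of "y mod ?e"]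
      compl[OF a1 apos(1), of C1 x] compl[OF a1 apos(1), of C1 y]
      compl[OF a2 apos(2), of C2 x] compl[OF a2 apos(2), of C2 y]
      pos[OF g(2) p(2) x(1)] pos[OF g(1) pc[OF p(1)], of x] pos[OF g(1) p(1) y(1)] pos[OF g(2) pc[OF p(2)], of y] x y
    by (auto simp: U_def)
qed

text \<open>Lets the sets found around single points be glued while the common lower bound
  \<open>N\<close> is kept. If neither set contains the other, the lcm serves as the new
  period.\<close>

lemma periodic_union:
  fixes n N :: int
  assumes n: "n > 0" and g: "g1 > 0" "g2 > 0" "g1 dvd n" "g2 dvd n"
    and p: "periodic g1 C1" "periodic g2 C2"
    and N: "N \<le> int (cnt C1 0 n) + n div g1" "N \<le> int (cnt C2 0 n) + n div g2"
  shows "\<exists>g>0. g dvd n \<and> periodic g (C1 \<union> C2) \<and> N \<le> int (cnt (C1 \<union> C2) 0 n) + n div g"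
proof (cases "C1 \<subseteq> C2 \<or> C2 \<subseteq> C1")
  case True
  then show ?thesis using assms by (metis Un_absorb1 Un_absorb2)
next
  case False
  then obtain x y where xy: "x \<in> C2" "x \<notin> C1" "y \<in> C1" "y \<notin> C2" by blast
  let ?l = "lcm g1 g2"
  have l: "?l > 0" using g by (simp add: lcm_pos_int)
  have ln: "?l dvd n" using g by simp
  then obtain k where k: "n = ?l * k" by (rule dvdE)
  have kpos: "k > 0" using k n l by (metis zero_less_mult_pos)
  have pl: "periodic ?l C1" "periodic ?l C2" using p periodic_dvd dvd_lcm1 dvd_lcm2 by blast+
  then have pU: "periodic ?l (C1 \<union> C2)" by (auto simp: periodic_def)
  have sc: "int (cnt S 0 n) = k * int (cnt S 0 ?l)" if "periodic ?l S" for S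
    using cnt_periodic_mult[OF that l, of "nat k"] k kpos by simp
  have dv: "n div g = k * (?l div g)" if "g dvd ?l" for g
    using k that by (metis div_mult_swap mult.commute)
  have nl: "n div ?l = k" using k l by (metis nonzero_mult_div_cancel_left order_less_irrefl)
  have c1: "int (cnt (C1 \<union> C2) 0 ?l) = int (cnt C1 0 ?l) + int (cnt (C2 - C1) 0 ?l)"
    using cnt_Un_Diff[of C1 C2 0 ?l] by simp
  have c2: "int (cnt (C1 \<union> C2) 0 ?l) = int (cnt C2 0 ?l) + int (cnt (C1 - C2) 0 ?l)"
    using cnt_Un_Diff[of C2 C1 0 ?l] by (simp add: Un_commute)
  have "N \<le> k * (int (cnt (C1 \<union> C2) 0 ?l) + 1)"
    using periodic_Un_lcm[OF g(1,2) p xy]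
  proof
    assume "?l div g1 - 1 \<le> int (cnt (C2 - C1) 0 ?l)"
    then have "k * (int (cnt C1 0 ?l) + ?l div g1) \<le> k * (int (cnt (C1 \<union> C2) 0 ?l) + 1)"
      using c1 kpos by (intro mult_left_mono) auto
    then show ?thesis using N(1) sc[OF pl(1)] dv[OF dvd_lcm1] by (simp add: distrib_left)
  next
    assume "?l div g2 - 1 \<le> int (cnt (C1 - C2) 0 ?l)"
    then have "k * (int (cnt C2 0 ?l) + ?l div g2) \<le> k * (int (cnt (C1 \<union> C2) 0 ?l) + 1)"
      using c2 kpos by (intro mult_left_mono) auto
    then show ?thesis using N(2) sc[OF pl(2)] dv[OF dvd_lcm2] by (simp add: distrib_left)
  qed
  then show ?thesis using l ln pU sc[OF pU] nl by (intro exI[of _ ?l]) (simp add: distrib_left)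
qed

text \<open>Each point of \<open>A + B\<close> lies in a set as in \<open>kneser_point\<close>;
  finitely many of them meet all residues modulo \<open>n\<close> and are joined by
  \<open>periodic_union\<close>. The \<open>g\<close> obtained is some period of the sum, perhaps
  not the least.\<close>

lemma kneser_weak:
  fixes A B :: "int set"
  assumes n: "n > 0" and A: "periodic n A" "A \<noteq> {}" and B: "periodic n B" "B \<noteq> {}"
  shows "\<exists>g>0. g dvd n \<and> periodic g (A + B) \<and>
    int (cnt A 0 n) + int (cnt B 0 n) \<le> int (cnt (A + B) 0 n) + n div g"
proof -
  let ?N = "int (cnt A 0 n) + int (cnt B 0 n)"
  define good where "good C \<longleftrightarrow> C \<subseteq> A + B \<and> (\<exists>g>0. g dvd n \<and> periodic g C \<and> ?N \<le> int (cnt C 0 n) + n div g)" for C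
  have goodU: "good (C1 \<union> C2)" if "good C1" "good C2" for C1 C2
    using that periodic_union[OF n] unfolding good_def by (metis Un_least)
  have pt: "\<exists>C. good C \<and> s \<in> C" if sAB: "s \<in> A + B" for s
  proof -
    obtain a b where s: "s = a + b" "a \<in> A" "b \<in> B" using sAB by (auto elim: set_plus_elim)
    then show ?thesis using kneser_point[OF n A(1) B(1) s(2,3)] unfolding good_def by blast
  qed
  have pAB: "periodic n (A + B)"
    unfolding periodic_def
  proof safe
    fix x assume "x \<in> A + B"
    then obtain a b where "x = a + b" "a \<in> A" "b \<in> B" by (auto elim!: set_plus_elim)
    then have "x + n = (a + n) + b" "a + n \<in> A" using A by (auto simp: periodic_def)
    then show "x + n \<in> A + B" using \<open>b \<in> B\<close> by (metis set_plus_intro)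
  next
    fix x assume "x + n \<in> A + B"
    then obtain a b where ab: "x + n = a + b" "a \<in> A" "b \<in> B" by (auto elim!: set_plus_elim)
    then have "a - n \<in> A" using A(1)[unfolded periodic_def, rule_format, of "a - n"] by simp
    moreover have "x = (a - n) + b" using ab by simp
    ultimately show "x \<in> A + B" using ab by (metis set_plus_intro)
  qed
  have fin: "\<exists>C. good C \<and> F \<subseteq> C" if "finite F" "F \<noteq> {}" "F \<subseteq> A + B" for F
    using that
  proof (induction F rule: finite_ne_induct)
    case (singleton x)
    then show ?case using pt by auto
  next
    case (insert x F)
    then obtain C1 C2 where "good C1" "x \<in> C1" "good C2" "F \<subseteq> C2" using pt by (metis insert_subset)
    then show ?case using goodU by (intro exI[of _ "C1 \<union> C2"]) auto
  qed
  obtain a b where "a \<in> A" "b \<in> B" using A B by blast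
  then have "(a + b) mod n \<in> A + B" using periodic_mod[OF pAB] by blast
  then have "(a + b) mod n \<in> (A + B) \<inter> {0..<n}" using n by simp
  then obtain C where C: "good C" "(A + B) \<inter> {0..<n} \<subseteq> C" using fin[of "(A + B) \<inter> {0..<n}"] by blast
  then obtain g where g: "g > 0" "g dvd n" "periodic g C" "?N \<le> int (cnt C 0 n) + n div g" by (auto simp: good_def)
  have "C = A + B"
  proof
    show "C \<subseteq> A + B" using C by (simp add: good_def)
    show "A + B \<subseteq> C"
    proof
      fix x assume "x \<in> A + B"
      then have "x mod n \<in> C" using C(2) periodic_mod[OF pAB] n by auto
      then show "x \<in> C" using periodic_mod[OF periodic_dvd[OF g(3,2)]] by blast
    qed
  qed
  then show ?thesis using g by blast
qed

lemma card_mod_image: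
  assumes "g > 0"
  shows "periodic g {x. \<exists>a\<in>A. g dvd x - a}" "cnt {x. \<exists>a\<in>A. g dvd x - a} 0 g = card ((\<lambda>x. x mod g) ` A)"
proof -
  show "periodic g {x. \<exists>a\<in>A. g dvd x - a}"
    by (simp add: periodic_def diff_add_eq[symmetric])
  have "{x. \<exists>a\<in>A. g dvd x - a} \<inter> {0..<g} = (\<lambda>x. x mod g) ` A"
    using assms by (auto simp: mod_eq_dvd_iff[symmetric])
  then show "cnt {x. \<exists>a\<in>A. g dvd x - a} 0 g = card ((\<lambda>x. x mod g) ` A)"
    by (simp add: cnt_def)
qed

text \<open>Apply \<open>kneser_weak\<close> with \<open>n = g\<close> to the sets filled up modulo
  \<open>g\<close>, whose sum is still \<open>A + B\<close>. The resulting period divides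
  \<open>g\<close> and is a multiple of \<open>g\<close>, so the stabiliser term is
  \<open>1\<close>.\<close>

theorem kneser_mod:
  fixes A B :: "int set"
  assumes g: "g > 0" and ne: "A \<noteq> {}" "B \<noteq> {}"
    and per: "\<And>h. periodic h (A + B) \<longleftrightarrow> g dvd h"
  shows "card ((\<lambda>x. x mod g) ` A) + card ((\<lambda>x. x mod g) ` B) \<le> card ((\<lambda>x. x mod g) ` (A + B)) + 1"
proof -
  define sat where "sat S = {x. \<exists>a\<in>S. g dvd x - a}" for S :: "int set"
  have sub: "S \<subseteq> sat S" for S by (force simp: sat_def)
  have p: "periodic g (A + B)" using per by simp
  have "sat A + sat B \<subseteq> A + B"
  proof
    fix s assume "s \<in> sat A + sat B"
    then obtain x y a b where s: "s = x + y" "a \<in> A" "b \<in> B" "g dvd x - a" "g dvd y - b"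
      by (auto elim!: set_plus_elim simp: sat_def)
    then have "g dvd (x - a) + (y - b)" by auto
    then have "g dvd s - (a + b)" using s(1) by (simp add: algebra_simps)
    then show "s \<in> A + B" using periodic_dvd_diff[OF p] s by blast
  qed
  then have eq: "sat A + sat B = A + B" by (rule antisym) (rule set_plus_mono2[OF sub sub])
  have satAB: "sat (A + B) = A + B"
    using sub periodic_dvd_diff[OF p] by (auto simp: sat_def)
  have "\<exists>g'>0. g' dvd g \<and> periodic g' (A + B) \<and>
      int (cnt (sat A) 0 g) + int (cnt (sat B) 0 g) \<le> int (cnt (A + B) 0 g) + g div g'"
    using kneser_weak[OF g, of "sat A" "sat B"] card_mod_image(1)[OF g] ne sub unfolding sat_def[symmetric] eq
    by blast
  then obtain g' where g': "g' > 0" "g' dvd g" "g dvd g'"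
    "int (cnt (sat A) 0 g) + int (cnt (sat B) 0 g) \<le> int (cnt (A + B) 0 g) + g div g'" using per by blast
  then have "g' = g" using g zdvd_antisym_abs[of g g'] by simp
  then show ?thesis
    using g' g card_mod_image(2)[OF g, of A] card_mod_image(2)[OF g, of B] card_mod_image(2)[OF g, of "A + B"] satAB
    by (simp add: sat_def)
qed

section \<open>Sums of equidistributed sets\<close>

lemma cnt_window_sum:
  assumes "w \<ge> 0"
  shows "cnt S a (a + w * int k) = (\<Sum>i<k. cnt S (a + w * int i) (a + w * int (Suc i)))"
proof (induction k)
  case (Suc k)
  have "cnt S a (a + w * int (Suc k)) = cnt S a (a + w * int k) + cnt S (a + w * int k) (a + w * int (Suc k))"
    using assms by (intro cnt_split) (auto simp: algebra_simps)
  then show ?case using Suc by simp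
qed (simp add: cnt_def)

lemma cnt_shift_ge: "int (cnt S p q) - \<bar>e\<bar> \<le> int (cnt S (p - e) (q - e))"
proof -
  have "S \<inter> {p..<q} \<subseteq> (S \<inter> {p - e..<q - e}) \<union> (if e \<ge> 0 then {q - e..<q} else {p..<p - e})" by auto
  then have "cnt S p q \<le> card ((S \<inter> {p - e..<q - e}) \<union> (if e \<ge> 0 then {q - e..<q} else {p..<p - e}))"
    unfolding cnt_def by (intro card_mono) auto
  also have "\<dots> \<le> cnt S (p - e) (q - e) + card (if e \<ge> 0 then {q - e..<q} else {p..<p - e})"
    unfolding cnt_def by (rule card_Un_le)
  finally show ?thesis by (auto split: if_splits)
qed

lemma cnt_residue_mult:
  fixes g :: int
  assumes "g > 0"
  shows "cnt {x. g dvd x - c} a (a + g * int k) = k"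
proof -
  let ?P = "{x. g dvd x - c}"
  have p: "periodic g ?P" by (simp add: periodic_def diff_add_eq[symmetric])
  have "x = c" if "g dvd x - c" "c \<le> x" "x < c + g" for x
    using zdvd_not_zless[of "x - c" g] that by force
  then have "?P \<inter> {c..<c + g} = {c}" using assms by auto
  then have "cnt ?P c (c + g) = 1" by (simp add: cnt_def)
  then have one: "cnt ?P b (b + g) = 1" for b
    using cnt_periodic_window[OF p assms, of b] cnt_periodic_window[OF p assms, of c] by simp
  have "cnt ?P (a + g * int i) (a + g * int (Suc i)) = 1" for i
    using one[of "a + g * int i"] by (simp add: algebra_simps)
  then show ?thesis using cnt_window_sum[of g ?P a k] assms by simp
qed

lemma cnt_residue_le:
  fixes g l :: int
  assumes "g > 0" "l \<ge> 0"
  shows "real (cnt {x. g dvd x - c} a (a + l)) \<le> l / g + 1"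
proof -
  let ?q = "nat (l div g + 1)"
  have q: "int ?q = l div g + 1" using assms by (simp add: pos_imp_zdiv_nonneg_iff)
  have "l \<le> g * (l div g + 1)"
    using pos_mod_bound[OF assms(1), of l] mult_div_mod_eq[of g l]
    unfolding distrib_left mult_1_right by linarith
  then have "cnt {x. g dvd x - c} a (a + l) \<le> cnt {x. g dvd x - c} a (a + g * int ?q)"
    using q by (intro cnt_mono_window) auto
  also have "\<dots> = ?q" by (rule cnt_residue_mult[OF assms(1)])
  finally have "int (cnt {x. g dvd x - c} a (a + l)) \<le> l div g + 1" using q by linarith
  then have "real (cnt {x. g dvd x - c} a (a + l)) \<le> real_of_int (l div g) + 1" by linarith
  also have "real_of_int (l div g) \<le> l / g" by (rule real_of_int_div4)
  finally show ?thesis by simp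
qed

text \<open>A class modulo \<open>g\<close> contains \<open>k\<close> disjoint classes modulo
  \<open>Q\<close>. Thus equidistribution modulo one highly divisible \<open>Q\<close> gives it
  modulo every divisor.\<close>

lemma cnt_residue_refine:
  fixes g :: int
  assumes g: "g > 0" and d: "Q = g * int k"
    and lb: "\<And>m. real (cnt (X \<inter> {x. Q dvd x - m}) p q) \<ge> t" and Q: "Q > 0"
  shows "real (cnt (X \<inter> {x. g dvd x - c}) p q) \<ge> k * t"
proof -
  let ?S = "\<lambda>j::nat. (X \<inter> {x. Q dvd x - (c + g * int j)}) \<inter> {p..<q}"
  have disj: "disjoint_family_on ?S {..<k}"
    unfolding disjoint_family_on_def
  proof (intro ballI impI equals0I)
    fix i j x assume ij: "i \<in> {..<k}" "j \<in> {..<k}" "i \<noteq> j" and "x \<in> ?S i \<inter> ?S j"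
    then have "Q dvd x - (c + g * int i)" "Q dvd x - (c + g * int j)" by auto
    then have "Q dvd (x - (c + g * int i)) - (x - (c + g * int j))" by (rule dvd_diff)
    then have "g * int k dvd g * (int j - int i)" unfolding d by (simp add: algebra_simps)
    then have "int k dvd int j - int i" using g by simp
    then show False using ij by (metis abs_of_nat dvd_imp_le_int lessThan_iff linorder_not_less mod_eq_dvd_iff mod_pos_pos_trivial of_nat_0_le_iff of_nat_eq_iff of_nat_less_iff zmod_int)
  qed
  have sub: "(\<Union>j<k. ?S j) \<subseteq> (X \<inter> {x. g dvd x - c}) \<inter> {p..<q}"
  proof
    fix x assume "x \<in> (\<Union>j<k. ?S j)"
    then obtain j where x: "x \<in> X" "x \<in> {p..<q}" "Q dvd x - (c + g * int j)" by auto
    have "g dvd x - (c + g * int j)" using x(3) unfolding d by (rule dvd_mult_left)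
    then have "g dvd (x - (c + g * int j)) + g * int j" by (intro dvd_add) auto
    then show "x \<in> (X \<inter> {x. g dvd x - c}) \<inter> {p..<q}" using x by simp
  qed
  have "real k * t \<le> (\<Sum>j<k. real (card (?S j)))"
    using sum_bounded_below[of "{..<k}" t "\<lambda>j. real (card (?S j))"] lb unfolding cnt_def by simp
  also have "\<dots> = real (card (\<Union>j<k. ?S j))"
    using disj by (subst card_UN_disjoint) (auto simp: disjoint_family_on_def)
  also have "\<dots> \<le> real (cnt (X \<inter> {x. g dvd x - c}) p q)"
    unfolding cnt_def using sub by (intro of_nat_mono card_mono) auto
  finally show ?thesis .
qed

text \<open>Points of \<open>Y\<close> without another point of \<open>Y\<close> at distance
  \<open>1\<close> to \<open>M\<close> above them lie in different blocks of length
  \<open>M\<close>, so there are at most \<open>h / M + 1\<close>. The others are shared among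
  \<open>M\<close> distances.\<close>

lemma popular_difference:
  fixes Y :: "int set"
  assumes Y: "Y \<subseteq> {u..<u + h}" and M: "M > 0" and h: "h \<ge> 0"
  shows "\<exists>g\<in>{1..int M}. real (card Y) - (h / M + 1) \<le> M * real (card {y \<in> Y. y + g \<in> Y})"
proof -
  define Z where "Z = {y \<in> Y. \<forall>g\<in>{1..int M}. y + g \<notin> Y}"
  have inj: "inj_on (\<lambda>y. (y - u) div int M) Z"
  proof (rule inj_onI, rule ccontr)
    fix x y assume xy: "x \<in> Z" "y \<in> Z" "(x - u) div int M = (y - u) div int M" "x \<noteq> y"
    have key: False if "x \<in> Z" "y \<in> Z" "x < y" "(x - u) div int M = (y - u) div int M" for x y
    proof -
      have "y - x < int M"
        using that(4) M mult_div_mod_eq[of "int M" "x - u"] mult_div_mod_eq[of "int M" "y - u"]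
          pos_mod_bound[of "int M" "y - u"] pos_mod_sign[of "int M" "x - u"]
        unfolding that(4) by linarith
      then have "y - x \<in> {1..int M}" using that by simp
      then have "x + (y - x) \<notin> Y" using that(1) unfolding Z_def by blast
      then show False using that(2) by (simp add: Z_def)
    qed
    show False using key[of x y] key[of y x] xy by (metis linorder_neqE)
  qed
  have "(\<lambda>y. (y - u) div int M) ` Z \<subseteq> {0..h div int M}"
  proof (rule image_subsetI)
    fix y assume "y \<in> Z"
    then have "y \<in> {u..<u + h}" using Y by (auto simp: Z_def)
    then have "0 \<le> y - u" "y - u \<le> h" by auto
    then show "(y - u) div int M \<in> {0..h div int M}"
      using M by (simp add: pos_imp_zdiv_nonneg_iff zdiv_mono1)
  qed
  then have "card ((\<lambda>y. (y - u) div int M) ` Z) \<le> card {0..h div int M}" by (intro card_mono) auto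
  then have "card Z \<le> card {0..h div int M}" by (simp add: card_image[OF inj])
  also have "\<dots> = nat (h div int M + 1)" by simp
  finally have "card Z \<le> nat (h div int M + 1)" .
  moreover have "0 \<le> h div int M" using h M by (simp add: pos_imp_zdiv_nonneg_iff)
  ultimately have "int (card Z) \<le> h div int M + 1" by linarith
  then have "real (card Z) \<le> real_of_int (h div int M) + 1" by linarith
  also have "real_of_int (h div int M) \<le> h / M" using real_of_int_div4[of h "int M"] by simp
  finally have Z: "real (card Z) \<le> h / M + 1" by simp
  have YZ: "Z \<union> (\<Union>g\<in>{1..int M}. {y \<in> Y. y + g \<in> Y}) = Y" by (auto simp: Z_def)
  have "card Y \<le> card Z + card (\<Union>g\<in>{1..int M}. {y \<in> Y. y + g \<in> Y})"
    using card_Un_le[of Z "\<Union>g\<in>{1..int M}. {y \<in> Y. y + g \<in> Y}"] unfolding YZ .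
  also have "card (\<Union>g\<in>{1..int M}. {y \<in> Y. y + g \<in> Y}) \<le> (\<Sum>g\<in>{1..int M}. card {y \<in> Y. y + g \<in> Y})"
    by (rule card_UN_le) simp
  finally have "real (card Y) \<le> real (card Z) + (\<Sum>g\<in>{1..int M}. real (card {y \<in> Y. y + g \<in> Y}))"
    by (simp only: of_nat_sum[symmetric] of_nat_add[symmetric] of_nat_le_iff)
  then have le: "real (card Y) - (h / M + 1) \<le> (\<Sum>g\<in>{1..int M}. real (card {y \<in> Y. y + g \<in> Y}))"
    using Z by linarith
  show ?thesis
  proof (rule ccontr)
    assume "\<not> ?thesis"
    then have *: "\<And>g. g \<in> {1..int M} \<Longrightarrow> real (card {y \<in> Y. y + g \<in> Y}) < (real (card Y) - (h / M + 1)) / M"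
      using M by (auto simp: field_simps not_le)
    have "(\<Sum>g\<in>{1..int M}. real (card {y \<in> Y. y + g \<in> Y})) < (\<Sum>g\<in>{1..int M}. (real (card Y) - (h / M + 1)) / M)"
      using M by (intro sum_strict_mono *) auto
    then show False using le M by simp
  qed
qed

lemma sum_card_swap:
  assumes "finite S" "finite T"
  shows "(\<Sum>e\<in>S. real (card {y \<in> T. P y e})) = (\<Sum>y\<in>T. real (card {e \<in> S. P y e}))"
proof -
  have "real (card {y \<in> T. P y e}) = (\<Sum>y\<in>T. of_bool (P y e))" for e
    using assms by (simp add: sum.If_cases Int_def flip: of_nat_sum)
  moreover have "real (card {e \<in> S. P y e}) = (\<Sum>e\<in>S. of_bool (P y e))" for y
    using assms by (simp add: sum.If_cases Int_def flip: of_nat_sum)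
  ultimately show ?thesis by (simp add: sum.swap[of _ S T])
qed

text \<open>The shifts \<open>e\<close> with \<open>Y + e\<close> almost contained in \<open>X\<close> are closed under adding a popular difference \<open>g\<close> of
  \<open>Y\<close>, and equidistribution of \<open>X\<close> modulo \<open>g\<close> supplies one in every class. Hence all short shifts are of this kind, and \<open>X\<close> is
  nearly full wherever \<open>Y\<close> is not empty.\<close>

lemma saturation:
  fixes X Y :: "int set" and u W :: int and L M :: nat and K D \<sigma> \<kappa> :: real
  assumes Y: "Y \<subseteq> {u..<u + W * int L}" and W: "W > 0" and M: "M > 0" "int M \<le> W"
    and K: "K > 0" and \<kappa>: "\<kappa> > 0"
    and dich: "\<And>e. \<bar>e\<bar> \<le> W \<Longrightarrow> real (card {y \<in> Y. y + e \<in> X}) < K \<or>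
      real (card Y) - K < real (card {y \<in> Y. y + e \<in> X})"
    and pop: "2 * K * M + (W * L / M + 1) \<le> real (card Y)"
    and equi: "\<And>j g c. j < L \<Longrightarrow> g \<in> {1..int M} \<Longrightarrow>
      \<sigma> * W / g \<le> real (cnt (X \<inter> {x. g dvd x - c}) (u + W * int j) (u + W * int (Suc j)))"
    and \<sigma>: "4 * K < \<sigma> * card Y"
    and D: "\<And>j. j < L \<Longrightarrow> D * W \<le> real (cnt X (u + W * int j) (u + W * int (Suc j))) +
      real (cnt Y (u + W * int j) (u + W * int (Suc j)))"
  shows "(min 1 D - \<kappa>) * (W * L) \<le> real (cnt X u (u + W * int L)) + 3 * K / \<kappa>"
proof -
  have finY: "finite Y" using Y finite_subset by blast
  have fin: "finite {y \<in> Y. P y}" for P using finY by simp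
  have compl: "real (card Y) = real (card {y \<in> Y. P y}) + real (card {y \<in> Y. \<not> P y})" for P
  proof -
    have "{y \<in> Y. P y} \<union> {y \<in> Y. \<not> P y} = Y" by blast
    moreover have "card ({y \<in> Y. P y} \<union> {y \<in> Y. \<not> P y}) = card {y \<in> Y. P y} + card {y \<in> Y. \<not> P y}"
      by (rule card_Un_disjoint[OF fin fin]) blast
    ultimately show ?thesis by simp
  qed
  define E where "E e \<longleftrightarrow> real (card Y) - K < real (card {y \<in> Y. y + e \<in> X})" for e
  have out: "real (card {y \<in> Y. y + e \<notin> X}) < K" if "E e" for e
    using compl[of "\<lambda>y. y + e \<in> X"] that unfolding E_def by linarith
  obtain g where g: "g \<in> {1..int M}"
    and pd: "real (card Y) - (W * L / M + 1) \<le> M * real (card {y \<in> Y. y + g \<in> Y})"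
    using popular_difference[OF Y M(1)] W by auto
  have "M * (2 * K) = 2 * K * M" by simp
  then have "M * (2 * K) \<le> M * real (card {y \<in> Y. y + g \<in> Y})" using pop pd by linarith
  then have gY: "2 * K \<le> real (card {y \<in> Y. y + g \<in> Y})" using M by simp
  define Yg where "Yg = {y \<in> Y. y + g \<in> Y}"
  have Yg: "Yg \<subseteq> Y" "finite Yg" using finY by (auto simp: Yg_def)
  have complg: "real (card Yg) = real (card {y \<in> Yg. P y}) + real (card {y \<in> Yg. \<not> P y})" for P
  proof -
    have "{y \<in> Yg. P y} \<union> {y \<in> Yg. \<not> P y} = Yg" by blast
    moreover have "card ({y \<in> Yg. P y} \<union> {y \<in> Yg. \<not> P y}) = card {y \<in> Yg. P y} + card {y \<in> Yg. \<not> P y}"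
      using Yg(2) by (intro card_Un_disjoint) auto
    ultimately show ?thesis by simp
  qed
  \<comment> \<open>Of at least \<open>2 * K\<close> points \<open>y\<close> with \<open>y\<close>
    and \<open>y + g\<close> in \<open>Y\<close>, fewer than \<open>K\<close> are lost because
    \<open>Y + e\<close> leaves \<open>X\<close>. So \<open>e + g\<close> carries more than
    \<open>K\<close> points into \<open>X\<close>, and \<open>dich\<close> leaves only the dense
    alternative.\<close>
  have up: "E (e + g)" if "E e" "\<bar>e + g\<bar> \<le> W" for e
  proof -
    have "card {y \<in> Yg. \<not> y + g + e \<in> X} \<le> card {y \<in> Y. y + e \<notin> X}"
      by (rule card_inj_on_le[of "\<lambda>y. y + g", OF _ _ fin]) (auto simp: inj_on_def Yg_def)
    moreover have "card {y \<in> Yg. y + g + e \<in> X} \<le> card {y \<in> Y. y + (e + g) \<in> X}"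
      using Yg by (intro card_mono[OF fin]) (auto simp: algebra_simps)
    ultimately have "K < real (card {y \<in> Y. y + (e + g) \<in> X})"
      using complg[of "\<lambda>y. y + g + e \<in> X"] out[OF that(1)] gY unfolding Yg_def[symmetric] by linarith
    then show ?thesis using dich[OF that(2)] unfolding E_def by linarith
  qed
  have down: "E (e - g)" if "E e" "\<bar>e - g\<bar> \<le> W" for e
  proof -
    have "card {y \<in> Yg. \<not> y + e \<in> X} \<le> card {y \<in> Y. y + e \<notin> X}"
      using Yg by (intro card_mono[OF fin]) auto
    moreover have "card {y \<in> Yg. y + e \<in> X} \<le> card {y \<in> Y. y + (e - g) \<in> X}"
      by (rule card_inj_on_le[of "\<lambda>y. y + g", OF _ _ fin]) (auto simp: inj_on_def Yg_def)
    ultimately have "K < real (card {y \<in> Y. y + (e - g) \<in> X})"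
      using complg[of "\<lambda>y. y + e \<in> X"] out[OF that(1)] gY unfolding Yg_def[symmetric] by linarith
    then show ?thesis using dich[OF that(2)] unfolding E_def by linarith
  qed
  have g0: "g > 0" "g \<le> W" using g M by auto
  have chain_up: "E (e + g * int k)" if "E e" "\<bar>e\<bar> \<le> W" "\<bar>e + g * int k\<bar> \<le> W" for e k
    using that(3)
  proof (induction k)
    case (Suc k)
    have "0 \<le> g * int k" using g0 by simp
    moreover have eq: "e + g * int (Suc k) = (e + g * int k) + g" by (simp add: algebra_simps)
    ultimately have "\<bar>e + g * int k\<bar> \<le> W" using Suc.prems that(2) g0 by linarith
    then have "E (e + g * int k + g)" using Suc eq by (intro up) metis+
    then show ?case unfolding eq .
  qed (use that in simp)
  have chain_down: "E (e - g * int k)" if "E e" "\<bar>e\<bar> \<le> W" "\<bar>e - g * int k\<bar> \<le> W" for e k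
    using that(3)
  proof (induction k)
    case (Suc k)
    have "0 \<le> g * int k" using g0 by simp
    moreover have eq: "e - g * int (Suc k) = (e - g * int k) - g" by (simp add: algebra_simps)
    ultimately have "\<bar>e - g * int k\<bar> \<le> W" using Suc.prems that(2) g0 by linarith
    then have "E (e - g * int k - g)" using Suc eq by (intro down) metis+
    then show ?case unfolding eq .
  qed (use that in simp)
  have Econg: "E e0" if Ee: "E e" "\<bar>e\<bar> \<le> W" "\<bar>e0\<bar> \<le> W" "g dvd e - e0" for e e0
  proof -
    obtain z where z: "e - e0 = g * z" using Ee(4) by (rule dvdE)
    show ?thesis
    proof (cases "z \<ge> 0")
      case True
      then have "e0 = e - g * int (nat z)" using z by simp
      then show ?thesis using chain_down Ee by metis
    next
      case False
      then have "e0 = e + g * int (nat (- z))" using z by simp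
      then show ?thesis using chain_up Ee by metis
    qed
  qed
  define I where "I j = {u + W * int j..<u + W * int (Suc j)}" for j
  have window: "\<exists>j<L. y \<in> I j" if "y \<in> Y" for y
  proof (intro exI conjI)
    have y: "0 \<le> y - u" "y - u < W * int L" using Y that by auto
    then have q: "0 \<le> (y - u) div W" using W by (simp add: pos_imp_zdiv_nonneg_iff)
    have lo: "W * ((y - u) div W) \<le> y - u" and hi: "y - u < W * ((y - u) div W) + W"
      using mult_div_mod_eq[of W "y - u"] pos_mod_bound[OF W, of "y - u"] pos_mod_sign[OF W, of "y - u"] by linarith+
    have "W * ((y - u) div W) < W * int L" using lo y(2) by (rule order_le_less_trans)
    then have "(y - u) div W < int L" using W by simp
    then show "nat ((y - u) div W) < L" using q by simp
    show "y \<in> I (nat ((y - u) div W))"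
      using q lo hi unfolding I_def by (simp add: distrib_left)
  qed
  \<comment> \<open>If \<open>e0\<close> failed, so would all short shifts in its class modulo
    \<open>g\<close>. Counting pairs with \<open>y + e \<in> X\<close> by \<open>e\<close> gives at
    most \<open>4 * W * K / g\<close>, counting by \<open>y\<close> at least
    \<open>\<sigma> * W / g\<close> for each \<open>y\<close>; this contradicts the lower bound on
    \<open>\<sigma> * card Y\<close>.\<close>
  have all: "E e0" if e0: "\<bar>e0\<bar> \<le> W" for e0
  proof (rule ccontr)
    assume "\<not> E e0"
    then have nE: "\<not> E e" if "\<bar>e\<bar> \<le> W" "g dvd e - e0" for e using Econg e0 that by blast
    define S where "S = {x. g dvd x - e0} \<inter> {- W..<- W + (2 * W + 1)}"
    have finS: "finite S" by (simp add: S_def)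
    have "real (card S) \<le> real_of_int (2 * W + 1) / g + 1"
      using cnt_residue_le[OF g0(1), of "2 * W + 1" e0 "- W"] W unfolding cnt_def S_def by simp
    also have "\<dots> = (2 * W + 1 + g) / g" using g0 by (simp add: field_simps)
    also have "\<dots> \<le> 4 * W / g" using g0 by (intro divide_right_mono) auto
    finally have cS: "real (card S) \<le> 4 * W / g" .
    have small: "real (card {y \<in> Y. y + e \<in> X}) \<le> K" if "e \<in> S" for e
    proof -
      have e: "\<bar>e\<bar> \<le> W" "g dvd e - e0" using that by (auto simp: S_def)
      then show ?thesis using dich[OF e(1)] nE[OF e] unfolding E_def by linarith
    qed
    have large: "\<sigma> * W / g \<le> real (card {e \<in> S. y + e \<in> X})" if yY: "y \<in> Y" for y
    proof -
      obtain j where j: "j < L" "y \<in> I j" using window yY by blast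
      have "cnt (X \<inter> {x. g dvd x - (y + e0)}) (u + W * int j) (u + W * int (Suc j)) \<le> card {e \<in> S. y + e \<in> X}"
        unfolding cnt_def
      proof (rule card_inj_on_le[of "\<lambda>x. x - y"])
        show "(\<lambda>x. x - y) ` (X \<inter> {x. g dvd x - (y + e0)} \<inter> {u + W * int j..<u + W * int (Suc j)}) \<subseteq> {e \<in> S. y + e \<in> X}"
          using j(2) unfolding S_def I_def by (auto simp: algebra_simps)
      qed (use finS in \<open>auto simp: inj_on_def\<close>)
      then show ?thesis using equi[OF j(1) g, of "y + e0"] by linarith
    qed
    have "real (card Y) * (\<sigma> * W / g) \<le> (\<Sum>y\<in>Y. real (card {e \<in> S. y + e \<in> X}))"
      using sum_bounded_below[of Y "\<sigma> * W / g" "\<lambda>y. real (card {e \<in> S. y + e \<in> X})"] large by simp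
    also have "\<dots> = (\<Sum>e\<in>S. real (card {y \<in> Y. y + e \<in> X}))"
      using sum_card_swap[OF finS finY, of "\<lambda>y e. y + e \<in> X"] by simp
    also have "\<dots> \<le> real (card S) * K"
      using sum_bounded_above[of S "\<lambda>e. real (card {y \<in> Y. y + e \<in> X})" K] small by simp
    also have "\<dots> \<le> 4 * W / g * K" using cS K by (intro mult_right_mono) auto
    finally have "(\<sigma> * card Y) * (W / g) \<le> (4 * K) * (W / g)" by (simp add: mult_ac)
    moreover have "real_of_int W / g > 0" using W g0 by simp
    ultimately have "\<sigma> * card Y \<le> 4 * K" by (simp only: mult_le_cancel_right_pos)
    then show False using \<sigma> by linarith
  qed
  \<comment> \<open>The number of short shifts that move \<open>y\<close> out of \<open>X\<close>.
    There are \<open>2 * W + 1 \<le> 3 * W\<close> shifts, each losing fewer than \<open>K\<close>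
    points, so the total over \<open>Y\<close> is at most \<open>3 * W * K\<close>.\<close>
  define df where "df y = real (card {e \<in> {- W..W}. y + e \<notin> X})" for y
  have "(\<Sum>y\<in>Y. df y) = (\<Sum>e\<in>{- W..W}. real (card {y \<in> Y. y + e \<notin> X}))"
    unfolding df_def using sum_card_swap[of "{- W..W}" Y "\<lambda>y e. y + e \<notin> X"] finY by simp
  also have "\<dots> \<le> real (card {- W..W}) * K"
    by (rule sum_bounded_above) (use out[OF all] in \<open>force intro: less_imp_le\<close>)
  also have "\<dots> \<le> (3 * W) * K"
    using W K by (intro mult_right_mono) auto
  finally have dfsum: "(\<Sum>y\<in>Y. df y) \<le> 3 * W * K" .
  define pos where "pos y = nat ((y - u) div W)" for y
  have posI: "pos y = j \<longleftrightarrow> y \<in> I j" if "y \<in> Y" for y j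
  proof -
    have y: "0 \<le> y - u" using Y that by auto
    have "pos y = j \<longleftrightarrow> (y - u) div W = int j"
      using y W by (auto simp: pos_def pos_imp_zdiv_nonneg_iff)
    also have "\<dots> \<longleftrightarrow> y \<in> I j"
    proof
      assume "(y - u) div W = int j"
      then show "y \<in> I j"
        using mult_div_mod_eq[of W "y - u"] pos_mod_bound[OF W, of "y - u"] pos_mod_sign[OF W, of "y - u"]
        unfolding I_def by (simp add: distrib_left)
    next
      assume "y \<in> I j"
      then show "(y - u) div W = int j"
        unfolding I_def by (intro int_div_pos_eq[of _ _ _ "y - u - W * int j"]) (auto simp: algebra_simps)
    qed
    finally show ?thesis .
  qed
  \<comment> \<open>If some \<open>y\<close> in window \<open>j\<close> has small
    \<open>df y\<close>, the window lies within distance \<open>W\<close> of \<open>y\<close>, so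
    \<open>X\<close> fills it up to \<open>\<kappa> * W\<close>. Otherwise every point of
    \<open>Y\<close> there has large \<open>df\<close>, so there are few of them, and their number
    is charged to the sum of \<open>df\<close>.\<close>
  have per: "(min 1 D - \<kappa>) * W \<le> real (cnt X (u + W * int j) (u + W * int (Suc j))) +
      (\<Sum>y\<in>{y \<in> Y. pos y = j}. df y) / (\<kappa> * W)" if j: "j < L" for j
  proof (cases "\<exists>y\<in>{y \<in> Y. pos y = j}. df y \<le> \<kappa> * W")
    case True
    then obtain y where y: "y \<in> Y" "y \<in> I j" "df y \<le> \<kappa> * W" using posI by auto
    have "card (I j - X) \<le> card {e \<in> {- W..W}. y + e \<notin> X}"
    proof (rule card_inj_on_le[of "\<lambda>x. x - y"])
      show "(\<lambda>x. x - y) ` (I j - X) \<subseteq> {e \<in> {- W..W}. y + e \<notin> X}"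
        using y(2) unfolding I_def by (auto simp: algebra_simps)
      show "finite {e \<in> {- W..W}. y + e \<notin> X}" by (rule finite_subset[of _ "{- W..W}"]) auto
    qed (auto simp: inj_on_def)
    then have "real (card (I j - X)) \<le> \<kappa> * W" using y(3) unfolding df_def by linarith
    moreover have "card (I j) = card (I j \<inter> X) + card (I j - X)"
      by (rule card_Int_Diff) (simp add: I_def)
    moreover have "card (I j) = nat W" unfolding I_def by (simp add: algebra_simps)
    moreover have "card (I j \<inter> X) = cnt X (u + W * int j) (u + W * int (Suc j))"
      by (simp add: cnt_def I_def Int_commute)
    ultimately have "W - \<kappa> * W \<le> real (cnt X (u + W * int j) (u + W * int (Suc j)))"
      using W by linarith
    moreover have "(min 1 D - \<kappa>) * W \<le> (1 - \<kappa>) * W" using W by (intro mult_right_mono) auto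
    moreover have "(\<Sum>y\<in>{y \<in> Y. pos y = j}. df y) / (\<kappa> * W) \<ge> 0"
      using W \<kappa> by (intro divide_nonneg_nonneg sum_nonneg) (auto simp: df_def)
    ultimately show ?thesis by (simp add: left_diff_distrib)
  next
    case False
    have "real (card {y \<in> Y. pos y = j}) * (\<kappa> * W) \<le> (\<Sum>y\<in>{y \<in> Y. pos y = j}. df y)"
      using sum_bounded_below[of "{y \<in> Y. pos y = j}" "\<kappa> * W" df] False by (auto simp: not_le less_imp_le)
    moreover have kW: "\<kappa> * W > 0" using W \<kappa> by simp
    ultimately have "real (card {y \<in> Y. pos y = j}) \<le> (\<Sum>y\<in>{y \<in> Y. pos y = j}. df y) / (\<kappa> * W)"
      by (simp add: pos_le_divide_eq)
    moreover have "{y \<in> Y. pos y = j} = Y \<inter> {u + W * int j..<u + W * int (Suc j)}"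
      using posI unfolding I_def by blast
    ultimately have "real (cnt Y (u + W * int j) (u + W * int (Suc j))) \<le> (\<Sum>y\<in>{y \<in> Y. pos y = j}. df y) / (\<kappa> * W)"
      unfolding cnt_def by simp
    moreover have "(min 1 D - \<kappa>) * W \<le> D * W" using W \<kappa> by (intro mult_right_mono) auto
    ultimately show ?thesis using D[OF j] by linarith
  qed
  have posL: "pos ` Y \<subseteq> {..<L}"
  proof (rule image_subsetI)
    fix y assume y: "y \<in> Y"
    then obtain j where "j < L" "y \<in> I j" using window by blast
    moreover from this(2) have "pos y = j" using posI[OF y] by blast
    ultimately show "pos y \<in> {..<L}" by simp
  qed
  have "(\<Sum>j<L. (min 1 D - \<kappa>) * W) \<le> (\<Sum>j<L. real (cnt X (u + W * int j) (u + W * int (Suc j))) +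
      (\<Sum>y\<in>{y \<in> Y. pos y = j}. df y) / (\<kappa> * W))"
    by (rule sum_mono) (use per in auto)
  also have "\<dots> = real (cnt X u (u + W * int L)) + (\<Sum>y\<in>Y. df y) / (\<kappa> * W)"
    using cnt_window_sum[of W X u L] W sum.group[OF finY _ posL, of df]
    by (simp add: sum.distrib sum_divide_distrib[symmetric])
  also have "(\<Sum>y\<in>Y. df y) / (\<kappa> * W) \<le> 3 * W * K / (\<kappa> * W)"
    using dfsum W \<kappa> by (intro divide_right_mono) auto
  also have "3 * W * K / (\<kappa> * W) = 3 * K / \<kappa>" using W by simp
  finally show ?thesis by (simp add: mult_ac)
qed

text \<open>A Dyson transform keeps the sum of the two counting functions and shrinks \<open>Y\<close>; iterate it, at coarser
  and coarser scales, as long as it shrinks \<open>Y\<close> by a fixed proportion. When this stops, either \<open>Y\<close> has become negligible, so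
  that \<open>X\<close> has density \<open>a + b\<close>, or the hypotheses of the previous lemma are met.\<close>

lemma equidistributed_sumset:
  fixes \<epsilon> :: real
  assumes \<epsilon>: "0 < \<epsilon>" "\<epsilon> \<le> 1"
  obtains Q T w0 :: nat and \<theta> :: real where "Q > 0" "T > 0" "\<theta> > 0"
    "\<And>X0 Y0 C u a b c w. \<lbrakk>w \<ge> w0; \<And>x y. x \<in> X0 \<Longrightarrow> y \<in> Y0 \<Longrightarrow> x + y \<in> C; \<epsilon> \<le> a; a \<le> 1; \<epsilon> \<le> b; b \<le> 1;
      \<And>i m. i < T \<Longrightarrow> (a - \<theta>) * real w / real Q \<le>
        real (cnt (X0 \<inter> {x. int Q dvd x - m}) (u + int w * int i) (u + int w * int (Suc i)));
      \<And>i. i < T \<Longrightarrow> (b - \<theta>) * real w \<le> real (cnt Y0 (u + int w * int i) (u + int w * int (Suc i)));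
      \<And>i. i < T \<Longrightarrow> real (cnt C (2 * u + 2 * int w * int i) (2 * u + 2 * int w * int (Suc i))) \<le> (c + \<theta>) * (2 * real w)\<rbrakk>
      \<Longrightarrow> min 1 (a + b) - \<epsilon> \<le> c"
proof -
  \<comment> \<open>\<open>\<kappa>1\<close> is the density below which \<open>Y\<close> is
    negligible, \<open>M\<close> the range of popular differences, \<open>\<kappa>\<close> the share
    of \<open>h\<close> that a transform must remove from \<open>Y\<close>, \<open>R\<close> the
    ratio of successive scales, \<open>N\<close> a bound on the number of transforms.
    \<open>Q = M!\<close> is divisible by every popular difference, and \<open>T\<close> leaves room
    for \<open>N + 1\<close> coarsenings.\<close>
  define \<kappa>1 where "\<kappa>1 = \<epsilon> / 8"
  define M where "M = nat \<lceil>4 / \<kappa>1\<rceil>"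
  define \<kappa> where "\<kappa> = min (\<epsilon>\<^sup>2 / 192) (\<kappa>1 / (4 * M))"
  define R where "R = nat \<lceil>64 / \<epsilon>\<rceil>"
  define N where "N = nat \<lceil>1 / \<kappa>\<rceil>"
  define \<theta> where "\<theta> = \<epsilon> / 32"
  define Q :: nat where "Q = fact M"
  define T where "T = R ^ (N + 1)"
  have \<kappa>1: "\<kappa>1 > 0" using \<epsilon> by (simp add: \<kappa>1_def)
  have M4: "real M \<ge> 4 / \<kappa>1" unfolding M_def by linarith
  have M: "M > 0" using M4 \<kappa>1 by (metis divide_pos_pos gr0I linorder_not_less of_nat_0 zero_less_numeral)
  have \<kappa>: "\<kappa> > 0" using \<epsilon> \<kappa>1 M by (simp add: \<kappa>_def)
  have \<kappa>le: "\<kappa> \<le> \<epsilon>\<^sup>2 / 192" "\<kappa> \<le> \<kappa>1 / (4 * M)" by (auto simp: \<kappa>_def)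
  have R64: "real R \<ge> 64 / \<epsilon>" unfolding R_def by linarith
  have "64 \<le> 64 / \<epsilon>" using \<epsilon> by (simp add: field_simps)
  then have R2: "R \<ge> 64" using R64 by linarith
  have N: "1 / \<kappa> \<le> N" unfolding N_def by linarith
  have \<theta>: "\<theta> > 0" using \<epsilon> by (simp add: \<theta>_def)
  have Q: "Q > 0" by (simp add: Q_def)
  have T: "T > 0" using R2 by (simp add: T_def)
  have main: "min 1 (a + b) - \<epsilon> \<le> c"
    if w: "w \<ge> M" and XYC: "\<And>x y. x \<in> X0 \<Longrightarrow> y \<in> Y0 \<Longrightarrow> x + y \<in> C"
      and ab: "\<epsilon> \<le> a" "a \<le> 1" "\<epsilon> \<le> b" "b \<le> 1"
      and Xlb: "\<And>i m. i < T \<Longrightarrow> (a - \<theta>) * real w / real Q \<le>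
        real (cnt (X0 \<inter> {x. int Q dvd x - m}) (u + int w * int i) (u + int w * int (Suc i)))"
      and Ylb: "\<And>i. i < T \<Longrightarrow> (b - \<theta>) * real w \<le> real (cnt Y0 (u + int w * int i) (u + int w * int (Suc i)))"
      and Cub: "\<And>i. i < T \<Longrightarrow> real (cnt C (2 * u + 2 * int w * int i) (2 * u + 2 * int w * int (Suc i))) \<le> (c + \<theta>) * (2 * real w)"
    for X0 Y0 C u a b c w
  proof -
    have wpos: "w > 0" using w M by simp
    define h where "h = int w * int T"
    have h: "h > 0" "real_of_int h = real w * real T" using wpos T by (auto simp: h_def)
    define X1 where "X1 = X0 \<inter> {u..<u + h}"
    define Y1 where "Y1 = Y0 \<inter> {u..<u + h}"
    have finY1: "finite Y1" by (simp add: Y1_def)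
    \<comment> \<open>The state after \<open>n\<close> transforms. The error in the window counts
      grows geometrically: a transform at scale \<open>w * R ^ (n + 1)\<close> shifts points by at
      most that much, and \<open>2 * w * R ^ n + w * R ^ (n + 1)\<close> is at most
      \<open>2 * w * R ^ (n + 1)\<close>.\<close>
    define Inv where "Inv n X Y \<longleftrightarrow> X1 \<subseteq> X \<and> Y \<subseteq> Y1 \<and> (\<forall>x\<in>X. \<forall>y\<in>Y. x + y \<in> C) \<and> \<kappa> * h \<le> real (card Y)
      \<and> real (card Y) + n * \<kappa> * h \<le> real (card Y1)
      \<and> (\<forall>p q. real (cnt X1 p q) + real (cnt Y1 p q) \<le> real (cnt X p q) + real (cnt Y p q) + 2 * real w * real R ^ n)"
      for n :: nat and X Y
    have coarse: "real r * t \<le> real (cnt S (u + int (w * r) * int j) (u + int (w * r) * int (Suc j)))"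
      if lb: "\<And>i. i < T \<Longrightarrow> t \<le> real (cnt S (u + int w * int i) (u + int w * int (Suc i)))"
        and rLT: "r * L = T" and jL: "j < L"
      for S t r L j
    proof -
      let ?a = "u + int (w * r) * int j"
      have "t \<le> real (cnt S (?a + int w * int i) (?a + int w * int (Suc i)))" if "i < r" for i
      proof -
        have "r * j + i < r * (j + 1)" using that by simp
        also have "\<dots> \<le> r * L" using jL by (intro mult_left_mono) auto
        finally have "r * j + i < T" using rLT by simp
        moreover have "?a + int w * int i = u + int w * int (r * j + i)"
          "?a + int w * int (Suc i) = u + int w * int (Suc (r * j + i))" by (simp_all add: algebra_simps)
        ultimately show ?thesis using lb by metis
      qed
      then have "real r * t \<le> (\<Sum>i<r. real (cnt S (?a + int w * int i) (?a + int w * int (Suc i))))"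
        using sum_bounded_below[of "{..<r}" t "\<lambda>i. real (cnt S (?a + int w * int i) (?a + int w * int (Suc i)))"] by simp
      also have "\<dots> = real (cnt S ?a (?a + int w * int r))"
        using cnt_window_sum[of "int w" S ?a r] by simp
      also have "?a + int w * int r = u + int (w * r) * int (Suc j)" by (simp add: algebra_simps)
      finally show ?thesis .
    qed
    have Xres: "(a - \<theta>) * real w / g \<le> real (cnt (X0 \<inter> {x. g dvd x - m}) (u + int w * int i) (u + int w * int (Suc i)))"
      if "i < T" "g \<in> {1..int M}" for i g m
    proof -
      have "nat g dvd fact M" using that(2) by (intro dvd_fact) auto
      then obtain k where "fact M = nat g * k" by (rule dvdE)
      then have k: "int Q = g * int k" using that(2) unfolding Q_def by (metis atLeastAtMost_iff int_nat_eq of_nat_mult zero_less_one order_trans zero_le_one)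
      then have "k > 0" using Q by (cases k) auto
      have "real_of_int g * real k = real Q" using k by (metis of_int_mult of_int_of_nat_eq)
      then have eq: "real k * ((a - \<theta>) * real w / real Q) = (a - \<theta>) * real w / g"
        using that(2) \<open>k > 0\<close> by (simp add: field_simps flip: \<open>real_of_int g * real k = real Q\<close>)
      have "real k * ((a - \<theta>) * real w / real Q) \<le> real (cnt (X0 \<inter> {x. g dvd x - m}) (u + int w * int i) (u + int w * int (Suc i)))"
        by (rule cnt_residue_refine[OF _ k]) (use Xlb[OF that(1)] that(2) Q in auto)
      then show ?thesis by (simp only: eq)
    qed
    have Xw: "(a - \<theta>) * real w \<le> real (cnt X0 (u + int w * int i) (u + int w * int (Suc i)))" if "i < T" for i
      using Xres[OF that, of 1] M by simp
    have inJ: "cnt (S \<inter> {u..<u + h}) (u + int (w * r) * int j) (u + int (w * r) * int (Suc j)) =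
      cnt S (u + int (w * r) * int j) (u + int (w * r) * int (Suc j))" if "r * L = T" "j < L" for S r L j
    proof -
      have "w * (r * Suc j) \<le> w * (r * L)" using that(2) by (intro mult_left_mono) auto
      then have "int (w * (r * Suc j)) \<le> int (w * T)" using that(1) by (simp only: of_nat_le_iff)
      moreover have "int (w * r) * int (Suc j) = int (w * (r * Suc j))" "h = int (w * T)"
        by (simp_all add: h_def algebra_simps)
      ultimately have "int (w * r) * int (Suc j) \<le> h" by metis
      moreover have "cnt (S \<inter> {u..<u + h}) (u + p) (u + q) = cnt S (u + p) (u + q)" if "0 \<le> p" "q \<le> h" for p q
        unfolding cnt_def using that by (intro arg_cong[of _ _ card]) auto
      moreover have "0 \<le> int (w * r) * int j" by (intro mult_nonneg_nonneg) auto
      ultimately show ?thesis by blast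
    qed
    have whole: "u + int (w * T) * int 0 = u" "u + int (w * T) * int (Suc 0) = u + h" by (simp_all add: h_def)
    have cX1: "(a - \<theta>) * h \<le> real (cnt X1 u (u + h))"
      using coarse[of "(a - \<theta>) * real w" X0 T 1 0] inJ[of T 1 0 X0] Xw unfolding whole X1_def h(2) by (simp add: mult_ac)
    have cY1: "(b - \<theta>) * h \<le> real (cnt Y1 u (u + h))"
      using coarse[of "(b - \<theta>) * real w" Y0 T 1 0] inJ[of T 1 0 Y0] Ylb unfolding whole Y1_def h(2) by (simp add: mult_ac)
    have cardY1: "card Y1 = cnt Y1 u (u + h)" by (simp add: cnt_def Y1_def)
    have cardY1h: "real (card Y1) \<le> h" using cnt_le[of Y1 u "u + h"] h unfolding cardY1 by simp
    have \<kappa>small: "\<kappa> \<le> \<epsilon> / 192"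
    proof -
      have "\<epsilon>\<^sup>2 \<le> \<epsilon>" using \<epsilon> by (simp add: power2_eq_square mult_left_le)
      then show ?thesis using \<kappa>le(1) by simp
    qed
    have "\<kappa> * h \<le> (b - \<theta>) * h"
      using \<kappa>small ab(3) h(1) \<epsilon> unfolding \<theta>_def by (intro mult_right_mono) auto
    then have inv0: "Inv 0 X1 Y1"
      unfolding Inv_def using cY1 cardY1 XYC by (auto simp: X1_def Y1_def)
    have bound: "n \<le> N" if "Inv n X Y" for n X Y
    proof -
      have "real n * \<kappa> * real_of_int h \<le> 1 * real_of_int h" using that cardY1h unfolding Inv_def by linarith
      then have "real n * \<kappa> \<le> 1" using h(1) by (simp only: mult_le_cancel_right_pos of_int_0_less_iff)
      then have "real n \<le> 1 / \<kappa>" using \<kappa> by (simp add: field_simps)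
      then show ?thesis using N by linarith
    qed
    \<comment> \<open>The iteration ends since each step costs \<open>Y\<close> a further
      \<open>\<kappa> * h\<close> points. That no pair satisfies \<open>Inv (Suc n)\<close> is
      precisely what gives the dichotomy for all shifts up to \<open>W\<close>.\<close>
    have "\<exists>n X Y. Inv n X Y \<and> (\<forall>X Y. \<not> Inv (Suc n) X Y)"
    proof (rule ccontr)
      assume *: "\<not> ?thesis"
      have "\<exists>X Y. Inv n X Y" for n
        by (induction n) (use * inv0 in blast)+
      then show False using bound not_less_eq_eq by blast
    qed
    then obtain n X Y where inv: "Inv n X Y" and maxn: "\<And>X Y. \<not> Inv (Suc n) X Y" by blast
    have nN: "n \<le> N" using bound inv by blast
    define r where "r = R ^ Suc n"
    define L where "L = R ^ (N - n)"
    define W where "W = int (w * r)"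
    have rL: "r * L = T" using nN unfolding r_def L_def T_def by (simp add: power_add[symmetric] flip: power_Suc)
    have WL: "W * int L = h" using rL unfolding W_def h_def by (metis mult.assoc of_nat_mult)
    have rpos: "r > 0" "L > 0" using R2 by (auto simp: r_def L_def)
    have W: "W > 0" using wpos rpos by (simp add: W_def)
    have Ww: "W \<ge> int w" using rpos mult_left_mono[of 1 "int r" "int w"] by (simp add: W_def)
    have Wh: "W \<le> h" using mult_left_mono[of 1 "int L" W] WL W rpos by simp
    have loss: "2 * real w * real R ^ n = 2 / R * W" using R2 by (simp add: W_def r_def field_simps)
    have X: "X1 \<subseteq> X" and Y: "Y \<subseteq> Y1" and XY: "\<And>x y. x \<in> X \<Longrightarrow> y \<in> Y \<Longrightarrow> x + y \<in> C" and cY: "\<kappa> * h \<le> real (card Y)"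
      and cYn: "real (card Y) + n * \<kappa> * h \<le> real (card Y1)"
      and win: "\<And>p q. real (cnt X1 p q) + real (cnt Y1 p q) \<le> real (cnt X p q) + real (cnt Y p q) + 2 * real w * real R ^ n"
      using inv unfolding Inv_def by auto
    have finY: "finite Y" using Y finY1 finite_subset by blast
    have dich: "real (card {y \<in> Y. y + e \<in> X}) < \<kappa> * h \<or> real (card Y) - \<kappa> * h < real (card {y \<in> Y. y + e \<in> X})"
      if e: "\<bar>e\<bar> \<le> W" for e
    proof (rule ccontr)
      assume neg: "\<not> ?thesis"
      define Y' where "Y' = {y \<in> Y. y + e \<in> X}"
      define X' where "X' = X \<union> {x. x - e \<in> Y}"
      have "real (cnt X1 p q) + real (cnt Y1 p q) \<le> real (cnt X' p q) + real (cnt Y' p q) + 2 * real w * real R ^ Suc n" for p q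
      proof -
        have "{x. x - e \<in> Y} - X = {x. x - e \<in> Y - Y'}" by (auto simp: Y'_def)
        then have "cnt X' p q = cnt X p q + cnt (Y - Y') (p - e) (q - e)"
          unfolding X'_def using cnt_Un_Diff[of X "{x. x - e \<in> Y}" p q] cnt_shift[of e "Y - Y'" p q] by simp
        moreover have "cnt Y p q = cnt Y' p q + cnt (Y - Y') p q"
          using cnt_Un_Diff[of Y' Y p q] by (simp add: Un_absorb1 Y'_def)
        ultimately have "int (cnt X p q) + int (cnt Y p q) \<le> int (cnt X' p q) + int (cnt Y' p q) + W"
          using cnt_shift_ge[of "Y - Y'" p q e] e by linarith
        then have "real (cnt X p q) + real (cnt Y p q) \<le> real (cnt X' p q) + real (cnt Y' p q) + W" by linarith
        moreover have "2 * real w * real R ^ n + W \<le> 2 * real w * real R ^ Suc n"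
        proof -
          have "2 * real R ^ n \<le> real R * real R ^ n" using R2 by (intro mult_right_mono) auto
          then have "real w * (2 * real R ^ n) \<le> real w * (real R * real R ^ n)" by (intro mult_left_mono) auto
          moreover have "real w * (2 * real R ^ n) = 2 * real w * real R ^ n" by simp
          moreover have "real_of_int W = real w * (real R * real R ^ n)" by (simp add: W_def r_def)
          moreover have "2 * real w * real R ^ Suc n = 2 * (real w * (real R * real R ^ n))" by simp
          ultimately show ?thesis by linarith
        qed
        ultimately show ?thesis using win[of p q] by (simp del: power_Suc)
      qed
      moreover have "x + y \<in> C" if "x \<in> X'" "y \<in> Y'" for x y
      proof (cases "x \<in> X")
        case True then show ?thesis using XY that by (simp add: Y'_def)
      next
        case False
        then have "(y + e) + (x - e) \<in> C" using that by (intro XY) (auto simp: X'_def Y'_def)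
        then show ?thesis by (simp add: add.commute)
      qed
      moreover have "X1 \<subseteq> X'" "Y' \<subseteq> Y1" using X Y by (auto simp: X'_def Y'_def)
      moreover have "\<kappa> * h \<le> real (card Y')" "real (card Y') + Suc n * \<kappa> * h \<le> real (card Y1)"
        using neg cYn unfolding Y'_def[symmetric] by (auto simp: algebra_simps)
      ultimately have "Inv (Suc n) X' Y'" unfolding Inv_def by blast
      then show False using maxn by blast
    qed
    let ?m = "min 1 (a + b)"
    have R2': "2 / real R \<le> \<epsilon> / 32" using R64 \<epsilon> R2 by (simp add: field_simps)
    \<comment> \<open>If \<open>Y\<close> is negligible, almost all of the preserved total is in
      \<open>X\<close>; otherwise \<open>saturation\<close> applies with
      \<open>K = \<kappa> * h\<close>. Either way the loss is at most
      \<open>3 * \<epsilon> / 8\<close>.\<close>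
    have lower: "(?m - 3 * \<epsilon> / 8) * h \<le> real (cnt X u (u + h))"
    proof (cases "real (card Y) < \<kappa>1 * h")
      case True
      have "cnt Y u (u + h) \<le> card Y" unfolding cnt_def using finY by (intro card_mono) auto
      moreover have "2 / real R * W \<le> 2 / real R * h" using Wh by (intro mult_left_mono) auto
      moreover have "2 / real R * h \<le> \<epsilon> / 32 * h" using R2' h(1) by (intro mult_right_mono) auto
      ultimately have "(a - \<theta>) * h + (b - \<theta>) * h \<le> real (cnt X u (u + h)) + \<kappa>1 * h + \<epsilon> / 32 * h"
        using win[of u "u + h"] cX1 cY1 True loss by (simp del: of_int_mult)
      then have "(a + b - 2 * \<theta> - \<kappa>1 - \<epsilon> / 32) * h \<le> real (cnt X u (u + h))" by (simp add: algebra_simps)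
      moreover have "(?m - 3 * \<epsilon> / 8) * h \<le> (a + b - 2 * \<theta> - \<kappa>1 - \<epsilon> / 32) * h"
        using h(1) \<epsilon> unfolding \<theta>_def \<kappa>1_def by (intro mult_right_mono) auto
      ultimately show ?thesis by linarith
    next
      case False
      let ?D = "a + b - 2 * \<theta> - 2 / R"
      have hM: "\<kappa>1 * h \<ge> 4"
      proof -
        have "real M \<le> h" using w Ww Wh by linarith
        then have "4 / \<kappa>1 \<le> h" using M4 by linarith
        then show ?thesis using \<kappa>1 by (simp add: field_simps)
      qed
      have "(min 1 ?D - \<epsilon> / 8) * (W * L) \<le> real (cnt X u (u + W * int L)) + 3 * (\<kappa> * h) / (\<epsilon> / 8)"
      proof (rule saturation[where M = M and Y = Y and \<sigma> = "\<epsilon> / 2"])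
        show "Y \<subseteq> {u..<u + W * int L}" using Y WL by (auto simp: Y1_def)
        show "int M \<le> W" using w Ww by linarith
        show "0 < \<kappa> * h" using \<kappa> h by simp
        show "2 * (\<kappa> * h) * M + (W * L / M + 1) \<le> real (card Y)"
        proof -
          have "\<kappa> * M \<le> \<kappa>1 / 4" using \<kappa>le(2) M by (simp add: field_simps)
          then have "(\<kappa> * M) * h \<le> \<kappa>1 / 4 * h" using h(1) by (intro mult_right_mono) auto
          moreover have "1 / real M \<le> \<kappa>1 / 4" using M4 M \<kappa>1 by (simp add: field_simps)
          then have "1 / real M * h \<le> \<kappa>1 / 4 * h" using h(1) by (intro mult_right_mono) auto
          moreover have "real_of_int (W * int L) / real M = 1 / real M * h" by (simp add: WL)
          moreover have "2 * (\<kappa> * h) * M = 2 * ((\<kappa> * M) * h)" by simp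
          moreover have "\<kappa>1 / 4 * h = (\<kappa>1 * h) / 4" by simp
          ultimately show ?thesis using hM False by linarith
        qed
        show "4 * (\<kappa> * h) < \<epsilon> / 2 * real (card Y)"
        proof -
          have "\<epsilon> / 2 * \<kappa>1 = \<epsilon>\<^sup>2 / 16" by (simp add: \<kappa>1_def power2_eq_square)
          moreover have "\<epsilon>\<^sup>2 > 0" using \<epsilon> by simp
          ultimately have "4 * \<kappa> < \<epsilon> / 2 * \<kappa>1" using \<kappa>le(1) by linarith
          then have "4 * \<kappa> * h < \<epsilon> / 2 * \<kappa>1 * h" using h(1) by (intro mult_strict_right_mono) auto
          also have "\<dots> = \<epsilon> / 2 * (\<kappa>1 * h)" by simp
          also have "\<dots> \<le> \<epsilon> / 2 * real (card Y)" using False \<epsilon> by (intro mult_left_mono) auto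
          finally show ?thesis by (simp only: mult.assoc)
        qed
        fix j assume j: "j < L"
        show "\<epsilon> / 2 * W / g \<le> real (cnt (X \<inter> {x. g dvd x - c}) (u + W * int j) (u + W * int (Suc j)))"
          if g: "g \<in> {1..int M}" for g c
        proof -
          have "real r * ((a - \<theta>) * real w / g) \<le> real (cnt (X0 \<inter> {x. g dvd x - c}) (u + W * int j) (u + W * int (Suc j)))"
            unfolding W_def by (rule coarse[OF Xres[OF _ g] rL j])
          also have "cnt (X0 \<inter> {x. g dvd x - c}) (u + W * int j) (u + W * int (Suc j)) =
            cnt (X0 \<inter> {x. g dvd x - c} \<inter> {u..<u + h}) (u + W * int j) (u + W * int (Suc j))"
            unfolding W_def using inJ[OF rL j] by simp
          also have "\<dots> \<le> cnt (X \<inter> {x. g dvd x - c}) (u + W * int j) (u + W * int (Suc j))"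
            using X by (intro cnt_mono) (auto simp: X1_def)
          also have "real r * ((a - \<theta>) * real w / g) = (a - \<theta>) * W / g" by (simp add: W_def)
          finally have "(a - \<theta>) * W / g \<le> real (cnt (X \<inter> {x. g dvd x - c}) (u + W * int j) (u + W * int (Suc j)))" by simp
          moreover have "\<epsilon> / 2 * W / g \<le> (a - \<theta>) * W / g"
            using ab(1) \<epsilon> W g unfolding \<theta>_def by (intro divide_right_mono mult_right_mono) auto
          ultimately show ?thesis by linarith
        qed
        show "?D * W \<le> real (cnt X (u + W * int j) (u + W * int (Suc j))) + real (cnt Y (u + W * int j) (u + W * int (Suc j)))"
        proof -
          have "real r * ((a - \<theta>) * real w) \<le> real (cnt X1 (u + W * int j) (u + W * int (Suc j)))"
            unfolding W_def X1_def inJ[OF rL j] by (rule coarse[OF Xw rL j])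
          moreover have "real r * ((b - \<theta>) * real w) \<le> real (cnt Y1 (u + W * int j) (u + W * int (Suc j)))"
            unfolding W_def Y1_def inJ[OF rL j] by (rule coarse[OF Ylb rL j])
          moreover have "real r * ((a - \<theta>) * real w) + real r * ((b - \<theta>) * real w) - 2 / R * W = ?D * W"
            by (simp add: W_def algebra_simps)
          ultimately show ?thesis using win[of "u + W * int j" "u + W * int (Suc j)"] loss by linarith
        qed
      qed (use dich W M \<epsilon> in auto)
      moreover have "real_of_int W * real L = h" using WL by (metis of_int_mult of_int_of_nat_eq)
      ultimately have 1: "(min 1 ?D - \<epsilon> / 8) * h \<le> real (cnt X u (u + h)) + 3 * (\<kappa> * h) / (\<epsilon> / 8)"
        using WL by simp
      have "3 * \<kappa> / (\<epsilon> / 8) \<le> \<epsilon> / 8" using \<kappa>le(1) \<epsilon> by (simp add: field_simps power2_eq_square)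
      then have "3 * \<kappa> / (\<epsilon> / 8) * h \<le> \<epsilon> / 8 * h" using h(1) by (intro mult_right_mono) auto
      then have "(min 1 ?D - \<epsilon> / 8) * h - \<epsilon> / 8 * h \<le> real (cnt X u (u + h))" using 1 by simp
      moreover have "(?m - 3 * \<epsilon> / 8) * h \<le> (min 1 ?D - \<epsilon> / 8 - \<epsilon> / 8) * h"
        using h(1) R2' \<epsilon> unfolding \<theta>_def by (intro mult_right_mono) (auto simp: min_def)
      ultimately show ?thesis by (simp add: left_diff_distrib)
    qed
    have "real (card Y) > 0" using cY \<kappa> h(1) by (metis mult_pos_pos of_int_0_less_iff order_less_le_trans)
    then obtain y0 where y0: "y0 \<in> Y" by (metis card.empty equals0I of_nat_0 order_less_irrefl)
    \<comment> \<open>A single element \<open>y0\<close> of \<open>Y\<close> already carries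
      \<open>X\<close> into \<open>C\<close>. The translate has length \<open>h = w * T\<close>, so
      it meets at most \<open>T / 2 + 2\<close> of the windows of length
      \<open>2 * w\<close>.\<close>
    define s where "s = y0 - u"
    have s: "0 \<le> s" "s < h" using y0 Y by (auto simp: s_def Y1_def)
    have "cnt X u (u + h) \<le> cnt C (2 * u + s) (2 * u + s + h)"
      unfolding cnt_def
    proof (rule card_inj_on_le[of "\<lambda>x. x + y0"])
      show "(\<lambda>x. x + y0) ` (X \<inter> {u..<u + h}) \<subseteq> C \<inter> {2 * u + s..<2 * u + s + h}"
        using XY y0 by (auto simp: s_def)
    qed (auto simp: inj_on_def)
    also have "\<dots> \<le> (\<Sum>i\<in>{nat (s div (2 * int w))..<nat ((s + h - 1) div (2 * int w)) + 1}.
        cnt C (2 * u + 2 * int w * int i) (2 * u + 2 * int w * int (Suc i)))"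
      (is "_ \<le> (\<Sum>i\<in>{?i0..<?i1 + 1}. _)")
    proof -
      have i0: "int ?i0 = s div (2 * int w)" and i1: "int ?i1 = (s + h - 1) div (2 * int w)"
        using s wpos h(1) by (simp_all add: pos_imp_zdiv_nonneg_iff)
      have i01: "?i0 \<le> ?i1" using wpos h(1) by (intro nat_mono zdiv_mono1) auto
      let ?a = "2 * u + 2 * int w * int ?i0"
      have "2 * int w * int ?i0 \<le> s"
        using mult_div_mod_eq[of "2 * int w" s] pos_mod_sign[of "2 * int w" s] wpos unfolding i0 by linarith
      moreover have "s + h - 1 < 2 * int w * (int ?i1 + 1)"
        using mult_div_mod_eq[of "2 * int w" "s + h - 1"] pos_mod_bound[of "2 * int w" "s + h - 1"] wpos
        unfolding i1 distrib_left by linarith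
      ultimately have "cnt C (2 * u + s) (2 * u + s + h) \<le> cnt C ?a (2 * u + 2 * int w * (int ?i1 + 1))"
        by (intro cnt_mono_window) auto
      also have "2 * u + 2 * int w * (int ?i1 + 1) = ?a + 2 * int w * int (?i1 + 1 - ?i0)"
        using i01 by (simp add: algebra_simps of_nat_diff)
      also have "cnt C ?a \<dots> = (\<Sum>i<?i1 + 1 - ?i0. cnt C (?a + 2 * int w * int i) (?a + 2 * int w * int (Suc i)))"
        by (rule cnt_window_sum) simp
      also have "\<dots> = (\<Sum>i<?i1 + 1 - ?i0. cnt C (2 * u + 2 * int w * int (i + ?i0)) (2 * u + 2 * int w * int (Suc (i + ?i0))))"
        by (intro sum.cong refl arg_cong2[of _ _ _ _ "cnt C"]) (simp_all add: algebra_simps)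
      also have "\<dots> = (\<Sum>i\<in>{?i0..<?i1 + 1}. cnt C (2 * u + 2 * int w * int i) (2 * u + 2 * int w * int (Suc i)))"
        using i01 by (intro sum.reindex_bij_witness[of _ "\<lambda>i. i - ?i0" "\<lambda>i. i + ?i0"]) auto
      finally show ?thesis .
    qed
    finally have "real (cnt X u (u + h)) \<le> (\<Sum>i\<in>{?i0..<?i1 + 1}. real (cnt C (2 * u + 2 * int w * int i) (2 * u + 2 * int w * int (Suc i))))"
      by (simp only: of_nat_sum[symmetric] of_nat_le_iff)
    also have "\<dots> \<le> real (card {?i0..<?i1 + 1}) * ((c + \<theta>) * (2 * real w))"
    proof (rule sum_bounded_above)
      fix i assume i: "i \<in> {?i0..<?i1 + 1}"
      have "2 * int w * int T = 2 * h" by (simp add: h_def)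
      moreover have "2 * int w * ((s + h - 1) div (2 * int w)) \<le> s + h - 1"
        using mult_div_mod_eq[of "2 * int w" "s + h - 1"] pos_mod_sign[of "2 * int w" "s + h - 1"] wpos by linarith
      ultimately have "2 * int w * ((s + h - 1) div (2 * int w)) < 2 * int w * int T" using s by linarith
      then have "(s + h - 1) div (2 * int w) < int T" using wpos by (simp only: mult_less_cancel_left_pos)
      then have "?i1 < T" using T by arith
      moreover have "i \<le> ?i1" using i by simp
      ultimately have "i < T" by linarith
      then show "real (cnt C (2 * u + 2 * int w * int i) (2 * u + 2 * int w * int (Suc i))) \<le> (c + \<theta>) * (2 * real w)" by (rule Cub)
    qed
    also have "\<dots> \<le> (real T / 2 + 2) * ((c + \<theta>) * (2 * real w))"
    proof (rule mult_right_mono)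
      have "real_of_int ((s + h - 1) div (2 * int w)) \<le> (s + h - 1) / (2 * int w)" by (rule real_of_int_div4)
      moreover have "real_of_int (s div (2 * int w)) \<ge> s / (2 * int w) - 1" using real_of_int_div3[of s "2 * int w"] by simp
      moreover have "(s + h - 1) / (2 * int w) \<le> s / (2 * int w) + real T / 2"
        using wpos h(2) by (simp add: field_simps)
      moreover have "real (card {?i0..<?i1 + 1}) \<le> real_of_int ((s + h - 1) div (2 * int w)) - real_of_int (s div (2 * int w)) + 1"
        using s wpos h(1) zdiv_mono1[of s "s + h - 1" "2 * int w"] by (simp add: pos_imp_zdiv_nonneg_iff nat_le_eq_zle of_nat_diff)
      ultimately show "real (card {?i0..<?i1 + 1}) \<le> real T / 2 + 2" by linarith
      show "0 \<le> (c + \<theta>) * (2 * real w)" using Cub[OF T] by linarith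
    qed
    also have "\<dots> = (c + \<theta>) * (1 + 4 / real T) * h" using T unfolding h(2) by (simp add: field_simps)
    finally have "(?m - 3 * \<epsilon> / 8) * h \<le> (c + \<theta>) * (1 + 4 / real T) * h" using lower by linarith
    then have fin: "?m - 3 * \<epsilon> / 8 \<le> (c + \<theta>) * (1 + 4 / real T)" using h(1) by simp
    have "R ^ 1 \<le> T" unfolding T_def using R2 by (intro power_increasing) auto
    then have "64 / \<epsilon> \<le> real T" using R64 by simp
    then have T4: "4 / real T \<le> \<epsilon> / 16" using T \<epsilon> by (simp add: field_simps)
    show ?thesis
    proof (cases "c \<ge> 1")
      case False
      have "(c + \<theta>) * (2 * real w) \<ge> 0" using Cub[OF T] by linarith
      then have "c + \<theta> \<ge> 0" using wpos by (simp add: zero_le_mult_iff)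
      then have "(c + \<theta>) * (4 / real T) \<le> 2 * (\<epsilon> / 16)"
        using False T4 \<epsilon> by (intro mult_mono) (auto simp: \<theta>_def)
      moreover have "(c + \<theta>) * (1 + 4 / real T) = (c + \<theta>) + (c + \<theta>) * (4 / real T)"
        by (simp only: distrib_left mult_1_right)
      moreover have "\<theta> = \<epsilon> / 32" by (rule \<theta>_def)
      ultimately show ?thesis using fin \<epsilon> by linarith
    qed (use \<epsilon> in auto)
  qed
  show ?thesis by (rule that[OF Q T \<theta>]) (rule main)
qed

section \<open>Limit densities on windows\<close>

text \<open>Taken relative to the whole window, not to the class, so the limit is at most
  \<open>1 / G\<close>. The factor \<open>e\<close> is \<open>1\<close> for \<open>A\<close> and
  \<open>2\<close> for \<open>A + A\<close>, since sums of two elements of a window fall into the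
  window of doubled ends. The unit \<open>k! / d\<close> is exact as soon as
  \<open>k \<ge> d\<close>.\<close>

definition window_density :: "int set \<Rightarrow> nat \<Rightarrow> nat \<Rightarrow> nat \<Rightarrow> nat \<Rightarrow> nat \<Rightarrow> nat \<Rightarrow> real" where
  "window_density S e G c d p k = real (cnt (S \<inter> {z. z mod int G = int c})
     (int e * int p * int (fact k div d)) (int e * int (Suc p) * int (fact k div d))) / (real e * real (fact k div d))"

lemma window_density_nonneg: "0 \<le> window_density S e G c d p k"
  by (simp add: window_density_def)

lemma window_density_le: "window_density S e G c d p k \<le> 1"
proof -
  let ?m = "fact k div d :: nat"
  have "cnt (S \<inter> {z. z mod int G = int c}) (int e * int p * int ?m) (int e * int (Suc p) * int ?m) \<le> e * ?m"
    using cnt_le[of "S \<inter> {z. z mod int G = int c}" "int e * int p * int ?m" "int e * int (Suc p) * int ?m"]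
    by (simp add: algebra_simps nat_mult_distrib)
  then have "real (cnt (S \<inter> {z. z mod int G = int c}) (int e * int p * int ?m) (int e * int (Suc p) * int ?m)) \<le> real e * real ?m"
    by (simp flip: of_nat_mult)
  moreover have "x / y \<le> 1" if "x \<le> y" "0 \<le> y" for x y :: real using that by (cases "y = 0") auto
  ultimately show ?thesis unfolding window_density_def by simp
qed

text \<open>There are countably many parameter tuples and all values lie in \<open>[0, 1]\<close>,
  so a diagonal argument yields one subsequence that serves them all.\<close>

lemma ex_window_density_limits:
  fixes S :: "bool \<Rightarrow> int set" and e :: "bool \<Rightarrow> nat"
  obtains \<rho> L where "strict_mono (\<rho> :: nat \<Rightarrow> nat)"
    "\<And>b G c d p. (\<lambda>k. window_density (S b) (e b) G c d p (\<rho> k)) \<longlonglongrightarrow> L b G c d p"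
proof -
  let ?f = "\<lambda>k (b, G, c, d, p). window_density (S b) (e b) G c d p k"
  obtain \<rho> :: "nat \<Rightarrow> nat" where \<rho>: "strict_mono \<rho>" "\<And>x. x \<in> UNIV \<Longrightarrow> \<exists>l. (\<lambda>k. ?f (\<rho> k) x) \<longlonglongrightarrow> l"
    by (rule function_convergent_subsequence[of UNIV ?f 1]) (auto simp: window_density_le window_density_nonneg split: prod.splits)
  have "\<exists>l. (\<lambda>k. window_density (S b) (e b) G c d p (\<rho> k)) \<longlonglongrightarrow> l" for b G c d p
    using \<rho>(2)[of "(b, G, c, d, p)"] by simp
  then have "\<exists>L. \<forall>b G c d p. (\<lambda>k. window_density (S b) (e b) G c d p (\<rho> k)) \<longlonglongrightarrow> L b G c d p" by metis
  then show thesis using that \<rho>(1) by blast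
qed

lemma cnt_class_split:
  assumes "c < G" "M > 0"
  shows "cnt (S \<inter> {z. z mod int G = int c}) p q =
    (\<Sum>j<M. cnt (S \<inter> {z. z mod int (G * M) = int (c + G * j)}) p q)"
proof -
  let ?X = "(S \<inter> {z. z mod int G = int c}) \<inter> {p..<q}"
  define f where "f z = nat ((z div int G) mod int M)" for z
  have iff: "z mod int (G * M) = int (c + G * j) \<longleftrightarrow> z mod int G = int c \<and> f z = j" if "j < M" for z j
  proof -
    have e: "z mod int (G * M) = int G * (z div int G mod int M) + z mod int G"
      using zmod_zmult2_eq[of "int M" z "int G"] by simp
    have fz: "int (f z) = z div int G mod int M" using assms by (simp add: f_def)
    show ?thesis
    proof
      assume *: "z mod int (G * M) = int (c + G * j)"
      then have "(z mod int (G * M)) mod int G = int c" using assms by simp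
      then have zc: "z mod int G = int c" using e by simp
      then have "int G * (z div int G mod int M) = int G * int j" using e * by simp
      then have "z div int G mod int M = int j" using assms by simp
      then show "z mod int G = int c \<and> f z = j" using zc fz by simp
    next
      assume "z mod int G = int c \<and> f z = j"
      then show "z mod int (G * M) = int (c + G * j)" using e fz by simp
    qed
  qed
  have img: "f ` ?X \<subseteq> {..<M}" using assms by (auto simp: f_def nat_less_iff)
  have "card ?X = (\<Sum>j<M. card {z \<in> ?X. f z = j})"
  proof -
    have "finite ?X" by simp
    then show ?thesis by (simp only: card_eq_sum sum.group[OF _ finite_lessThan img])
  qed
  also have "\<dots> = (\<Sum>j<M. cnt (S \<inter> {z. z mod int (G * M) = int (c + G * j)}) p q)"
  proof (rule sum.cong[OF refl])
    fix j assume "j \<in> {..<M}"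
    then have "{z \<in> ?X. f z = j} = (S \<inter> {z. z mod int (G * M) = int (c + G * j)}) \<inter> {p..<q}"
      using iff by auto
    then show "card {z \<in> ?X. f z = j} = cnt (S \<inter> {z. z mod int (G * M) = int (c + G * j)}) p q"
      by (simp add: cnt_def)
  qed
  finally show ?thesis by (simp add: cnt_def)
qed

lemma fact_div_mult:
  assumes "d > 0" "T > 0" "d * T \<le> k"
  shows "fact k div d = T * (fact k div (d * T) :: nat)"
proof -
  have "d * T dvd fact k" using assms by (intro dvd_fact) auto
  then obtain q where "fact k = d * T * q" by (rule dvdE)
  then show ?thesis using assms by simp
qed

text \<open>Window \<open>p\<close> in units \<open>k! / d\<close> consists of the windows
  \<open>p * T + i\<close> in units \<open>k! / (d * T)\<close>. By \<open>d * T \<le> k\<close> the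
  product \<open>d * T\<close> divides \<open>k!\<close>, so the pieces fit without
  rounding.\<close>

lemma window_density_refine:
  assumes "c < G" "M > 0" "d > 0" "T > 0" "d * T \<le> k"
  shows "window_density S e G c d p k = (\<Sum>i<T. \<Sum>j<M. window_density S e (G * M) (c + G * j) (d * T) (p * T + i) k) / real T"
proof -
  define m where "m = (fact k div (d * T) :: nat)"
  have m: "fact k div d = T * m" using fact_div_mult[OF assms(3-5)] by (simp add: m_def)
  let ?S = "S \<inter> {z. z mod int G = int c}" and ?a = "int e * int p * int (T * m)"
  have "int e * int (Suc p) * int (T * m) = ?a + int (e * m) * int T" by (simp add: algebra_simps)
  then have "cnt ?S ?a (int e * int (Suc p) * int (T * m)) =
      (\<Sum>i<T. cnt ?S (?a + int (e * m) * int i) (?a + int (e * m) * int (Suc i)))"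
    using cnt_window_sum[of "int (e * m)" ?S ?a T] by simp
  also have "\<dots> = (\<Sum>i<T. \<Sum>j<M. cnt (S \<inter> {z. z mod int (G * M) = int (c + G * j)})
      (int e * int (p * T + i) * int m) (int e * int (Suc (p * T + i)) * int m))"
  proof (rule sum.cong[OF refl])
    fix i assume "i \<in> {..<T}"
    have "?a + int (e * m) * int i = int e * int (p * T + i) * int m"
      "?a + int (e * m) * int (Suc i) = int e * int (Suc (p * T + i)) * int m" by (simp_all add: algebra_simps)
    then show "cnt ?S (?a + int (e * m) * int i) (?a + int (e * m) * int (Suc i)) =
      (\<Sum>j<M. cnt (S \<inter> {z. z mod int (G * M) = int (c + G * j)})
      (int e * int (p * T + i) * int m) (int e * int (Suc (p * T + i)) * int m))"
      using cnt_class_split[OF assms(1,2)] by simp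
  qed
  finally have "real (cnt ?S ?a (int e * int (Suc p) * int (T * m))) =
      (\<Sum>i<T. \<Sum>j<M. real (cnt (S \<inter> {z. z mod int (G * M) = int (c + G * j)})
      (int e * int (p * T + i) * int m) (int e * int (Suc (p * T + i)) * int m)))" by simp
  then show ?thesis
    unfolding window_density_def m m_def[symmetric] by (simp add: sum_divide_distrib mult_ac)
qed

lemma fact_div_at_top:
  assumes "strict_mono (\<rho> :: nat \<Rightarrow> nat)" "d > 0"
  shows "filterlim (\<lambda>k. fact (\<rho> k) div d :: nat) at_top sequentially"
proof -
  have "n \<le> fact (n + d) div d" for n
  proof -
    have "n * d \<le> fact (n + d)"
    proof -
      have "(n + d) * fact (n + d - 1) = (fact (n + d) :: nat)" using assms(2) by (metis add_gr_0 fact_reduce of_nat_id)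
      moreover have "fact n \<le> (fact (n + d - 1) :: nat)" using assms(2) by (intro fact_mono) auto
      ultimately show ?thesis
        by (metis (no_types, lifting) add_is_0 assms(2) fact_ge_self fact_mono_nat le_add1 le_add2 le_trans mult.commute mult_le_mono Suc_pred' add_Suc_right add_gr_0 less_Suc_eq_le diff_Suc_1)
    qed
    then show ?thesis using assms(2) by (simp add: less_eq_div_iff_mult_less_eq)
  qed
  then have "n \<le> fact k div d" if "k \<ge> n + d" for n k
    using that by (meson div_le_mono fact_mono_nat le_trans)
  moreover have "\<rho> k \<ge> k" for k using assms(1) by (rule seq_suble)
  ultimately show ?thesis unfolding filterlim_at_top eventually_sequentially by (meson le_trans)
qed

lemma cnt_class_le:
  assumes "G > 0" "l \<ge> 0"
  shows "real (cnt (S \<inter> {z. z mod int G = int c}) a (a + l)) \<le> l / G + 1"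
proof -
  have "cnt (S \<inter> {z. z mod int G = int c}) a (a + l) \<le> cnt {z. int G dvd z - int c} a (a + l)"
  proof (intro cnt_mono subsetI)
    fix z assume "z \<in> S \<inter> {z. z mod int G = int c}"
    then show "z \<in> {z. int G dvd z - int c}" using dvd_minus_mod[of "int G" z] by simp
  qed
  then show ?thesis using cnt_residue_le[of "int G" l "int c" a] assms by simp
qed

text \<open>A class modulo \<open>G\<close> may exceed its share of a window by one element, so the
  bound \<open>1 / G\<close> is reached only in the limit, as the unit grows.\<close>

lemma limit_density_bounds:
  assumes lim: "\<And>G c d p. (\<lambda>k. window_density S e G c d p (\<rho> k)) \<longlonglongrightarrow> L G c d p"
    and \<rho>: "strict_mono \<rho>" and e: "e > 0" and G: "G > 0" and d: "d > 0"
  shows "0 \<le> L G c d p" "L G c d p \<le> 1 / G"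
proof -
  show "0 \<le> L G c d p" by (rule LIMSEQ_le_const[OF lim]) (auto simp: window_density_nonneg)
  have top: "filterlim (\<lambda>k. fact (\<rho> k) div d :: nat) at_top sequentially" by (rule fact_div_at_top[OF \<rho> d])
  then have "filterlim (\<lambda>k. real (fact (\<rho> k) div d)) at_top sequentially"
    using filterlim_compose[OF filterlim_real_sequentially] by blast
  then have "(\<lambda>k. 1 / G + 1 / real (fact (\<rho> k) div d)) \<longlonglongrightarrow> 1 / G + 0"
    by (intro tendsto_intros tendsto_divide_0[OF tendsto_const] filterlim_at_top_imp_at_infinity)
  moreover have "eventually (\<lambda>k. window_density S e G c d p (\<rho> k) \<le> 1 / G + 1 / real (fact (\<rho> k) div d)) sequentially"
  proof -
    have "eventually (\<lambda>k. fact (\<rho> k) div d \<ge> (1::nat)) sequentially" using top by (auto simp: filterlim_at_top)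
    then show ?thesis
    proof eventually_elim
      case (elim k)
      define m where "m = (fact (\<rho> k) div d :: nat)"
      have m: "m \<ge> 1" using elim by (simp add: m_def)
      let ?a = "int e * int p * int m"
      have eq: "int e * int (Suc p) * int m = ?a + int (e * m)" by (simp add: algebra_simps)
      have "real (cnt (S \<inter> {z. z mod int G = int c}) ?a (?a + int (e * m))) \<le> real (e * m) / G + 1"
        using cnt_class_le[OF G, of "int (e * m)" S c ?a] by simp
      then have "window_density S e G c d p (\<rho> k) \<le> (real (e * m) / G + 1) / (real e * real m)"
        unfolding window_density_def m_def[symmetric] eq by (intro divide_right_mono) auto
      also have "\<dots> = 1 / G + 1 / (real e * real m)" using e m by (simp add: add_divide_distrib)
      also have "\<dots> \<le> 1 / G + 1 / real m" using e m by (auto intro!: divide_left_mono)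
      finally show ?case by (simp add: m_def)
    qed
  qed
  ultimately show "L G c d p \<le> 1 / G"
    using tendsto_le[OF sequentially_bot, of "\<lambda>k. 1 / G + 1 / real (fact (\<rho> k) div d)" "1 / G" "\<lambda>k. window_density S e G c d p (\<rho> k)" "L G c d p"] lim by simp
qed

lemma limit_density_refine:
  assumes lim: "\<And>G c d p. (\<lambda>k. window_density S e G c d p (\<rho> k)) \<longlonglongrightarrow> L G c d p"
    and \<rho>: "strict_mono \<rho>" and "c < G" "M > 0" "d > 0" "T > 0"
  shows "L G c d p = (\<Sum>i<T. \<Sum>j<M. L (G * M) (c + G * j) (d * T) (p * T + i)) / real T"
proof (rule LIMSEQ_unique[OF lim])
  have "(\<lambda>k. (\<Sum>i<T. \<Sum>j<M. window_density S e (G * M) (c + G * j) (d * T) (p * T + i) (\<rho> k)) / real T)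
    \<longlonglongrightarrow> (\<Sum>i<T. \<Sum>j<M. L (G * M) (c + G * j) (d * T) (p * T + i)) / real T"
    using assms(6) by (intro tendsto_intros lim) auto
  moreover have "eventually (\<lambda>k. window_density S e G c d p (\<rho> k) =
    (\<Sum>i<T. \<Sum>j<M. window_density S e (G * M) (c + G * j) (d * T) (p * T + i) (\<rho> k)) / real T) sequentially"
    using eventually_ge_at_top[of "d * T"]
  proof eventually_elim
    case (elim k)
    then have "d * T \<le> \<rho> k" using seq_suble[OF \<rho>, of k] by simp
    then show ?case using window_density_refine assms(3-6) by blast
  qed
  ultimately show "(\<lambda>k. window_density S e G c d p (\<rho> k)) \<longlonglongrightarrow> (\<Sum>i<T. \<Sum>j<M. L (G * M) (c + G * j) (d * T) (p * T + i)) / real T"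
    by (simp cong: tendsto_cong)
qed

section \<open>Asymptotic density seen on windows\<close>

lemma has_density_cnt:
  assumes "has_density A \<alpha>"
  shows "(\<lambda>n. real (cnt (int ` A) 0 (int n)) / real n) \<longlonglongrightarrow> \<alpha>"
proof -
  have *: "\<bar>real (cnt (int ` A) 0 (int n)) - real (card (A \<inter> {1..n}))\<bar> \<le> 1" for n
  proof -
    have "(int ` A) \<inter> {0..<int n} = int ` (A \<inter> {0..<n})" by auto
    then have c: "cnt (int ` A) 0 (int n) = card (A \<inter> {0..<n})" unfolding cnt_def by (simp add: card_image)
    have "card (A \<inter> {0..<n}) \<le> card (insert 0 (A \<inter> {1..n}))" by (intro card_mono) auto
    also have "\<dots> \<le> card (A \<inter> {1..n}) + 1" by (simp add: card_insert_if)
    finally have 1: "card (A \<inter> {0..<n}) \<le> card (A \<inter> {1..n}) + 1" .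
    have "card (A \<inter> {1..n}) \<le> card (insert n (A \<inter> {0..<n}))" by (intro card_mono) auto
    also have "\<dots> \<le> card (A \<inter> {0..<n}) + 1" by (simp add: card_insert_if)
    finally show ?thesis using 1 unfolding c by linarith
  qed
  have "(\<lambda>n. real (cnt (int ` A) 0 (int n)) / real n - real (card (A \<inter> {1..n})) / real n) \<longlonglongrightarrow> 0"
  proof (rule Lim_null_comparison[of _ "\<lambda>n. 1 / real n"])
    show "\<forall>\<^sub>F n in sequentially. norm (real (cnt (int ` A) 0 (int n)) / real n - real (card (A \<inter> {1..n})) / real n) \<le> 1 / real n"
    proof (rule always_eventually, rule allI)
      fix n
      show "norm (real (cnt (int ` A) 0 (int n)) / real n - real (card (A \<inter> {1..n})) / real n) \<le> 1 / real n"
        using *[of n] by (cases "n = 0") (auto simp flip: diff_divide_distrib simp: divide_right_mono)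
    qed
  qed (rule lim_1_over_n)
  from tendsto_add[OF this assms[unfolded has_density_def]] show ?thesis by simp
qed

lemma cnt_window_density:
  assumes A: "(\<lambda>n. real (cnt S 0 (int n)) / real n) \<longlonglongrightarrow> \<alpha>" and m: "filterlim m at_top sequentially" and ab: "a \<le> b"
  shows "(\<lambda>k. real (cnt S (int a * int (m k)) (int b * int (m k))) / real (m k)) \<longlonglongrightarrow> (real b - real a) * \<alpha>"
proof -
  have lim: "(\<lambda>k. real (cnt S 0 (int b * int (m k))) / real (m k)) \<longlonglongrightarrow> real b * \<alpha>" for b
  proof (cases "b = 0")
    case True then show ?thesis by (simp add: cnt_def)
  next
    case False
    have "filterlim (\<lambda>k. b * m k) at_top sequentially"
      unfolding filterlim_at_top
    proof
      fix Z
      have "eventually (\<lambda>k. m k \<ge> Z) sequentially" using m by (auto simp: filterlim_at_top)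
      then show "eventually (\<lambda>k. b * m k \<ge> Z) sequentially"
        by eventually_elim (use False in \<open>metis le_trans mult_le_mono1 nat_mult_1 less_one linorder_not_less\<close>)
    qed
    from filterlim_compose[OF A this]
    have "(\<lambda>k. real b * (real (cnt S 0 (int (b * m k))) / real (b * m k))) \<longlonglongrightarrow> real b * \<alpha>" by (intro tendsto_intros)
    then show ?thesis using False by simp
  qed
  have sp: "cnt S 0 (int b * int (m k)) = cnt S 0 (int a * int (m k)) + cnt S (int a * int (m k)) (int b * int (m k))" for k
    using ab by (intro cnt_split) (auto intro!: mult_right_mono)
  have "real (cnt S (int a * int (m k)) (int b * int (m k))) / real (m k) =
    real (cnt S 0 (int b * int (m k))) / real (m k) - real (cnt S 0 (int a * int (m k))) / real (m k)" for k
    unfolding sp[of k] by (simp add: add_divide_distrib)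
  then show ?thesis using tendsto_diff[OF lim[of b] lim[of a]] by (simp add: left_diff_distrib)
qed

text \<open>A window has ends at fixed multiples of a growing unit, so the existence of the density
  gives it the same density \<open>\<alpha>\<close> whatever \<open>d\<close> and \<open>p\<close>
  are. Hence no choice of window loses mass.\<close>

lemma limit_density_total:
  assumes lim: "\<And>G c d p. (\<lambda>k. window_density S e G c d p (\<rho> k)) \<longlonglongrightarrow> L G c d p"
    and \<rho>: "strict_mono \<rho>" and e: "e > 0" and G: "G > 0" and d: "d > 0"
    and S: "(\<lambda>n. real (cnt S 0 (int n)) / real n) \<longlonglongrightarrow> \<alpha>"
  shows "(\<Sum>c<G. L G c d p) = \<alpha>"
proof (rule LIMSEQ_unique)
  show "(\<lambda>k. \<Sum>c<G. window_density S e G c d p (\<rho> k)) \<longlonglongrightarrow> (\<Sum>c<G. L G c d p)" by (intro tendsto_intros lim)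
  define m where "m k = (fact (\<rho> k) div d :: nat)" for k
  have "(\<Sum>c<G. window_density S e G c d p (\<rho> k)) = real (cnt S (int (e * p) * int (m k)) (int (e * Suc p) * int (m k))) / real (m k) / real e" for k
  proof -
    have "cnt S a b = (\<Sum>c<G. cnt (S \<inter> {z. z mod int G = int c}) a b)" for a b
      using cnt_class_split[of 0 1 G S a b] G by simp
    then show ?thesis unfolding window_density_def m_def[symmetric]
      by (simp add: sum_divide_distrib mult.commute del: of_nat_Suc mult_Suc_right)
  qed
  moreover have "(\<lambda>k. real (cnt S (int (e * p) * int (m k)) (int (e * Suc p) * int (m k))) / real (m k) / real e)
      \<longlonglongrightarrow> (real (e * Suc p) - real (e * p)) * \<alpha> / real e"
    using e by (intro tendsto_divide cnt_window_density[OF S] tendsto_const) (auto simp: m_def intro!: fact_div_at_top \<rho> d)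
  moreover have "(real (e * Suc p) - real (e * p)) * \<alpha> / real e = \<alpha>" using e by (simp add: field_simps)
  ultimately show "(\<lambda>k. \<Sum>c<G. window_density S e G c d p (\<rho> k)) \<longlonglongrightarrow> \<alpha>" by simp
qed

section \<open>Kneser's theorem with weights\<close>

lemma cnt_grid:
  assumes "G > 0" "N > 0"
  shows "cnt {z. Pr (nat (z mod int G)) (nat (z mod int (G * N) div int G))} 0 (int (G * N)) =
    (\<Sum>r<G. card {j \<in> {..<N}. Pr r j})"
proof -
  have bij: "bij_betw (\<lambda>(r, j). int (r + G * j)) (SIGMA r:{..<G}. {j \<in> {..<N}. Pr r j})
    ({z. Pr (nat (z mod int G)) (nat (z mod int (G * N) div int G))} \<inter> {0..<int (G * N)})"
  proof (rule bij_betw_byWitness[where f' = "\<lambda>z. (nat (z mod int G), nat (z div int G))"])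
    show "\<forall>x\<in>SIGMA r:{..<G}. {j \<in> {..<N}. Pr r j}.
       (nat ((case x of (r, j) \<Rightarrow> int (r + G * j)) mod int G), nat ((case x of (r, j) \<Rightarrow> int (r + G * j)) div int G)) = x"
      using assms by auto
    show "\<forall>z\<in>{z. Pr (nat (z mod int G)) (nat (z mod int (G * N) div int G))} \<inter> {0..<int (G * N)}.
       (case (nat (z mod int G), nat (z div int G)) of (r, j) \<Rightarrow> int (r + G * j)) = z"
      using assms by (auto simp: pos_imp_zdiv_nonneg_iff)
    show "(\<lambda>(r, j). int (r + G * j)) ` (SIGMA r:{..<G}. {j \<in> {..<N}. Pr r j}) \<subseteq>
       {z. Pr (nat (z mod int G)) (nat (z mod int (G * N) div int G))} \<inter> {0..<int (G * N)}"
    proof clarify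
      fix r j assume rj: "r < G" "j < N" "Pr r j"
      have "r + G * j < G * (j + 1)" using rj by simp
      also have "\<dots> \<le> G * N" using rj by (intro mult_left_mono) auto
      finally have lt: "r + G * j < G * N" .
      then have m: "int (r + G * j) mod int (G * N) = int (r + G * j)" by (simp only: zmod_int[symmetric] mod_less)
      have e: "nat (int (r + G * j) mod int G) = r" "nat (int (r + G * j) div int G) = j" using rj by simp_all
      have "int (r + G * j) \<in> {0..<int (G * N)}" using lt by (simp only: atLeastLessThan_iff of_nat_less_iff) simp
      then show "int (r + G * j) \<in> {z. Pr (nat (z mod int G)) (nat (z mod int (G * N) div int G))} \<inter> {0..<int (G * N)}"
        unfolding Int_iff mem_Collect_eq m e using rj by blast
    qed
    show "(\<lambda>z. (nat (z mod int G), nat (z div int G))) `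
       ({z. Pr (nat (z mod int G)) (nat (z mod int (G * N) div int G))} \<inter> {0..<int (G * N)})
       \<subseteq> (SIGMA r:{..<G}. {j \<in> {..<N}. Pr r j})"
    proof (rule image_subsetI)
      fix z assume "z \<in> {z. Pr (nat (z mod int G)) (nat (z mod int (G * N) div int G))} \<inter> {0..<int (G * N)}"
      then have z: "z \<in> {0..<int (G * N)}" and P: "Pr (nat (z mod int G)) (nat (z mod int (G * N) div int G))" by auto
      have "z mod int (G * N) = z" using z by (intro mod_pos_pos_trivial) auto
      moreover have "z div int G < int N"
      proof -
        have "int G * (z div int G) \<le> z" using mult_div_mod_eq[of "int G" z] pos_mod_sign[of "int G" z] assms by linarith
        also have "z < int G * int N" using z by simp
        finally show ?thesis using assms by simp
      qed
      moreover have "0 \<le> z div int G" using z assms by (simp add: pos_imp_zdiv_nonneg_iff)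
      ultimately show "(nat (z mod int G), nat (z div int G)) \<in> (SIGMA r:{..<G}. {j \<in> {..<N}. Pr r j})"
        using P assms by (simp add: nat_less_iff)
    qed
  qed
  have "cnt {z. Pr (nat (z mod int G)) (nat (z mod int (G * N) div int G))} 0 (int (G * N)) =
    card (SIGMA r:{..<G}. {j \<in> {..<N}. Pr r j})" unfolding cnt_def by (rule bij_betw_same_card[OF bij, symmetric])
  also have "\<dots> = (\<Sum>r<G. card {j \<in> {..<N}. Pr r j})" by simp
  finally show ?thesis .
qed

lemma card_initial:
  fixes x :: real
  assumes "0 \<le> x"
  shows "real (card {j \<in> {..<N}. real j + 1 \<le> x}) \<le> x"
    and "x \<le> real N \<Longrightarrow> x - 1 \<le> real (card {j \<in> {..<N}. real j + 1 \<le> x})"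
proof -
  have "{j \<in> {..<N}. real j + 1 \<le> x} \<subseteq> {..<nat \<lfloor>x\<rfloor>}"
  proof
    fix j assume "j \<in> {j \<in> {..<N}. real j + 1 \<le> x}"
    then have "real_of_int (int j + 1) \<le> x" by simp
    then have "int j + 1 \<le> \<lfloor>x\<rfloor>" by (simp only: le_floor_iff)
    then show "j \<in> {..<nat \<lfloor>x\<rfloor>}" by simp
  qed
  then have "card {j \<in> {..<N}. real j + 1 \<le> x} \<le> nat \<lfloor>x\<rfloor>" by (metis card_lessThan card_mono finite_lessThan)
  then show "real (card {j \<in> {..<N}. real j + 1 \<le> x}) \<le> x" using assms by linarith
  assume "x \<le> real N"
  have "{..<nat \<lfloor>x\<rfloor>} \<subseteq> {j \<in> {..<N}. real j + 1 \<le> x}"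
  proof
    fix j assume "j \<in> {..<nat \<lfloor>x\<rfloor>}"
    then have "int j + 1 \<le> \<lfloor>x\<rfloor>" by auto
    then have "real_of_int (int j + 1) \<le> x" by (simp only: le_floor_iff)
    then show "j \<in> {j \<in> {..<N}. real j + 1 \<le> x}" using \<open>x \<le> real N\<close> by auto
  qed
  then have "nat \<lfloor>x\<rfloor> \<le> card {j \<in> {..<N}. real j + 1 \<le> x}"
    by (metis (no_types, lifting) card_lessThan card_mono finite_Collect_conjI finite_lessThan mem_Collect_eq finite_subset subsetI)
  then show "x - 1 \<le> real (card {j \<in> {..<N}. real j + 1 \<le> x})" by linarith
qed

text \<open>The low digits carry at most \<open>1\<close> into the high digit, and reducing the high
  digit modulo \<open>N\<close> can only lower it.\<close>

lemma sumset_digits: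
  fixes z1 z2 :: int
  assumes G: "G > 0" "N > 0"
  defines "rr \<equiv> \<lambda>z. nat (z mod int G)" and "jj \<equiv> \<lambda>z. nat (z mod int (G * N) div int G)"
  shows "rr (z1 + z2) = (rr z1 + rr z2) mod G" "jj (z1 + z2) \<le> jj z1 + jj z2 + 1" "jj (z1 + z2) < N"
proof -
  have rep: "z mod int (G * N) = int (rr z + G * jj z)" "rr z < G" for z
  proof -
    have "z mod int (G * N) = int G * (z mod int (G * N) div int G) + z mod int (G * N) mod int G" by simp
    moreover have "z mod int (G * N) mod int G = z mod int G" by (rule mod_mod_cancel) simp
    moreover have "z mod int (G * N) div int G \<ge> 0" using G by (simp add: pos_imp_zdiv_nonneg_iff)
    moreover have i: "int (rr z) = z mod int G" using G by (simp add: rr_def)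
    moreover have "int (jj z) = z mod int (G * N) div int G" unfolding jj_def using calculation(3) by (rule nat_0_le)
    ultimately have "z mod int (G * N) = int G * int (jj z) + int (rr z)" by metis
    then show "z mod int (G * N) = int (rr z + G * jj z)" by simp
    show "rr z < G" using G by (simp add: rr_def nat_less_iff)
  qed
  define m where "m = rr z1 + rr z2 + G * (jj z1 + jj z2)"
  have "(z1 + z2) mod int (G * N) = (z1 mod int (G * N) + z2 mod int (G * N)) mod int (G * N)" by (simp add: mod_add_eq)
  also have "\<dots> = int (m mod (G * N))" 
    unfolding rep(1)[of z1] rep(1)[of z2] m_def zmod_int by (simp add: algebra_simps)
  finally have e: "(z1 + z2) mod int (G * N) = int (m mod (G * N))" .
  have "jj (z1 + z2) = m mod (G * N) div G" unfolding jj_def e by (simp add: zdiv_int[symmetric] del: of_nat_mult)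
  also have "\<dots> = m div G mod N" using G by (simp add: mod_mult2_eq)
  finally have j: "jj (z1 + z2) = m div G mod N" .
  then show "jj (z1 + z2) < N" using G by simp
  have "m div G = (rr z1 + rr z2) div G + (jj z1 + jj z2)" using G unfolding m_def by simp
  moreover have "rr z1 + rr z2 < 2 * G" using rep(2)[of z1] rep(2)[of z2] by linarith
  then have "(rr z1 + rr z2) div G < 2" by (rule less_mult_imp_div_less)
  moreover have "m div G mod N \<le> m div G" by (rule mod_less_eq_dividend)
  ultimately show "jj (z1 + z2) \<le> jj z1 + jj z2 + 1" unfolding j by linarith
  have "int (rr (z1 + z2)) = (z1 mod int G + z2 mod int G) mod int G" using G by (simp add: rr_def mod_add_eq)
  also have "\<dots> = int ((rr z1 + rr z2) mod G)" using G by (simp add: rr_def zmod_int)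
  finally show "rr (z1 + z2) = (rr z1 + rr z2) mod G" by simp
qed

lemma periodic_cnt_mult:
  assumes "periodic (int g) S" "g > 0" "g dvd n"
  shows "real (cnt S 0 (int n)) * g = n * real (cnt S 0 (int g))"
proof -
  obtain k where k: "n = g * k" using assms(3) by (rule dvdE)
  show ?thesis using cnt_periodic_mult[OF assms(1), of k] assms(2) unfolding k by (simp add: mult_ac)
qed

text \<open>Weights become multiplicities in \<open>\<int>/(G N)\<close>: the class \<open>r\<close> modulo \<open>G\<close> receives
  the residues \<open>r + G j\<close> with \<open>j\<close> below about \<open>N f(r)\<close>.\<close>

lemma weighted_kneser:
  fixes f c :: "nat \<Rightarrow> real" and G :: nat and \<epsilon> \<alpha> \<beta> :: real
  assumes G: "G > 0" and \<epsilon>: "\<epsilon> > 0" and Good: "Good \<subseteq> {..<G}" and Bad: "Bad \<subseteq> {..<G}"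
    and f: "\<And>r. r \<in> Good \<Longrightarrow> \<epsilon> \<le> f r" "\<And>r. r \<in> Good \<Longrightarrow> f r \<le> 1"
    and pair: "\<And>r r'. r \<in> Good \<Longrightarrow> r' \<in> Good \<Longrightarrow> (r + r') mod G \<notin> Bad \<Longrightarrow> min 1 (f r + f r') - \<epsilon> \<le> c ((r + r') mod G)"
    and c: "\<And>r. r < G \<Longrightarrow> 0 \<le> c r" and cBad: "real (card Bad) \<le> \<epsilon> * G"
    and sumc: "(\<Sum>r<G. c r) \<le> \<beta> * G" and sumf: "(\<alpha> - 2 * \<epsilon>) * G \<le> (\<Sum>r\<in>Good. f r)"
    and ab: "0 \<le> \<beta>" "16 * \<epsilon> \<le> 2 * \<alpha> - \<beta>"
    and dv: "\<And>g::nat. 0 < g \<Longrightarrow> real g \<le> 2 / (2 * \<alpha> - \<beta>) \<Longrightarrow> g dvd G"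
  obtains g :: nat and P where "g > 0" "real g \<le> 2 / (2 * \<alpha> - \<beta>)" "periodic (int g) P" "P \<noteq> {}"
    "\<And>h. periodic h (P + P) \<longleftrightarrow> int g dvd h" "cnt (P + P) 0 (int g) + 1 = 2 * cnt P 0 (int g)"
    "real (cnt (P + P) 0 (int g)) \<le> (\<beta> + 2 * \<epsilon>) * g" "(\<alpha> - 3 * \<epsilon>) * g \<le> real (cnt P 0 (int g))"
    "\<And>r. r \<in> Good \<Longrightarrow> int r \<in> P" "g dvd G"
proof -
  \<comment> \<open>\<open>N * \<epsilon> \<ge> 1\<close>, so losing one residue per class by
    rounding costs at most \<open>\<epsilon>\<close> in density.\<close>
  define N where "N = nat \<lceil>1 / \<epsilon>\<rceil>"
  have N1: "real N \<ge> 1 / \<epsilon>" unfolding N_def by linarith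
  moreover have "0 < 1 / \<epsilon>" using \<epsilon> by simp
  ultimately have "0 < real N" by linarith
  then have N: "N > 0" by simp
  have N\<epsilon>: "1 \<le> real N * \<epsilon>" using N1 \<epsilon> by (simp add: field_simps)
  define rr where "rr z = nat (z mod int G)" for z
  define jj where "jj z = nat (z mod int (G * N) div int G)" for z
  define X where "X = {z. rr z \<in> Good \<and> real (jj z) + 1 \<le> real N * f (rr z)}"
  \<comment> \<open>Nothing is known about \<open>c\<close> on \<open>Bad\<close>, so these classes
    enter \<open>S\<close> completely; this costs at most a share \<open>\<epsilon>\<close>.\<close>
  define S where "S = {z. rr z \<in> Bad \<or> real (jj z) + 1 \<le> real N * (c (rr z) + \<epsilon>)}"
  let ?n = "int (G * N)"
  have n: "?n > 0" using G N by simp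
  have perX: "periodic ?n X"
  proof -
    have "(z + ?n) mod int G = z mod int G" "(z + ?n) mod ?n = z mod ?n" for z by simp_all
    then show ?thesis unfolding periodic_def X_def rr_def jj_def by (simp only: mem_Collect_eq simp_thms)
  qed
  have XS: "X + X \<subseteq> S"
  proof
    fix z assume "z \<in> X + X"
    then obtain z1 z2 where z: "z = z1 + z2" "z1 \<in> X" "z2 \<in> X" by (auto elim!: set_plus_elim)
    note dig = sumset_digits[OF G N, of z1 z2, folded rr_def jj_def]
    show "z \<in> S"
    proof (cases "rr z \<in> Bad")
      case False
      have r: "rr z = (rr z1 + rr z2) mod G" using dig(1) z(1) by simp
      have "min 1 (f (rr z1) + f (rr z2)) - \<epsilon> \<le> c (rr z)"
        using pair[of "rr z1" "rr z2"] z False r by (simp add: X_def)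
      then have "real N * min 1 (f (rr z1) + f (rr z2)) \<le> real N * (c (rr z) + \<epsilon>)"
        by (intro mult_left_mono) auto
      moreover have "real (jj z) + 1 \<le> real N" using dig(3) z(1) by simp
      \<comment> \<open>The two \<open>+ 1\<close> in the membership conditions of \<open>z1\<close>
        and \<open>z2\<close> pay for the carry and for the \<open>+ 1\<close> required of
        \<open>z\<close>.\<close>
      moreover have "real (jj z) + 1 \<le> real N * f (rr z1) + real N * f (rr z2)"
        using dig(2) z by (simp add: X_def)
      ultimately show ?thesis by (auto simp: S_def min_def distrib_left split: if_splits)
    qed (simp add: S_def)
  qed
  have cX: "(\<alpha> - 3 * \<epsilon>) * (G * N) \<le> real (cnt X 0 ?n)"
  proof -
    have "cnt X 0 ?n = (\<Sum>r<G. card {j \<in> {..<N}. r \<in> Good \<and> real j + 1 \<le> real N * f r})"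
      unfolding X_def rr_def jj_def by (rule cnt_grid[OF G N])
    also have "\<dots> = (\<Sum>r\<in>Good. card {j \<in> {..<N}. real j + 1 \<le> real N * f r})"
      using Good by (intro sum.mono_neutral_cong_right) auto
    finally have "real (cnt X 0 ?n) = (\<Sum>r\<in>Good. real (card {j \<in> {..<N}. real j + 1 \<le> real N * f r}))" by simp
    also have "\<dots> \<ge> (\<Sum>r\<in>Good. real N * f r - 1)"
    proof (rule sum_mono)
      fix r assume r: "r \<in> Good"
      have "0 \<le> f r" using f(1)[OF r] \<epsilon> by linarith
      then show "real N * f r - 1 \<le> real (card {j \<in> {..<N}. real j + 1 \<le> real N * f r})"
        using f(2)[OF r] by (intro card_initial(2)) (auto simp: mult_left_le)
    qed
    also have "(\<Sum>r\<in>Good. real N * f r - 1) = real N * (\<Sum>r\<in>Good. f r) - card Good"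
      by (simp add: sum_subtractf sum_distrib_left)
    finally have "real N * (\<Sum>r\<in>Good. f r) - card Good \<le> real (cnt X 0 ?n)" .
    moreover have "card Good \<le> G" using Good by (metis card_lessThan card_mono finite_lessThan)
    moreover have "real N * ((\<alpha> - 2 * \<epsilon>) * G) \<le> real N * (\<Sum>r\<in>Good. f r)" using sumf by (intro mult_left_mono) auto
    moreover have "real G * 1 \<le> real G * (real N * \<epsilon>)" using N\<epsilon> by (intro mult_left_mono) auto
    ultimately show ?thesis by (simp add: algebra_simps)
  qed
  have cS: "real (cnt S 0 ?n) \<le> (\<beta> + 2 * \<epsilon>) * (G * N)"
  proof -
    have "cnt S 0 ?n = (\<Sum>r<G. card {j \<in> {..<N}. r \<in> Bad \<or> real j + 1 \<le> real N * (c r + \<epsilon>)})"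
      unfolding S_def rr_def jj_def by (rule cnt_grid[OF G N])
    then have "real (cnt S 0 ?n) = (\<Sum>r<G. real (card {j \<in> {..<N}. r \<in> Bad \<or> real j + 1 \<le> real N * (c r + \<epsilon>)}))" by simp
    also have "\<dots> \<le> (\<Sum>r<G. real N * of_bool (r \<in> Bad) + real N * (c r + \<epsilon>))"
    proof (rule sum_mono)
      fix r assume "r \<in> {..<G}"
      then have c0: "0 \<le> real N * (c r + \<epsilon>)" using c[of r] \<epsilon> by simp
      show "real (card {j \<in> {..<N}. r \<in> Bad \<or> real j + 1 \<le> real N * (c r + \<epsilon>)}) \<le> real N * of_bool (r \<in> Bad) + real N * (c r + \<epsilon>)"
        using c0 card_initial(1)[OF c0, of N] by (cases "r \<in> Bad") auto
    qed
    also have "\<dots> = real N * (\<Sum>r<G. of_bool (r \<in> Bad)) + real N * ((\<Sum>r<G. c r) + G * \<epsilon>)"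
      by (simp add: sum.distrib sum_distrib_left[symmetric])
    also have "(\<Sum>r<G. of_bool (r \<in> Bad) :: real) = card Bad"
      using Bad by (simp add: sum.If_cases Int_absorb1 of_bool_def)
    also have "real N * card Bad + real N * ((\<Sum>r<G. c r) + G * \<epsilon>) \<le> real N * (\<epsilon> * G) + real N * (\<beta> * G + G * \<epsilon>)"
      using cBad sumc by (intro add_mono mult_left_mono) auto
    finally show ?thesis by (simp add: algebra_simps)
  qed
  have cXX: "real (cnt (X + X) 0 ?n) \<le> (\<beta> + 2 * \<epsilon>) * (G * N)"
    using cS cnt_mono[OF XS, of 0 ?n] by linarith
  have GN: "real G * real N > 0" using G N by simp
  have \<alpha>: "\<alpha> - 3 * \<epsilon> > 0" using ab \<epsilon> by linarith
  have "X \<noteq> {}"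
  proof
    assume "X = {}"
    then have "(\<alpha> - 3 * \<epsilon>) * (real G * real N) \<le> 0" using cX by (simp add: cnt_def)
    then show False using mult_pos_pos[OF \<alpha> GN] by linarith
  qed
  then obtain x0 where x0: "x0 \<in> X" by blast
  obtain g0 where "g0 > 0" "g0 dvd ?n" "periodic g0 (X + X)"
    using kneser_weak[OF n perX \<open>X \<noteq> {}\<close> perX \<open>X \<noteq> {}\<close>] by blast
  then have pn: "periodic ?n (X + X)" using periodic_dvd by blast
  obtain gi where gi: "gi > 0" "\<And>h. periodic h (X + X) \<longleftrightarrow> gi dvd h" using periods_principal[OF pn n] by blast
  define g where "g = nat gi"
  have g: "g > 0" "int g = gi" using gi(1) by (auto simp: g_def)
  have stab: "periodic h (X + X) \<longleftrightarrow> int g dvd h" for h using gi(2) g(2) by simp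
  have gn: "g dvd G * N" using stab pn by (metis int_dvd_int_iff)
  \<comment> \<open>Filling \<open>X\<close> up modulo the stabiliser of \<open>X + X\<close> does
    not change the sum, and turns \<open>X\<close> into a union of classes.\<close>
  define P where "P = {x. \<exists>a\<in>X. int g dvd x - a}"
  have pP: "periodic (int g) P" and cP: "cnt P 0 (int g) = card ((\<lambda>x. x mod int g) ` X)"
    unfolding P_def using card_mod_image[of "int g" X] g(1) by auto
  have XP: "X \<subseteq> P" by (force simp: P_def)
  have pXX: "periodic (int g) (X + X)" using stab by simp
  have PP: "P + P = X + X"
  proof
    show "X + X \<subseteq> P + P" by (rule set_plus_mono2[OF XP XP])
    show "P + P \<subseteq> X + X"
    proof
      fix s assume "s \<in> P + P"
      then obtain x y a b where s: "s = x + y" "a \<in> X" "b \<in> X" "int g dvd x - a" "int g dvd y - b"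
        by (auto elim!: set_plus_elim simp: P_def)
      then have "int g dvd (x - a) + (y - b)" by auto
      then have "int g dvd s - (a + b)" using s(1) by (simp add: algebra_simps)
      then show "s \<in> X + X" using periodic_dvd_diff[OF pXX] s by blast
    qed
  qed
  have satXX: "{x. \<exists>a\<in>X + X. int g dvd x - a} = X + X"
    using periodic_dvd_diff[OF pXX] by force
  have kn: "2 * cnt P 0 (int g) \<le> cnt (P + P) 0 (int g) + 1"
    using kneser_mod[of "int g" X X] g(1) \<open>X \<noteq> {}\<close> stab card_mod_image(2)[of "int g" "X + X"]
    unfolding PP cP satXX by simp
  have up: "real (cnt (P + P) 0 (int g)) \<le> (\<beta> + 2 * \<epsilon>) * g"
  proof -
    have "real (cnt (X + X) 0 ?n) * g = (G * N) * real (cnt (X + X) 0 (int g))"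
      using periodic_cnt_mult[OF pXX g(1) gn] by simp
    moreover have "real (cnt (X + X) 0 ?n) * g \<le> (\<beta> + 2 * \<epsilon>) * (G * N) * g"
      using cXX by (intro mult_right_mono) auto
    ultimately have "(real G * real N) * real (cnt (X + X) 0 (int g)) \<le> (real G * real N) * ((\<beta> + 2 * \<epsilon>) * g)"
      by (simp add: mult_ac)
    then show ?thesis using GN unfolding PP by (simp only: mult_le_cancel_left_pos)
  qed
  have lo: "(\<alpha> - 3 * \<epsilon>) * g \<le> real (cnt P 0 (int g))"
  proof -
    have "real (cnt P 0 ?n) * g = (G * N) * real (cnt P 0 (int g))"
      using periodic_cnt_mult[OF pP g(1) gn] by simp
    moreover have "cnt X 0 ?n \<le> cnt P 0 ?n" by (rule cnt_mono[OF XP])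
    then have "(\<alpha> - 3 * \<epsilon>) * (G * N) * g \<le> real (cnt P 0 ?n) * g"
      using cX by (intro mult_right_mono) auto
    ultimately have "(real G * real N) * ((\<alpha> - 3 * \<epsilon>) * g) \<le> (real G * real N) * real (cnt P 0 (int g))"
      by (simp add: mult_ac)
    then show ?thesis using GN by (simp only: mult_le_cancel_left_pos)
  qed
  have gpos: "real g > 0" using g by simp
  \<comment> \<open>So \<open>|P + P| < 2 |P|\<close>, and Kneser's bound becomes an equality.
    Inserted into the density bounds it leaves
    \<open>(2 \<alpha> - \<beta> - 8 \<epsilon>) g \<le> 1\<close>, where
    \<open>8 \<epsilon>\<close> is at most half of \<open>2 \<alpha> - \<beta>\<close>; this bounds
    \<open>g\<close>.\<close>
  have "\<beta> + 2 * \<epsilon> < 2 * (\<alpha> - 3 * \<epsilon>)" using ab(2) \<epsilon> unfolding right_diff_distrib by linarith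
  then have "(\<beta> + 2 * \<epsilon>) * g < 2 * (\<alpha> - 3 * \<epsilon>) * g" using gpos by (rule mult_strict_right_mono)
  then have "(\<beta> + 2 * \<epsilon>) * g < 2 * ((\<alpha> - 3 * \<epsilon>) * g)" by (simp only: mult.assoc)
  then have "real (cnt (P + P) 0 (int g)) < 2 * real (cnt P 0 (int g))" using up lo by linarith
  then have eq: "cnt (P + P) 0 (int g) + 1 = 2 * cnt P 0 (int g)" using kn by linarith
  then have "2 * real (cnt P 0 (int g)) = real (cnt (P + P) 0 (int g)) + 1" by linarith
  then have "2 * ((\<alpha> - 3 * \<epsilon>) * g) \<le> (\<beta> + 2 * \<epsilon>) * g + 1" using up lo by linarith
  moreover have "8 * \<epsilon> * g \<le> (2 * \<alpha> - \<beta>) / 2 * g" using ab by (intro mult_right_mono) auto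
  ultimately have "(2 * \<alpha> - \<beta>) / 2 * g \<le> 1" by (simp add: algebra_simps)
  then have gle: "real g \<le> 2 / (2 * \<alpha> - \<beta>)" using ab \<epsilon> by (simp add: field_simps)
  have gG: "g dvd G" by (rule dv[OF g(1) gle])
  \<comment> \<open>The residue \<open>r\<close> itself has high digit \<open>0\<close>, and
    \<open>N * f r \<ge> N * \<epsilon> \<ge> 1\<close>, so \<open>r\<close> lies in
    \<open>X\<close>.\<close>
  have "int r \<in> P" if r: "r \<in> Good" for r
  proof -
    have rG: "r < G" using Good r by auto
    then have "r < G * N" using N by (metis less_le_trans mult.right_neutral mult_le_mono2 Suc_leI One_nat_def)
    then have "int r mod int (G * N) div int G = 0" using rG by (simp add: zmod_int[symmetric] zdiv_int[symmetric] del: of_nat_mult)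
    moreover have "real N * \<epsilon> \<le> real N * f r" using f(1)[OF r] by (intro mult_left_mono) auto
    ultimately have "int r \<in> X" using r rG N\<epsilon> by (simp add: X_def rr_def jj_def)
    then show ?thesis using XP by blast
  qed
  moreover have "P \<noteq> {}" using XP x0 by blast
  ultimately show thesis using that[of g P] g gle pP stab eq up lo gG unfolding PP by blast
qed

section \<open>Energy increment\<close>

lemma sum_mod_split: "(\<Sum>x<G * M. h x) = (\<Sum>c<G. \<Sum>j<M. h (c + G * j))" for G M :: nat
proof -
  have "(\<Sum>x<G * M. h x) = (\<Sum>j<M. sum h {j * G..<j * G + G})"
    by (simp add: sum.nat_group mult.commute)
  also have "\<dots> = (\<Sum>j<M. \<Sum>c<G. h (c + G * j))"
  proof (rule sum.cong[OF refl])
    fix j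
    have "sum h {j * G..<j * G + G} = (\<Sum>c\<in>{0..<G}. h (j * G + c))"
      by (subst sum.atLeastLessThan_shift_0) simp
    then show "sum h {j * G..<j * G + G} = (\<Sum>c<G. h (c + G * j))"
      by (simp add: atLeast0LessThan add.commute mult.commute)
  qed
  also have "\<dots> = (\<Sum>c<G. \<Sum>j<M. h (c + G * j))" by (rule sum.swap)
  finally show ?thesis .
qed

text \<open>The energy is monotone under refinement of both the window and the modulus, so at a window
  almost maximising it no refinement moves the densities much.\<close>

lemma regular_window:
  fixes F :: "bool \<Rightarrow> nat \<Rightarrow> nat \<Rightarrow> nat \<Rightarrow> nat \<Rightarrow> real"
  assumes nn: "\<And>b G c d p. 0 < G \<Longrightarrow> 0 < d \<Longrightarrow> 0 \<le> F b G c d p"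
    and le1: "\<And>b G c d p. 0 < G \<Longrightarrow> 0 < d \<Longrightarrow> F b G c d p \<le> 1"
    and refine: "\<And>b G c d p M T. c < G \<Longrightarrow> 0 < M \<Longrightarrow> 0 < d \<Longrightarrow> 0 < T \<Longrightarrow>
      (\<Sum>i<T. \<Sum>j<M. F b (G * M) (c + G * j) (d * T) (p * T + i)) = real (T * M) * F b G c d p"
    and \<eta>: "\<eta> > 0" and M0: "M0 > 0"
  obtains G d p where "G > 0" "d > 0" "M0 dvd G"
    "\<And>M T. M > 0 \<Longrightarrow> T > 0 \<Longrightarrow> (\<Sum>c<G. \<Sum>b\<in>UNIV. \<Sum>i<T. \<Sum>j<M.
      (F b (G * M) (c + G * j) (d * T) (p * T + i) - F b G c d p)\<^sup>2) \<le> \<eta> * real (G * T * M)"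
proof -
  define En where "En G d p = (\<Sum>c<G. \<Sum>b\<in>UNIV. (F b G c d p)\<^sup>2) / G" for G d p
  \<comment> \<open>Pythagoras: by \<open>refine\<close> the refined values have the coarse one as
    their mean, so their squared deviation is the gain in energy.\<close>
  have var: "(\<Sum>c<G. \<Sum>b\<in>UNIV. \<Sum>i<T. \<Sum>j<M. (F b (G * M) (c + G * j) (d * T) (p * T + i) - F b G c d p)\<^sup>2)
      = real (G * M) * (\<Sum>i<T. En (G * M) (d * T) (p * T + i)) - real (T * M) * real G * En G d p"
    if pos: "0 < G" "0 < M" "0 < d" "0 < T" for G M d T p
  proof -
    have one: "(\<Sum>i<T. \<Sum>j<M. (F b (G * M) (c + G * j) (d * T) (p * T + i) - F b G c d p)\<^sup>2) =
      (\<Sum>i<T. \<Sum>j<M. (F b (G * M) (c + G * j) (d * T) (p * T + i))\<^sup>2) - real (T * M) * (F b G c d p)\<^sup>2"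
      if "c < G" for c b
    proof -
      let ?x = "\<lambda>i j. F b (G * M) (c + G * j) (d * T) (p * T + i)" and ?m = "F b G c d p"
      have "(\<Sum>i<T. \<Sum>j<M. (?x i j - ?m)\<^sup>2) = (\<Sum>i<T. \<Sum>j<M. (?x i j)\<^sup>2) - 2 * ?m * (\<Sum>i<T. \<Sum>j<M. ?x i j) + real (T * M) * ?m\<^sup>2"
        by (simp add: power2_diff sum.distrib sum_subtractf sum_distrib_left mult_ac)
      also have "(\<Sum>i<T. \<Sum>j<M. ?x i j) = real (T * M) * ?m" using refine that pos by blast
      finally show ?thesis by (simp add: power2_eq_square algebra_simps)
    qed
    have "(\<Sum>c<G. \<Sum>b\<in>UNIV. \<Sum>i<T. \<Sum>j<M. (F b (G * M) (c + G * j) (d * T) (p * T + i) - F b G c d p)\<^sup>2)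
      = (\<Sum>c<G. \<Sum>b\<in>UNIV. (\<Sum>i<T. \<Sum>j<M. (F b (G * M) (c + G * j) (d * T) (p * T + i))\<^sup>2) - real (T * M) * (F b G c d p)\<^sup>2)"
      by (intro sum.cong refl one) simp
    also have "\<dots> = (\<Sum>c<G. \<Sum>b\<in>UNIV. \<Sum>i<T. \<Sum>j<M. (F b (G * M) (c + G * j) (d * T) (p * T + i))\<^sup>2)
      - real (T * M) * (\<Sum>c<G. \<Sum>b\<in>UNIV. (F b G c d p)\<^sup>2)"
      by (simp only: sum_subtractf sum_distrib_left)
    also have "(\<Sum>c<G. \<Sum>b\<in>UNIV. (F b G c d p)\<^sup>2) = real G * En G d p" using pos by (simp add: En_def)
    also have "(\<Sum>c<G. \<Sum>b\<in>UNIV. \<Sum>i<T. \<Sum>j<M. (F b (G * M) (c + G * j) (d * T) (p * T + i))\<^sup>2)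
      = (\<Sum>i<T. \<Sum>x<G * M. \<Sum>b\<in>UNIV. (F b (G * M) x (d * T) (p * T + i))\<^sup>2)"
    proof -
      have "(\<Sum>i<T. \<Sum>x<G * M. \<Sum>b\<in>UNIV. (F b (G * M) x (d * T) (p * T + i))\<^sup>2)
        = (\<Sum>i<T. \<Sum>c<G. \<Sum>j<M. \<Sum>b\<in>UNIV. (F b (G * M) (c + G * j) (d * T) (p * T + i))\<^sup>2)"
        by (simp only: sum_mod_split)
      also have "\<dots> = (\<Sum>c<G. \<Sum>i<T. \<Sum>j<M. \<Sum>b\<in>UNIV. (F b (G * M) (c + G * j) (d * T) (p * T + i))\<^sup>2)"
        by (rule sum.swap)
      also have "\<dots> = (\<Sum>c<G. \<Sum>i<T. \<Sum>b\<in>UNIV. \<Sum>j<M. (F b (G * M) (c + G * j) (d * T) (p * T + i))\<^sup>2)"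
        by (intro sum.cong refl) (rule sum.swap)
      also have "\<dots> = (\<Sum>c<G. \<Sum>b\<in>UNIV. \<Sum>i<T. \<Sum>j<M. (F b (G * M) (c + G * j) (d * T) (p * T + i))\<^sup>2)"
        by (intro sum.cong refl) (rule sum.swap)
      finally show ?thesis by simp
    qed
    also have "\<dots> = real (G * M) * (\<Sum>i<T. En (G * M) (d * T) (p * T + i))"
      using pos by (simp add: En_def sum_divide_distrib[symmetric])
    finally show ?thesis by simp
  qed
  have Enle: "En G d p \<le> 2" if "0 < G" "0 < d" for G d p
  proof -
    have "(\<Sum>c<G. \<Sum>b\<in>UNIV. (F b G c d p)\<^sup>2) \<le> (\<Sum>c<G. \<Sum>b\<in>(UNIV::bool set). 1)"
      by (intro sum_mono power_le_one nn le1 that)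
    also have "\<dots> = 2 * real G" by simp
    finally show ?thesis unfolding En_def using that by (simp add: field_simps)
  qed
  define V where "V = Sup {En G d p | G d p. 0 < G \<and> 0 < d}"
  have bdd: "bdd_above {En G d p | G d p. 0 < G \<and> 0 < d}" using Enle by (intro bdd_aboveI[of _ 2]) auto
  have EnV: "En G d p \<le> V" if "0 < G" "0 < d" for G d p
    unfolding V_def using that by (intro cSup_upper bdd) auto
  have "V - \<eta> < V" using \<eta> by simp
  moreover have "{En G d p | G d p. 0 < G \<and> 0 < d} \<noteq> {}" by blast
  ultimately obtain x where "x \<in> {En G d p | G d p. 0 < G \<and> 0 < d}" "V - \<eta> < x"
    unfolding V_def by (rule less_cSupE)
  then obtain G0 d p where G0: "0 < G0" "0 < d" "V - \<eta> < En G0 d p" by blast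
  \<comment> \<open>Refining the modulus by \<open>M0\<close> with \<open>T = 1\<close> does not
    lower the energy, so divisibility by \<open>M0\<close> comes without losing
    near-maximality.\<close>
  define G where "G = G0 * M0"
  have G: "0 < G" using G0 M0 by (simp add: G_def)
  have "0 \<le> (\<Sum>c<G0. \<Sum>b\<in>UNIV. \<Sum>i<1. \<Sum>j<M0. (F b (G0 * M0) (c + G0 * j) (d * 1) (p * 1 + i) - F b G0 c d p)\<^sup>2)"
    by (intro sum_nonneg) auto
  also have "\<dots> = real (G0 * M0) * (\<Sum>i<1. En (G0 * M0) (d * 1) (p * 1 + i)) - real (1 * M0) * real G0 * En G0 d p"
    by (rule var) (use G0 M0 in auto)
  finally have "real (G0 * M0) * En G0 d p \<le> real (G0 * M0) * En G d p" by (simp add: G_def mult_ac)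
  then have "En G0 d p \<le> En G d p" using G unfolding G_def by simp
  then have EnG: "V - \<eta> < En G d p" using G0 by linarith
  show thesis
  proof (rule that[OF G G0(2)])
    show "M0 dvd G" by (simp add: G_def)
    fix M T :: nat assume MT: "M > 0" "T > 0"
    have "(\<Sum>c<G. \<Sum>b\<in>UNIV. \<Sum>i<T. \<Sum>j<M. (F b (G * M) (c + G * j) (d * T) (p * T + i) - F b G c d p)\<^sup>2)
      = real (G * M) * (\<Sum>i<T. En (G * M) (d * T) (p * T + i)) - real (T * M) * real G * En G d p"
      by (rule var) (use G G0 MT in auto)
    also have "(\<Sum>i<T. En (G * M) (d * T) (p * T + i)) \<le> (\<Sum>i<T. V)"
      using G G0 MT by (intro sum_mono EnV) auto
    also have "real (G * M) * (\<Sum>i<T. V) - real (T * M) * real G * En G d p \<le> real (G * M) * (\<Sum>i<T. V) - real (T * M) * real G * (V - \<eta>)"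
      using EnG by (intro diff_left_mono mult_left_mono) auto
    also have "\<dots> = \<eta> * real (G * T * M)" by (simp add: algebra_simps)
    finally show "(\<Sum>c<G. \<Sum>b\<in>UNIV. \<Sum>i<T. \<Sum>j<M. (F b (G * M) (c + G * j) (d * T) (p * T + i) - F b G c d p)\<^sup>2) \<le> \<eta> * real (G * T * M)"
      by (simp add: mult_left_mono)
  qed
qed

section \<open>From a regular window to a union of classes\<close>

text \<open>Writing the elements of the class of \<open>r\<close> as \<open>r + G x\<close>, classes
  of \<open>x\<close> modulo \<open>Q\<close> are classes modulo \<open>G * Q\<close>. In this form
  densities on refined classes are fed to \<open>equidistributed_sumset\<close>.\<close>

lemma cnt_rescale:
  fixes \<mu> :: int
  assumes "r < G" "Q > 0"
  shows "cnt ({x. int r + int G * x \<in> S} \<inter> {x. int Q dvd x - \<mu>}) a b =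
    cnt (S \<inter> {z. z mod int (G * Q) = int (r + G * nat (\<mu> mod int Q))}) (int G * a) (int G * b)"
proof -
  have G: "G > 0" using assms by simp
  have modGQ: "z mod int (G * Q) = int G * (z div int G mod int Q) + z mod int G" for z
    using zmod_zmult2_eq[of "int Q" z "int G"] by simp
  have \<mu>: "int (nat (\<mu> mod int Q)) = \<mu> mod int Q" using assms by simp
  have "bij_betw (\<lambda>x. int r + int G * x) (({x. int r + int G * x \<in> S} \<inter> {x. int Q dvd x - \<mu>}) \<inter> {a..<b})
    ((S \<inter> {z. z mod int (G * Q) = int (r + G * nat (\<mu> mod int Q))}) \<inter> {int G * a..<int G * b})"
  proof (rule bij_betw_byWitness[where f' = "\<lambda>z. z div int G"])
    show "\<forall>x\<in>({x. int r + int G * x \<in> S} \<inter> {x. int Q dvd x - \<mu>}) \<inter> {a..<b}. (int r + int G * x) div int G = x"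
      using assms by simp
    have recover: "int r + int G * (z div int G) = z \<and> (z div int G) mod int Q = \<mu> mod int Q"
      if "z mod int (G * Q) = int (r + G * nat (\<mu> mod int Q))" for z
    proof -
      have "(z mod int (G * Q)) mod int G = int r" using that assms by simp
      then have zr: "z mod int G = int r" using modGQ[of z] by simp
      then have "int G * (z div int G mod int Q) = int G * (\<mu> mod int Q)" using that modGQ[of z] \<mu> by auto
      then have "z div int G mod int Q = \<mu> mod int Q" using G by simp
      then show ?thesis using zr mult_div_mod_eq[of "int G" z] by simp
    qed
    then show "\<forall>z\<in>(S \<inter> {z. z mod int (G * Q) = int (r + G * nat (\<mu> mod int Q))}) \<inter> {int G * a..<int G * b}.
        int r + int G * (z div int G) = z" by blast
    show "(\<lambda>x. int r + int G * x) ` (({x. int r + int G * x \<in> S} \<inter> {x. int Q dvd x - \<mu>}) \<inter> {a..<b})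
      \<subseteq> (S \<inter> {z. z mod int (G * Q) = int (r + G * nat (\<mu> mod int Q))}) \<inter> {int G * a..<int G * b}"
    proof (rule image_subsetI)
      fix x assume x: "x \<in> ({x. int r + int G * x \<in> S} \<inter> {x. int Q dvd x - \<mu>}) \<inter> {a..<b}"
      then have "x mod int Q = \<mu> mod int Q" by (simp add: mod_eq_dvd_iff)
      then have "(int r + int G * x) mod int (G * Q) = int (r + G * nat (\<mu> mod int Q))"
        using modGQ[of "int r + int G * x"] assms \<mu> by simp
      moreover have "int G * a \<le> int G * x" using x by (intro mult_left_mono) auto
      then have "int G * a \<le> int r + int G * x" by linarith
      moreover have "int G * (x + 1) \<le> int G * b" using x by (intro mult_left_mono) auto
      then have "int r + int G * x < int G * b" using assms(1) unfolding distrib_left by linarith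
      ultimately show "int r + int G * x \<in> (S \<inter> {z. z mod int (G * Q) = int (r + G * nat (\<mu> mod int Q))}) \<inter> {int G * a..<int G * b}"
        using x assms by (simp add: distrib_left)
    qed
    show "(\<lambda>z. z div int G) ` ((S \<inter> {z. z mod int (G * Q) = int (r + G * nat (\<mu> mod int Q))}) \<inter> {int G * a..<int G * b})
      \<subseteq> ({x. int r + int G * x \<in> S} \<inter> {x. int Q dvd x - \<mu>}) \<inter> {a..<b}"
    proof (rule image_subsetI)
      fix z assume z: "z \<in> (S \<inter> {z. z mod int (G * Q) = int (r + G * nat (\<mu> mod int Q))}) \<inter> {int G * a..<int G * b}"
      then have bk: "int r + int G * (z div int G) = z" "(z div int G) mod int Q = \<mu> mod int Q" using recover by auto
      have "int G * (z div int G) < int G * b" using z bk(1) by auto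
      then have "z div int G < b" using G by simp
      moreover have "int G * a < int G * (z div int G + 1)" using z bk(1) assms(1) by (simp add: distrib_left)
      then have "a < z div int G + 1" using G by simp
      ultimately show "z div int G \<in> ({x. int r + int G * x \<in> S} \<inter> {x. int Q dvd x - \<mu>}) \<inter> {a..<b}"
        using z bk by (simp add: mod_eq_dvd_iff[symmetric])
    qed
  qed
  then show ?thesis unfolding cnt_def by (rule bij_betw_same_card)
qed

text \<open>The outcome concerns one window only and still admits a share \<open>tol\<close> of
  exceptions to membership in \<open>P\<close>; both restrictions are removed by the confinement
  argument.\<close>

lemma structured_window:
  fixes A :: "nat set" and \<alpha> \<beta> tol :: real
  assumes dA: "has_density A \<alpha>" and dC: "has_density (A + A) \<beta>"
    and tol: "0 < tol" "tol \<le> 1" "16 * tol \<le> 2 * \<alpha> - \<beta>"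
  obtains g d p :: nat and P \<rho> where "g > 0" "real g \<le> 2 / (2 * \<alpha> - \<beta>)" "d > 0" "periodic (int g) P" "P \<noteq> {}"
    "\<And>h. periodic h (P + P) \<longleftrightarrow> int g dvd h" "cnt (P + P) 0 (int g) + 1 = 2 * cnt P 0 (int g)"
    "real (cnt (P + P) 0 (int g)) \<le> (\<beta> + tol) * g" "(\<alpha> - tol) * g \<le> real (cnt P 0 (int g))"
    "strict_mono (\<rho> :: nat \<Rightarrow> nat)"
    "\<forall>\<^sub>F k in sequentially. real (cnt (int ` A - P) (int p * int (fact (\<rho> k) div d)) (int (Suc p) * int (fact (\<rho> k) div d)))
      \<le> tol * real (fact (\<rho> k) div d)"
proof -
  define \<epsilon> where "\<epsilon> = tol / 8"
  have \<epsilon>: "0 < \<epsilon>" "\<epsilon> \<le> 1" "16 * \<epsilon> \<le> 2 * \<alpha> - \<beta>" using tol by (auto simp: \<epsilon>_def)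
  obtain Q T w0 :: nat and \<theta> :: real where Q: "Q > 0" and T: "T > 0" and \<theta>: "\<theta> > 0" and conn:
    "\<And>X0 Y0 C u a b c w. \<lbrakk>w \<ge> w0; \<And>x y. x \<in> X0 \<Longrightarrow> y \<in> Y0 \<Longrightarrow> x + y \<in> C; \<epsilon> \<le> a; a \<le> 1; \<epsilon> \<le> b; b \<le> 1;
      \<And>i m. i < T \<Longrightarrow> (a - \<theta>) * real w / real Q \<le>
        real (cnt (X0 \<inter> {x. int Q dvd x - m}) (u + int w * int i) (u + int w * int (Suc i)));
      \<And>i. i < T \<Longrightarrow> (b - \<theta>) * real w \<le> real (cnt Y0 (u + int w * int i) (u + int w * int (Suc i)));
      \<And>i. i < T \<Longrightarrow> real (cnt C (2 * u + 2 * int w * int i) (2 * u + 2 * int w * int (Suc i))) \<le> (c + \<theta>) * (2 * real w)\<rbrakk>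
      \<Longrightarrow> min 1 (a + b) - \<epsilon> \<le> c"
    using equidistributed_sumset[OF \<epsilon>(1,2)] by metis
  define S where "S b = (if b then int ` A else int ` (A + A))" for b
  define e :: "bool \<Rightarrow> nat" where "e b = (if b then 1 else 2)" for b
  define dens where "dens b = (if b then \<alpha> else \<beta>)" for b
  have e: "e b > 0" for b by (simp add: e_def)
  have S: "(\<lambda>n. real (cnt (S b) 0 (int n)) / real n) \<longlonglongrightarrow> dens b" for b
    using has_density_cnt[OF dA] has_density_cnt[OF dC] by (simp add: S_def dens_def)
  have \<beta>: "\<beta> \<ge> 0" by (rule LIMSEQ_le_const[OF S[of False, unfolded dens_def if_False]]) auto
  obtain \<rho> L where \<rho>: "strict_mono (\<rho> :: nat \<Rightarrow> nat)"
    and lim: "\<And>b G c d p. (\<lambda>k. window_density (S b) (e b) G c d p (\<rho> k)) \<longlonglongrightarrow> L b G c d p"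
    using ex_window_density_limits by metis
  \<comment> \<open>The factor \<open>G\<close> makes the densities relative to the class, with
    values in \<open>[0, 1]\<close>.\<close>
  define F where "F b G c d p = real G * L b G c d p" for b G c d p
  \<comment> \<open>With this value at most \<open>\<epsilon> * G\<close> classes have deviation
    above the square of \<open>\<theta> / 2\<close>. As the deviation is a sum over all
    \<open>T * Q\<close> pieces, every single piece of any other class is within
    \<open>\<theta> / 2\<close>.\<close>
  define \<eta> where "\<eta> = \<epsilon> * (\<theta> / 2)\<^sup>2 / (T * Q)"
  \<comment> \<open>Every \<open>g\<close> up to \<open>2 / (2 * \<alpha> - \<beta>)\<close> divides
    this factorial, hence divides \<open>G\<close>.\<close>
  define M0 :: nat where "M0 = fact (nat \<lfloor>2 / (2 * \<alpha> - \<beta>)\<rfloor>)"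
  have \<eta>: "\<eta> > 0" using \<epsilon> \<theta> T Q by (simp add: \<eta>_def)
  have Fb: "0 \<le> F b G c d p" "F b G c d p \<le> 1" if "0 < G" "0 < d" for b G c d p
    using limit_density_bounds[OF lim \<rho> e that, of b c p] that by (auto simp: F_def field_simps)
  have Fref: "(\<Sum>i<T. \<Sum>j<M. F b (G * M) (c + G * j) (d * T) (p * T + i)) = real (T * M) * F b G c d p"
    if "c < G" "0 < M" "0 < d" "0 < T" for b G c d p M T
  proof -
    have "(\<Sum>i<T. \<Sum>j<M. F b (G * M) (c + G * j) (d * T) (p * T + i)) =
      real (G * M) * (\<Sum>i<T. \<Sum>j<M. L b (G * M) (c + G * j) (d * T) (p * T + i))"
      by (simp add: F_def sum_distrib_left)
    also have "(\<Sum>i<T. \<Sum>j<M. L b (G * M) (c + G * j) (d * T) (p * T + i)) = real T * L b G c d p"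
      using limit_density_refine[OF lim \<rho> that, of b p] that by simp
    finally show ?thesis by (simp add: F_def mult_ac)
  qed
  obtain G d p where G: "G > 0" and d: "d > 0" and M0G: "M0 dvd G" and reg:
    "\<And>M T. M > 0 \<Longrightarrow> T > 0 \<Longrightarrow> (\<Sum>c<G. \<Sum>b\<in>UNIV. \<Sum>i<T. \<Sum>j<M.
      (F b (G * M) (c + G * j) (d * T) (p * T + i) - F b G c d p)\<^sup>2) \<le> \<eta> * real (G * T * M)"
    using regular_window[of F \<eta> M0, OF Fb Fref \<eta>] by (auto simp: M0_def)
  define V where "V b c = (\<Sum>i<T. \<Sum>j<Q. (F b (G * Q) (c + G * j) (d * T) (p * T + i) - F b G c d p)\<^sup>2)" for b c
  define Bad where "Bad b = {c. c < G \<and> (\<theta> / 2)\<^sup>2 < V b c}" for b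
  define f where "f c = F True G c d p" for c
  define cc where "cc c = F False G c d p" for c
  define Good where "Good = {c. c < G \<and> c \<notin> Bad True \<and> \<epsilon> \<le> f c}"
  have V0: "0 \<le> V b c" for b c unfolding V_def by (intro sum_nonneg) auto
  have cBad: "real (card (Bad b)) \<le> \<epsilon> * G" for b
  proof -
    have "real (card (Bad b)) * (\<theta> / 2)\<^sup>2 \<le> (\<Sum>c\<in>Bad b. V b c)"
      using sum_bounded_below[of "Bad b" "(\<theta> / 2)\<^sup>2" "V b"] by (simp add: Bad_def less_imp_le)
    also have "\<dots> \<le> (\<Sum>c<G. V b c)" by (intro sum_mono2) (auto simp: Bad_def V0)
    also have "\<dots> \<le> (\<Sum>c<G. \<Sum>b\<in>UNIV. V b c)"
      by (intro sum_mono) (cases b; simp add: UNIV_bool V0)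
    also have "\<dots> \<le> \<eta> * real (G * T * Q)" using reg[OF Q T] by (simp add: V_def)
    also have "\<dots> = (\<epsilon> * G) * (\<theta> / 2)\<^sup>2" using T Q by (simp add: \<eta>_def)
    finally show ?thesis using \<theta> by (simp add: mult_le_cancel_right)
  qed
  have close: "\<bar>F b (G * Q) (c + G * j) (d * T) (p * T + i) - F b G c d p\<bar> \<le> \<theta> / 2"
    if "c < G" "c \<notin> Bad b" "i < T" "j < Q" for b c i j
  proof -
    have "(F b (G * Q) (c + G * j) (d * T) (p * T + i) - F b G c d p)\<^sup>2 \<le>
      (\<Sum>j<Q. (F b (G * Q) (c + G * j) (d * T) (p * T + i) - F b G c d p)\<^sup>2)"
      using that by (intro member_le_sum) auto
    also have "\<dots> \<le> V b c" unfolding V_def using that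
      by (intro member_le_sum[of i "{..<T}" "\<lambda>i. \<Sum>j<Q. (F b (G * Q) (c + G * j) (d * T) (p * T + i) - F b G c d p)\<^sup>2"]) (auto intro: sum_nonneg)
    also have "\<dots> \<le> (\<theta> / 2)\<^sup>2" using that by (auto simp: Bad_def not_less)
    finally have "\<bar>F b (G * Q) (c + G * j) (d * T) (p * T + i) - F b G c d p\<bar> \<le> \<bar>\<theta> / 2\<bar>" by (simp only: abs_le_square_iff)
    then show ?thesis using \<theta> by simp
  qed
  have pair: "min 1 (f r + f r') - \<epsilon> \<le> cc ((r + r') mod G)"
    if r: "r \<in> Good" "r' \<in> Good" and nB: "(r + r') mod G \<notin> Bad False" for r r'
  proof -
    define r2 where "r2 = (r + r') mod G"
    have rG: "r < G" "r' < G" "r2 < G" using r G by (auto simp: Good_def r2_def)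
    have evA: "\<forall>\<^sub>F k in sequentially. \<forall>i\<in>{..<T}. \<forall>j\<in>{..<Q}.
        (f c - \<theta>) / (G * Q) < window_density (S True) (e True) (G * Q) (c + G * j) (d * T) (p * T + i) (\<rho> k)"
      if c: "c \<in> Good" for c
    proof (intro eventually_ball_finite ballI finite_lessThan)
      fix i j assume ij: "i \<in> {..<T}" "j \<in> {..<Q}"
      have "f c - \<theta> < F True (G * Q) (c + G * j) (d * T) (p * T + i)"
      proof -
        have "c < G" "c \<notin> Bad True" "i < T" "j < Q" using c ij by (auto simp: Good_def)
        from close[OF this] show ?thesis using \<theta> unfolding f_def by linarith
      qed
      then have "(f c - \<theta>) / (G * Q) < L True (G * Q) (c + G * j) (d * T) (p * T + i)"
        using G Q unfolding F_def by (simp add: field_simps)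
      then show "\<forall>\<^sub>F k in sequentially. (f c - \<theta>) / (G * Q) < window_density (S True) (e True) (G * Q) (c + G * j) (d * T) (p * T + i) (\<rho> k)"
        by (rule order_tendstoD(1)[OF lim])
    qed
    \<comment> \<open>For \<open>A + A\<close> only classes modulo \<open>G\<close> are needed, so
      the \<open>Q\<close> finer classes are averaged. The margin \<open>3 * \<theta> / 4\<close>
      leaves \<open>\<theta> / 4\<close> for the carry treated below.\<close>
    have evC: "\<forall>\<^sub>F k in sequentially. \<forall>i\<in>{..<T}.
        window_density (S False) (e False) G r2 (d * T) (p * T + i) (\<rho> k) < (cc r2 + 3 * \<theta> / 4) / G"
    proof (intro eventually_ball_finite ballI finite_lessThan)
      fix i assume i: "i \<in> {..<T}"
      have "real Q * F False G r2 (d * T) (p * T + i) = (\<Sum>j<Q. F False (G * Q) (r2 + G * j) (d * T) (p * T + i))"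
        using Fref[OF rG(3) Q, of "d * T" 1 False "p * T + i"] d T by simp
      also have "\<dots> \<le> real (card {..<Q}) * (cc r2 + \<theta> / 2)"
      proof (rule sum_bounded_above)
        fix j assume "j \<in> {..<Q}"
        then have "r2 < G" "r2 \<notin> Bad False" "i < T" "j < Q" using nB rG i by (auto simp: r2_def)
        from close[OF this] show "F False (G * Q) (r2 + G * j) (d * T) (p * T + i) \<le> cc r2 + \<theta> / 2"
          unfolding cc_def by linarith
      qed
      finally have "F False G r2 (d * T) (p * T + i) \<le> cc r2 + \<theta> / 2" using Q by simp
      then have "F False G r2 (d * T) (p * T + i) < cc r2 + 3 * \<theta> / 4" using \<theta> by linarith
      then have "L False G r2 (d * T) (p * T + i) < (cc r2 + 3 * \<theta> / 4) / G"
        using G unfolding F_def by (simp add: field_simps)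
      then show "\<forall>\<^sub>F k in sequentially. window_density (S False) (e False) G r2 (d * T) (p * T + i) (\<rho> k) < (cc r2 + 3 * \<theta> / 4) / G"
        by (rule order_tendstoD(2)[OF lim])
    qed
    have ev\<rho>: "\<forall>\<^sub>F k in sequentially. d * T * G \<le> \<rho> k"
      using eventually_ge_at_top[of "d * T * G"] by eventually_elim (use seq_suble[OF \<rho>] le_trans in blast)
    have evw: "\<forall>\<^sub>F k in sequentially. max w0 (nat \<lceil>2 / \<theta>\<rceil> + 1) \<le> fact (\<rho> k) div (d * T * G)"
    proof -
      have "d * T * G > 0" using d T G by simp
      from fact_div_at_top[OF \<rho> this] show ?thesis unfolding filterlim_at_top by (rule spec)
    qed
    obtain k where kr: "\<forall>i\<in>{..<T}. \<forall>j\<in>{..<Q}. (f r - \<theta>) / (G * Q) < window_density (S True) (e True) (G * Q) (r + G * j) (d * T) (p * T + i) (\<rho> k)"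
      and kr': "\<forall>i\<in>{..<T}. \<forall>j\<in>{..<Q}. (f r' - \<theta>) / (G * Q) < window_density (S True) (e True) (G * Q) (r' + G * j) (d * T) (p * T + i) (\<rho> k)"
      and kC: "\<forall>i\<in>{..<T}. window_density (S False) (e False) G r2 (d * T) (p * T + i) (\<rho> k) < (cc r2 + 3 * \<theta> / 4) / G"
      and k\<rho>: "d * T * G \<le> \<rho> k" and kw: "max w0 (nat \<lceil>2 / \<theta>\<rceil> + 1) \<le> fact (\<rho> k) div (d * T * G)"
      using eventually_happens'[OF sequentially_bot eventually_conj[OF evA[OF r(1)] eventually_conj[OF evA[OF r(2)]
        eventually_conj[OF evC eventually_conj[OF ev\<rho> evw]]]]] by blast
    define w where "w = (fact (\<rho> k) div (d * T * G) :: nat)"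
    have w: "w0 \<le> w" "w > 0" and w\<theta>: "2 / \<theta> \<le> real w"
      using kw unfolding w_def[symmetric] by auto linarith+
    have m: "fact (\<rho> k) div (d * T) = G * w"
      unfolding w_def using d T G k\<rho> by (intro fact_div_mult) auto
    \<comment> \<open>\<open>G * u\<close> is the left end of window \<open>p\<close>, because
      \<open>k! / (d * T) = G * w\<close> at \<open>\<rho> k\<close>; after rescaling each of the
      \<open>T\<close> pieces has length \<open>w\<close>.\<close>
    define u where "u = int (p * T * w)"
    have win: "int (p * T + i) * int (G * w) = int G * (u + int w * int i)"
      "int (Suc (p * T + i)) * int (G * w) = int G * (u + int w * int (Suc i))"
      "2 * int (p * T + i) * int (G * w) = int G * (2 * u + 2 * int w * int i)"
      "2 * int (Suc (p * T + i)) * int (G * w) = int G * (2 * u + 2 * int w * int (Suc i))" for i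
      by (simp_all add: u_def algebra_simps)
    have resid: "(f c - \<theta>) * real w / real Q \<le>
        real (cnt ({x. int c + int G * x \<in> S True} \<inter> {x. int Q dvd x - \<mu>}) (u + int w * int i) (u + int w * int (Suc i)))"
      if cG: "c < G" and kc: "\<forall>i\<in>{..<T}. \<forall>j\<in>{..<Q}. (f c - \<theta>) / (G * Q) < window_density (S True) (e True) (G * Q) (c + G * j) (d * T) (p * T + i) (\<rho> k)"
        and i: "i < T" for c i \<mu>
    proof -
      define j where "j = nat (\<mu> mod int Q)"
      have j: "j < Q" using Q by (simp add: j_def nat_less_iff)
      have "(f c - \<theta>) / (G * Q) < window_density (S True) (e True) (G * Q) (c + G * j) (d * T) (p * T + i) (\<rho> k)"
        using kc i j by simp
      also have "\<dots> = real (cnt ({x. int c + int G * x \<in> S True} \<inter> {x. int Q dvd x - \<mu>}) (u + int w * int i) (u + int w * int (Suc i))) / real (G * w)"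
        by (simp only: window_density_def m cnt_rescale[OF cG Q] j_def[symmetric] e_def if_True of_nat_1 mult_1 win(1,2))
      finally have "(f c - \<theta>) / (G * Q) * real (G * w) <
          real (cnt ({x. int c + int G * x \<in> S True} \<inter> {x. int Q dvd x - \<mu>}) (u + int w * int i) (u + int w * int (Suc i)))"
        using G w(2) by (simp only: pos_less_divide_eq of_nat_0_less_iff nat_0_less_mult_iff simp_thms)
      moreover have "(f c - \<theta>) / (G * Q) * real (G * w) = (f c - \<theta>) * real w / real Q" using G by simp
      ultimately show ?thesis by linarith
    qed
    have full1: "X \<inter> {x. 1 dvd x - (0::int)} = X" for X by auto
    let ?\<kappa> = "int ((r + r') div G)"
    let ?C = "{x. int (r + r') + int G * x \<in> S False}"
    have "min 1 (f r + f r') - \<epsilon> \<le> cc r2"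
    proof (rule conn[OF w(1), where ?X0.0 = "{x. int r + int G * x \<in> S True}" and ?Y0.0 = "{x. int r' + int G * x \<in> S True}" and C = ?C and u = u])
      show "x + y \<in> ?C" if xy: "x \<in> {x. int r + int G * x \<in> S True}" "y \<in> {x. int r' + int G * x \<in> S True}" for x y
      proof -
        obtain a b where "a \<in> A" "b \<in> A" "int r + int G * x = int a" "int r' + int G * y = int b"
          using xy by (auto simp: S_def)
        then have "int (r + r') + int G * (x + y) = int (a + b)" "int (a + b) \<in> int ` (A + A)"
          by (auto simp only: distrib_left of_nat_add intro!: imageI set_plus_intro simp flip: of_nat_add)
        then show ?thesis by (simp only: S_def if_False mem_Collect_eq)
      qed
      show "\<epsilon> \<le> f r" "\<epsilon> \<le> f r'" using r by (auto simp: Good_def)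
      show "f r \<le> 1" "f r' \<le> 1" using Fb(2)[OF G d] by (auto simp: f_def)
      show "(f r - \<theta>) * real w / real Q \<le> real (cnt ({x. int r + int G * x \<in> S True} \<inter> {x. int Q dvd x - m}) (u + int w * int i) (u + int w * int (Suc i)))"
        if "i < T" for i m using resid[OF rG(1) kr that] .
      show "(f r' - \<theta>) * real w \<le> real (cnt {x. int r' + int G * x \<in> S True} (u + int w * int i) (u + int w * int (Suc i)))"
        if "i < T" for i
        using cnt_residue_refine[of 1 "int Q" Q "(f r' - \<theta>) * real w / real Q" "{x. int r' + int G * x \<in> S True}" "u + int w * int i" "u + int w * int (Suc i)" 0]
          resid[OF rG(2) kr' that] Q unfolding full1 by simp
      show "real (cnt ?C (2 * u + 2 * int w * int i) (2 * u + 2 * int w * int (Suc i))) \<le> (cc r2 + \<theta>) * (2 * real w)"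
        if i: "i < T" for i
      proof -
        let ?D = "{x. int r2 + int G * x \<in> S False}" and ?a = "2 * u + 2 * int w * int i" and ?b = "2 * u + 2 * int w * int (Suc i)"
        \<comment> \<open>When \<open>r + r'\<close> exceeds \<open>G\<close>, the rescaled class is
          that of \<open>r2\<close> shifted by \<open>1\<close>. This changes a count by at most
          \<open>1\<close>, which \<open>w \<ge> 2 / \<theta>\<close> makes at most
          \<open>\<theta> / 4\<close> of the length \<open>2 * w\<close>.\<close>
        have "int (r + r') = int r2 + int G * ?\<kappa>" unfolding r2_def by (metis mod_mult_div_eq of_nat_add of_nat_mult)
        then have "?C = {x. x - (- ?\<kappa>) \<in> ?D}" by (simp add: algebra_simps)
        then have "cnt ?C ?a ?b = cnt ?D (?a + ?\<kappa>) (?b + ?\<kappa>)" using cnt_shift[of "- ?\<kappa>" ?D ?a ?b] by simp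
        moreover have "(r + r') div G < 2" using rG by (intro less_mult_imp_div_less) linarith
        ultimately have "real (cnt ?C ?a ?b) \<le> real (cnt ?D ?a ?b) + 1"
          using cnt_shift_ge[of ?D "?a + ?\<kappa>" "?b + ?\<kappa>" ?\<kappa>] by auto
        moreover have "real (cnt ?D ?a ?b) = real (cnt (S False \<inter> {z. z mod int G = int r2}) (int G * ?a) (int G * ?b))"
          using cnt_rescale[OF rG(3), of 1 "S False" 0 ?a ?b] unfolding of_nat_1 full1 by simp
        moreover have "\<dots> / (2 * real (G * w)) = window_density (S False) (e False) G r2 (d * T) (p * T + i) (\<rho> k)"
          by (simp only: window_density_def m e_def if_False of_nat_numeral win(3,4))
        moreover have "window_density (S False) (e False) G r2 (d * T) (p * T + i) (\<rho> k) < (cc r2 + 3 * \<theta> / 4) / G" using kC i by simp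
        ultimately have "real (cnt ?C ?a ?b) \<le> real (cnt ?D ?a ?b) + 1"
          "real (cnt ?D ?a ?b) / (2 * real (G * w)) < (cc r2 + 3 * \<theta> / 4) / G" by simp_all
        moreover have "(cc r2 + 3 * \<theta> / 4) / G * (2 * real (G * w)) = (cc r2 + 3 * \<theta> / 4) * (2 * real w)"
          using G by simp
        moreover have "2 * real (G * w) > 0" using G w(2) by simp
        ultimately have "real (cnt ?C ?a ?b) \<le> (cc r2 + 3 * \<theta> / 4) * (2 * real w) + 1"
          by (smt (verit) pos_divide_less_eq)
        moreover have "1 \<le> \<theta> / 4 * (2 * real w)" using w\<theta> \<theta> by (simp add: field_simps)
        ultimately show ?thesis by (simp add: algebra_simps)
      qed
    qed
    then show ?thesis by (simp add: r2_def)
  qed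
  have tot: "(\<Sum>c<G. F b G c d p) = dens b * G" for b
    using limit_density_total[OF lim \<rho> e G d S, of b p] by (simp add: F_def sum_distrib_left[symmetric])
  have fle: "f c \<le> of_bool (c \<in> Bad True) + \<epsilon>" if "c \<in> {..<G} - Good" for c
    using that Fb[OF G d, of True c p] \<epsilon> by (auto simp: Good_def f_def)
  \<comment> \<open>A class outside \<open>Good\<close> is either bad, where
    \<open>f \<le> 1\<close>, or has \<open>f < \<epsilon>\<close>.\<close>
  have miss: "(\<Sum>c\<in>{..<G} - Good. f c) \<le> 2 * \<epsilon> * G"
  proof -
    have "(\<Sum>c\<in>{..<G} - Good. f c) \<le> (\<Sum>c\<in>{..<G} - Good. of_bool (c \<in> Bad True) + \<epsilon>)" by (rule sum_mono[OF fle])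
    also have "\<dots> \<le> (\<Sum>c<G. of_bool (c \<in> Bad True) + \<epsilon>)" using \<epsilon> by (intro sum_mono2) auto
    also have "\<dots> = card (Bad True) + G * \<epsilon>"
    proof -
      have "{..<G} \<inter> Bad True = Bad True" by (auto simp: Bad_def)
      then show ?thesis by (simp add: sum.distrib sum.If_cases of_bool_def)
    qed
    finally show ?thesis using cBad[of True] by (simp add: algebra_simps)
  qed
  have GoodG: "Good \<subseteq> {..<G}" by (auto simp: Good_def)
  obtain g :: nat and P where gP: "g > 0" "real g \<le> 2 / (2 * \<alpha> - \<beta>)" "periodic (int g) P" "P \<noteq> {}"
    "\<And>h. periodic h (P + P) \<longleftrightarrow> int g dvd h" "cnt (P + P) 0 (int g) + 1 = 2 * cnt P 0 (int g)"
    "real (cnt (P + P) 0 (int g)) \<le> (\<beta> + 2 * \<epsilon>) * g" "(\<alpha> - 3 * \<epsilon>) * g \<le> real (cnt P 0 (int g))"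
    "\<And>r. r \<in> Good \<Longrightarrow> int r \<in> P" "g dvd G"
  proof (rule weighted_kneser[OF G \<epsilon>(1) GoodG, of "Bad False" f cc \<beta> \<alpha>])
    show "Bad False \<subseteq> {..<G}" by (auto simp: Bad_def)
    show "\<epsilon> \<le> f r" "f r \<le> 1" if "r \<in> Good" for r using that Fb(2)[OF G d] by (auto simp: Good_def f_def)
    show "min 1 (f r + f r') - \<epsilon> \<le> cc ((r + r') mod G)" if "r \<in> Good" "r' \<in> Good" "(r + r') mod G \<notin> Bad False" for r r'
      using pair that by blast
    show "0 \<le> cc r" for r using Fb(1)[OF G d] by (simp add: cc_def)
    show "real (card (Bad False)) \<le> \<epsilon> * G" by (rule cBad)
    show "(\<Sum>r<G. cc r) \<le> \<beta> * G" using tot[of False] by (simp add: cc_def dens_def)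
    show "(\<alpha> - 2 * \<epsilon>) * G \<le> (\<Sum>r\<in>Good. f r)"
    proof -
      have "(\<Sum>r<G. f r) = (\<Sum>r\<in>{..<G} - Good. f r) + (\<Sum>r\<in>Good. f r)"
        by (rule sum.subset_diff[OF GoodG]) simp
      then show ?thesis using miss tot[of True] by (simp add: f_def dens_def algebra_simps)
    qed
    show "g dvd G" if "0 < g" "real g \<le> 2 / (2 * \<alpha> - \<beta>)" for g :: nat
    proof -
      have "g dvd M0" unfolding M0_def using that by (intro dvd_fact) (auto simp: le_nat_floor)
      then show ?thesis using M0G by (rule dvd_trans)
    qed
  qed (use \<beta> \<epsilon> in auto)
  have ev: "\<forall>\<^sub>F k in sequentially. (\<Sum>c\<in>{..<G} - Good. window_density (S True) (e True) G c d p (\<rho> k)) < 3 * \<epsilon>"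
  proof (rule order_tendstoD(2))
    show "(\<lambda>k. \<Sum>c\<in>{..<G} - Good. window_density (S True) (e True) G c d p (\<rho> k)) \<longlonglongrightarrow> (\<Sum>c\<in>{..<G} - Good. L True G c d p)"
      by (intro tendsto_intros lim)
    have "real G * (\<Sum>c\<in>{..<G} - Good. L True G c d p) \<le> real G * (2 * \<epsilon>)"
      using miss by (simp add: f_def F_def sum_distrib_left mult_ac)
    then have "(\<Sum>c\<in>{..<G} - Good. L True G c d p) \<le> 2 * \<epsilon>" using G by simp
    then show "(\<Sum>c\<in>{..<G} - Good. L True G c d p) < 3 * \<epsilon>" using \<epsilon> by linarith
  qed
  have "\<forall>\<^sub>F k in sequentially. real (cnt (int ` A - P) (int p * int (fact (\<rho> k) div d)) (int (Suc p) * int (fact (\<rho> k) div d)))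
      \<le> tol * real (fact (\<rho> k) div d)"
    using ev
  proof eventually_elim
    case (elim k)
    define m where "m = (fact (\<rho> k) div d :: nat)"
    let ?a = "int p * int m" and ?b = "int (Suc p) * int m"
    have "(int ` A - P) \<inter> {?a..<?b} \<subseteq> (\<Union>c\<in>{..<G} - Good. (int ` A \<inter> {z. z mod int G = int c}) \<inter> {?a..<?b})"
    proof
      fix z assume z: "z \<in> (int ` A - P) \<inter> {?a..<?b}"
      define c where "c = nat (z mod int G)"
      have c: "int c = z mod int G" "c < G" using G by (auto simp: c_def nat_less_iff)
      have "c \<notin> Good"
      proof
        assume "c \<in> Good"
        then have "z mod int G \<in> P" using gP(9) c by metis
        moreover have "int g dvd z mod int G - z"
        proof -
          have "int G dvd z mod int G - z" by (metis dvd_minus_mod minus_diff_eq dvd_minus_iff)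
          then show ?thesis using gP(10) by (meson dvd_trans int_dvd_int_iff)
        qed
        ultimately show False using z periodic_dvd_diff[OF gP(3)] by blast
      qed
      then show "z \<in> (\<Union>c\<in>{..<G} - Good. (int ` A \<inter> {z. z mod int G = int c}) \<inter> {?a..<?b})"
        using z c by (intro UN_I[of c]) auto
    qed
    then have "cnt (int ` A - P) ?a ?b \<le> card (\<Union>c\<in>{..<G} - Good. (int ` A \<inter> {z. z mod int G = int c}) \<inter> {?a..<?b})"
      unfolding cnt_def by (intro card_mono) auto
    also have "\<dots> \<le> (\<Sum>c\<in>{..<G} - Good. cnt (int ` A \<inter> {z. z mod int G = int c}) ?a ?b)"
      unfolding cnt_def by (rule card_UN_le) simp
    finally have "real (cnt (int ` A - P) ?a ?b) \<le> (\<Sum>c\<in>{..<G} - Good. real (cnt (int ` A \<inter> {z. z mod int G = int c}) ?a ?b))"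
      by (simp only: of_nat_sum[symmetric] of_nat_le_iff)
    also have "\<dots> = (\<Sum>c\<in>{..<G} - Good. window_density (S True) (e True) G c d p (\<rho> k)) * m"
    proof (cases "m = 0")
      case True then show ?thesis by (simp add: cnt_def)
    next
      case False then show ?thesis
        unfolding window_density_def m_def[symmetric] sum_distrib_right by (simp add: S_def e_def)
    qed
    also have "\<dots> \<le> tol * m" using elim \<epsilon> by (intro mult_right_mono) (auto simp: \<epsilon>_def)
    finally show ?case by (simp add: m_def)
  qed
  moreover have "(\<beta> + 2 * \<epsilon>) * g \<le> (\<beta> + tol) * g" "(\<alpha> - tol) * g \<le> (\<alpha> - 3 * \<epsilon>) * g"
    using tol by (auto intro!: mult_right_mono simp: \<epsilon>_def)
  ultimately show thesis
    using that[of g d P \<rho> p] gP(1-8) d \<rho> by (meson order_trans)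
qed

section \<open>Confinement to residue classes\<close>

lemma cnt_periodic_shift:
  assumes "periodic g S" "g > 0"
  shows "cnt S a (a + g * int k) = k * cnt S 0 g"
proof -
  have "cnt S (a + g * int i) (a + g * int (Suc i)) = cnt S 0 g" for i
    using cnt_periodic_window[OF assms, of "a + g * int i"] by (simp add: algebra_simps)
  then show ?thesis using cnt_window_sum[of g S a k] assms(2) by simp
qed

lemma cnt_periodic_bounds:
  fixes g l :: int
  assumes "periodic g S" "g > 0" "l \<ge> 0"
  shows "real (cnt S a (a + l)) \<le> (l / g + 1) * real (cnt S 0 g)"
    and "(l / g - 1) * real (cnt S 0 g) \<le> real (cnt S a (a + l))"
proof -
  define q where "q = nat (l div g)"
  have q: "int q = l div g" using assms by (simp add: q_def pos_imp_zdiv_nonneg_iff)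
  have lo: "g * int q \<le> l" and hi: "l \<le> g * int (Suc q)"
  proof -
    have "int (Suc q) = l div g + 1" using q by simp
    then show "g * int q \<le> l" "l \<le> g * int (Suc q)"
      using mult_div_mod_eq[of g l] pos_mod_bound[OF assms(2), of l] pos_mod_sign[OF assms(2), of l]
      unfolding q by (simp_all only: distrib_left mult_1_right)
  qed
  have "cnt S a (a + l) \<le> cnt S a (a + g * int (Suc q))" using hi by (intro cnt_mono_window) auto
  then have 1: "cnt S a (a + l) \<le> Suc q * cnt S 0 g" using cnt_periodic_shift[OF assms(1,2), of a "Suc q"] by simp
  have "cnt S a (a + g * int q) \<le> cnt S a (a + l)" using lo by (intro cnt_mono_window) auto
  then have 2: "q * cnt S 0 g \<le> cnt S a (a + l)" using cnt_periodic_shift[OF assms(1,2), of a q] by simp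
  have "real q = real_of_int (l div g)" using q by (metis of_int_of_nat_eq)
  then have ql: "real q \<le> l / g" and qg: "l / g - 1 \<le> real q" using real_of_int_div4[of l g] real_of_int_div3[of l g] by linarith+
  have "real (cnt S a (a + l)) \<le> real (Suc q) * real (cnt S 0 g)" using 1 by (metis of_nat_le_iff of_nat_mult)
  also have "\<dots> \<le> (l / g + 1) * real (cnt S 0 g)" using ql by (intro mult_right_mono) auto
  finally show "real (cnt S a (a + l)) \<le> (l / g + 1) * real (cnt S 0 g)" .
  have "(l / g - 1) * real (cnt S 0 g) \<le> real q * real (cnt S 0 g)" using qg by (intro mult_right_mono) auto
  also have "\<dots> \<le> real (cnt S a (a + l))" using 2 by (metis of_nat_le_iff of_nat_mult)
  finally show "(l / g - 1) * real (cnt S 0 g) \<le> real (cnt S a (a + l))" .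
qed

text \<open>The remaining classes of \<open>P\<close> number \<open>cnt P 0 g - 1\<close> and hold
  at most \<open>l / g + 1\<close> elements each; what else \<open>S\<close> has inside
  \<open>P\<close> must lie in the class of \<open>q\<close>.\<close>

lemma cnt_in_class:
  fixes g l :: int
  assumes P: "periodic g P" "g > 0" "q \<in> P" and l: "l \<ge> 0"
  shows "real (cnt S a (a + l)) - real (cnt (S - P) a (a + l)) - (l / g + 1) * (real (cnt P 0 g) - 1)
    \<le> real (cnt (S \<inter> {z. g dvd z - q}) a (a + l))"
proof -
  let ?R = "{z. g dvd z - q}"
  have pR: "periodic g ?R" by (simp add: periodic_def diff_add_eq[symmetric])
  have pd: "periodic g (P - ?R)" using P(1) pR by (auto simp: periodic_def)
  have sub: "?R \<subseteq> P" using periodic_dvd_diff[OF P(1)] P(3) by blast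
  have "cnt ?R 0 g = 1" using cnt_residue_mult[OF P(2), of q 0 1] by simp
  moreover have "cnt P 0 g = cnt ?R 0 g + cnt (P - ?R) 0 g" using cnt_Un_Diff[of ?R P 0 g] sub by (simp add: Un_absorb1)
  ultimately have c: "real (cnt (P - ?R) 0 g) = real (cnt P 0 g) - 1" by simp
  have "cnt S a (a + l) \<le> cnt (((S - P) \<union> (S \<inter> ?R)) \<union> (P - ?R)) a (a + l)" by (intro cnt_mono) auto
  also have "\<dots> \<le> cnt (S - P) a (a + l) + cnt (S \<inter> ?R) a (a + l) + cnt (P - ?R) a (a + l)"
    unfolding cnt_def Int_Un_distrib2 by (meson add_le_mono card_Un_le le_refl order_trans)
  finally have "cnt S a (a + l) \<le> cnt (S - P) a (a + l) + cnt (S \<inter> ?R) a (a + l) + cnt (P - ?R) a (a + l)" .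
  then show ?thesis using cnt_periodic_bounds(1)[OF pd P(2) l, of a] unfolding c by linarith
qed

text \<open>A window count is a difference of two initial counts, each with error
  \<open>\<sigma> * n + B\<close>, and the constant \<open>B\<close> is absorbed by large
  \<open>N\<close>. Uniformity in \<open>a\<close> and \<open>b\<close> matters since the windows
  used later depend on the element under study.\<close>

lemma cnt_uniform:
  assumes S: "(\<lambda>n. real (cnt S 0 (int n)) / real n) \<longlonglongrightarrow> \<alpha>" and \<tau>: "\<tau> > 0"
  shows "\<forall>\<^sub>F N in sequentially. \<forall>a b. a \<le> b \<longrightarrow> b \<le> K * N \<longrightarrow>
    \<bar>real (cnt S (int a) (int b)) - \<alpha> * (real b - real a)\<bar> \<le> \<tau> * real N"
proof -
  define \<sigma> where "\<sigma> = \<tau> / (real K + 1) / 2"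
  have \<sigma>: "\<sigma> > 0" using \<tau> by (simp add: \<sigma>_def)
  obtain n0 where n0: "\<And>n. n \<ge> n0 \<Longrightarrow> \<bar>real (cnt S 0 (int n)) / real n - \<alpha>\<bar> < \<sigma>"
    using S[unfolded LIMSEQ_def, rule_format, OF \<sigma>] by (auto simp: dist_real_def)
  define B where "B = (1 + \<bar>\<alpha>\<bar>) * real n0"
  have bound: "\<bar>real (cnt S 0 (int n)) - \<alpha> * real n\<bar> \<le> \<sigma> * real n + B" for n
  proof (cases "n \<ge> n0 \<and> n > 0")
    case True
    have "real (cnt S 0 (int n)) - \<alpha> * real n = (real (cnt S 0 (int n)) / real n - \<alpha>) * real n"
      using True by (simp add: left_diff_distrib)
    then have "\<bar>real (cnt S 0 (int n)) - \<alpha> * real n\<bar> = \<bar>real (cnt S 0 (int n)) / real n - \<alpha>\<bar> * real n"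
      by (simp add: abs_mult)
    also have "\<dots> \<le> \<sigma> * real n" using n0[of n] True by (intro mult_right_mono) auto
    also have "\<dots> \<le> \<sigma> * real n + B" by (simp add: B_def)
    finally show ?thesis .
  next
    case False
    then have nn: "real n \<le> real n0" by auto
    have "real (cnt S 0 (int n)) \<le> real n" using cnt_le[of S 0 "int n"] by simp
    moreover have "\<bar>\<alpha> * real n\<bar> \<le> \<bar>\<alpha>\<bar> * real n0" using nn by (simp add: abs_mult mult_left_mono)
    moreover have "0 \<le> \<sigma> * real n" using \<sigma> by simp
    ultimately show ?thesis using nn by (auto simp: B_def algebra_simps abs_le_iff)
  qed
  have "\<forall>\<^sub>F N in sequentially. 2 * B / (\<tau> / (real K + 1)) \<le> real N"
    using filterlim_real_sequentially unfolding filterlim_at_top by blast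
  then show ?thesis
  proof eventually_elim
    case (elim N)
    have BN: "2 * B \<le> \<tau> / (real K + 1) * real N" using elim \<tau> by (simp add: field_simps)
    show ?case
    proof (intro allI impI)
      fix a b :: nat assume ab: "a \<le> b" "b \<le> K * N"
      have bK: "real b \<le> real K * real N" using ab(2) by (metis of_nat_le_iff of_nat_mult)
      have "cnt S 0 (int b) = cnt S 0 (int a) + cnt S (int a) (int b)" using ab by (intro cnt_split) auto
      then have "\<bar>real (cnt S (int a) (int b)) - \<alpha> * (real b - real a)\<bar> \<le>
          \<bar>real (cnt S 0 (int b)) - \<alpha> * real b\<bar> + \<bar>real (cnt S 0 (int a)) - \<alpha> * real a\<bar>"
        by (simp add: right_diff_distrib)
      also have "\<dots> \<le> (\<sigma> * real b + B) + (\<sigma> * real a + B)" by (intro add_mono bound)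
      also have "\<sigma> * real a \<le> \<sigma> * real b" using ab \<sigma> by simp
      also have "(\<sigma> * real b + B) + (\<sigma> * real b + B) = 2 * \<sigma> * real b + 2 * B" by simp
      also have "2 * \<sigma> * real b \<le> 2 * \<sigma> * (real K * real N)" using bK \<sigma> by (intro mult_left_mono) auto
      also have "2 * \<sigma> * (real K * real N) + 2 * B \<le> \<tau> / (real K + 1) * (real K * real N) + \<tau> / (real K + 1) * real N"
      proof -
        have "2 * \<sigma> = \<tau> / (real K + 1)" by (simp only: \<sigma>_def mult_2 field_sum_of_halves)
        then show ?thesis using BN by simp
      qed
      also have "\<dots> = \<tau> / (real K + 1) * ((real K + 1) * real N)"
        by (simp only: distrib_left distrib_right mult_1_left)
      also have "\<dots> = \<tau> * real N" by (simp add: add_nonneg_eq_0_iff)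
      finally show "\<bar>real (cnt S (int a) (int b)) - \<alpha> * (real b - real a)\<bar> \<le> \<tau> * real N" by simp
    qed
  qed
qed

text \<open>The relative densities of \<open>A\<close> in any two of the classes making up \<open>P\<close> add up to more than \<open>1\<close>,
  so the sum of the two classes is filled by the pigeonhole principle.\<close>

lemma classes_filled:
  fixes A :: "int set" and v w x g :: int and E B \<alpha> :: real
  assumes P: "periodic g P" "g > 0"
    and x: "x \<in> P + P" "2 * v + h \<le> x" "x < 2 * w - h" and h: "0 \<le> h" "h \<le> w - v"
    and dens: "\<And>a b. v \<le> a \<Longrightarrow> a \<le> b \<Longrightarrow> b \<le> w \<Longrightarrow> \<alpha> * (b - a) - E \<le> real (cnt A a b)"
    and bad: "real (cnt (A - P) v w) \<le> B"
    and big: "2 * E + 2 * B + 2 * real (cnt P 0 g) < (2 * \<alpha> - (2 * real (cnt P 0 g) - 1) / g) * h"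
    and pos: "0 \<le> 2 * \<alpha> - (2 * real (cnt P 0 g) - 1) / g"
  shows "x \<in> A + A"
proof -
  obtain p1 p2 where p: "x = p1 + p2" "p1 \<in> P" "p2 \<in> P" using x(1) by (auto elim!: set_plus_elim)
  \<comment> \<open>\<open>[lo, lo + l)\<close> consists of all \<open>z\<close> for which
    \<open>z\<close> and \<open>x - z\<close> both lie in \<open>[v, w)\<close>. The margins
    \<open>h\<close> around \<open>x\<close> ensure \<open>l \<ge> h\<close>.\<close>
  define lo where "lo = max v (x - w + 1)"
  define l where "l = min w (x - v + 1) - lo"
  have l: "h \<le> l" "0 \<le> l" using x h by (auto simp: l_def lo_def)
  have rng: "v \<le> lo" "lo + l \<le> w" "v \<le> x - (lo + l) + 1" "x - lo + 1 \<le> w" by (auto simp: l_def lo_def)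
  let ?s = "real (cnt P 0 g)"
  have badsub: "real (cnt (A - P) a b) \<le> B" if "v \<le> a" "b \<le> w" for a b
  proof -
    have "cnt (A - P) a b \<le> cnt (A - P) v w" using that by (intro cnt_mono_window) auto
    then show ?thesis using bad by linarith
  qed
  have lower: "\<alpha> * l - E - B - (l / g + 1) * (?s - 1) \<le> real (cnt (A \<inter> {z. g dvd z - q}) a (a + l))"
    if "q \<in> P" "v \<le> a" "a + l \<le> w" for q a
    using cnt_in_class[OF P that(1) l(2), of A a] dens[OF that(2) _ that(3)] badsub[OF that(2,3)] l(2) by simp
  \<comment> \<open>The reflection \<open>x - z\<close> maps the class of \<open>p2\<close> to that
    of \<open>p1\<close>, so \<open>U\<close> and \<open>V\<close> compete for the at most
    \<open>l / g + 1\<close> places of one class.\<close>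
  define U where "U = A \<inter> {z. g dvd z - p1} \<inter> {lo..<lo + l}"
  define V where "V = (\<lambda>z. x - z) ` (A \<inter> {z. g dvd z - p2} \<inter> {x - (lo + l) + 1..<x - (lo + l) + 1 + l})"
  have cU: "\<alpha> * l - E - B - (l / g + 1) * (?s - 1) \<le> real (card U)"
    using lower[OF p(2) rng(1,2)] unfolding cnt_def U_def .
  have cV: "\<alpha> * l - E - B - (l / g + 1) * (?s - 1) \<le> real (card V)"
  proof -
    have "inj_on (\<lambda>z. x - z) X" for X by (auto simp: inj_on_def)
    then have "card V = cnt (A \<inter> {z. g dvd z - p2}) (x - (lo + l) + 1) (x - (lo + l) + 1 + l)"
      unfolding V_def cnt_def by (intro card_image)
    then show ?thesis using lower[OF p(3) rng(3)] rng(4) by simp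
  qed
  have UV: "U \<union> V \<subseteq> {z. g dvd z - p1} \<inter> {lo..<lo + l}"
  proof -
    have "g dvd (x - z) - p1" if "g dvd z - p2" for z
    proof -
      have "(x - z) - p1 = - (z - p2)" using p(1) by simp
      then show ?thesis using that by (simp only: dvd_minus_iff)
    qed
    then show ?thesis by (auto simp: U_def V_def)
  qed
  have "U \<inter> V \<noteq> {}"
  proof
    assume "U \<inter> V = {}"
    moreover have "finite U" "finite V" by (auto simp: U_def V_def)
    ultimately have "card U + card V = card (U \<union> V)" by (simp add: card_Un_disjoint)
    also have "\<dots> \<le> cnt {z. g dvd z - p1} lo (lo + l)" unfolding cnt_def using UV by (intro card_mono) auto
    finally have "real (card U) + real (card V) \<le> l / g + 1" using cnt_residue_le[OF P(2) l(2), of p1 lo] by linarith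
    then have *: "(\<alpha> * l - E - B - (l / g + 1) * (?s - 1)) + (\<alpha> * l - E - B - (l / g + 1) * (?s - 1)) \<le> l / g + 1"
      by (rule order_trans[OF add_mono[OF cU cV]])
    define X where "X = real_of_int l / real_of_int g"
    have "(2 * \<alpha> - (2 * ?s - 1) / g) * l = 2 * \<alpha> * l - (2 * ?s - 1) * X" by (simp add: X_def left_diff_distrib)
    also have "\<dots> \<le> 2 * E + 2 * B + 2 * ?s" using * unfolding X_def[symmetric] by (simp add: algebra_simps)
    finally have "(2 * \<alpha> - (2 * ?s - 1) / g) * l \<le> 2 * E + 2 * B + 2 * ?s" .
    moreover have "(2 * \<alpha> - (2 * ?s - 1) / g) * h \<le> (2 * \<alpha> - (2 * ?s - 1) / g) * l"
      using l(1) pos by (intro mult_left_mono) auto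
    ultimately show False using big by linarith
  qed
  then obtain z where "z \<in> U" "z \<in> V" by blast
  then have "z \<in> A" "x - z \<in> A" by (auto simp: U_def V_def)
  then have "z + (x - z) \<in> A + A" by (rule set_plus_intro)
  then show ?thesis by simp
qed

text \<open>An element outside \<open>P\<close> would create a new residue class in the sumset, whose density would then
  be about \<open>\<alpha> + s/g > \<beta>\<close> or more, for \<open>s\<close> the number of classes of \<open>P\<close>.\<close>

lemma element_in_classes:
  fixes A :: "int set" and v w a g :: int and E B \<alpha> \<beta> :: real
  assumes P: "periodic g P" "g > 0" "P \<noteq> {}"
    and stab: "\<And>h. periodic h (P + P) \<longleftrightarrow> g dvd h" and cPP: "cnt (P + P) 0 g + 1 = 2 * cnt P 0 g"
    and a: "a \<in> A"
    and y: "v \<le> y" "y + l \<le> w" "0 \<le> l"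
    and full: "\<And>x. x \<in> P + P \<Longrightarrow> a + y \<le> x \<Longrightarrow> x < a + y + l \<Longrightarrow> x \<in> A + A"
    and dens: "\<alpha> * l - E \<le> real (cnt A y (y + l))"
    and densC: "real (cnt (A + A) (a + y) (a + y + l)) \<le> \<beta> * l + E"
    and bad: "real (cnt (A - P) v w) \<le> B"
    and big: "2 * E + B + 3 * real (cnt P 0 g) < (\<alpha> + real (cnt P 0 g) / g - \<beta>) * l"
  shows "a \<in> P"
proof -
  let ?s = "real (cnt P 0 g)"
  have s: "real (cnt (P + P) 0 g) = 2 * ?s - 1" using cPP by linarith
  have pPP: "periodic g (P + P)" using stab by simp
  \<comment> \<open>Otherwise \<open>a\<close> plus the part of \<open>A\<close> in the class of
    \<open>q\<close>, of density about \<open>\<alpha> - (s - 1)/g\<close> or more, is disjoint from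
    the filled \<open>P + P\<close>, of density \<open>(2 s - 1)/g\<close>.\<close>
  have aP: "a + q \<in> P + P" if q: "q \<in> P" for q
  proof (rule ccontr)
    assume no: "a + q \<notin> P + P"
    let ?N = "{x. x - a \<in> A \<inter> {z. g dvd z - q}}"
    have disj: "?N \<inter> (P + P) = {}"
    proof (intro equals0I)
      fix x assume x: "x \<in> ?N \<inter> (P + P)"
      then have "g dvd x - (a + q)" by (simp add: diff_diff_eq)
      then show False using x no periodic_dvd_diff[OF pPP, of x "a + q"] by blast
    qed
    have NA: "?N \<subseteq> A + A"
    proof
      fix x assume "x \<in> ?N"
      then have "(x - a) + a \<in> A + A" using a by (intro set_plus_intro) auto
      then show "x \<in> A + A" by simp
    qed
    have "cnt ?N (a + y) (a + y + l) + cnt (P + P) (a + y) (a + y + l) = cnt (?N \<union> (P + P)) (a + y) (a + y + l)"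
      using cnt_Un_disjoint[OF disj] by simp
    also have "\<dots> \<le> cnt (A + A) (a + y) (a + y + l)" using NA full by (intro cnt_mono_window) auto
    finally have 1: "real (cnt ?N (a + y) (a + y + l)) + real (cnt (P + P) (a + y) (a + y + l)) \<le> \<beta> * l + E"
      using densC by linarith
    have "cnt ?N (a + y) (a + y + l) = cnt (A \<inter> {z. g dvd z - q}) y (y + l)"
      using cnt_shift[of a "A \<inter> {z. g dvd z - q}" "a + y" "a + y + l"] by simp
    moreover have "cnt (A - P) y (y + l) \<le> cnt (A - P) v w" using y by (intro cnt_mono_window) auto
    ultimately have 2: "\<alpha> * l - E - B - (l / g + 1) * (?s - 1) \<le> real (cnt ?N (a + y) (a + y + l))"
      using cnt_in_class[OF P(1,2) q y(3), of A y] dens bad by linarith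
    have 3: "(l / g - 1) * (2 * ?s - 1) \<le> real (cnt (P + P) (a + y) (a + y + l))"
      using cnt_periodic_bounds(2)[OF pPP P(2) y(3), of "a + y"] unfolding s .
    have "\<alpha> * l - E - B - (l / g + 1) * (?s - 1) + (l / g - 1) * (2 * ?s - 1) \<le> \<beta> * l + E" using 1 2 3 by linarith
    note 4 = this
    define X where "X = real_of_int l / real_of_int g"
    have "(\<alpha> + ?s / g - \<beta>) * l = \<alpha> * l + ?s * X - \<beta> * l" by (simp add: X_def left_diff_distrib distrib_right)
    also have "\<dots> \<le> 2 * E + B + 3 * ?s" using 4 unfolding X_def[symmetric] by (simp add: algebra_simps)
    finally have "(\<alpha> + ?s / g - \<beta>) * l \<le> 2 * E + B + 3 * ?s" .
    then show False using big by linarith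
  qed
  \<comment> \<open>Adding \<open>a\<close> to one summand changes neither the sum nor its
    stabiliser. As \<open>|P + P| = 2 |P| - 1\<close> is extremal in Kneser's bound,
    \<open>a\<close> cannot bring a new class.\<close>
  have eq: "P + insert a P = P + P"
  proof
    show "P + insert a P \<subseteq> P + P"
    proof
      fix x assume "x \<in> P + insert a P"
      then obtain q b where "x = q + b" "q \<in> P" "b \<in> insert a P" by (auto elim!: set_plus_elim)
      then show "x \<in> P + P" using aP[of q] by (auto simp: add.commute)
    qed
    show "P + P \<subseteq> P + insert a P" by (rule set_plus_mono2) auto
  qed
  have cimg: "card ((\<lambda>x. x mod g) ` S) = cnt S 0 g" if "periodic g S" for S
  proof -
    have "{x. \<exists>b\<in>S. g dvd x - b} = S" using periodic_dvd_diff[OF that] by force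
    then show ?thesis using card_mod_image(2)[OF P(2), of S] by simp
  qed
  have "card ((\<lambda>x. x mod g) ` P) + card ((\<lambda>x. x mod g) ` insert a P) \<le> card ((\<lambda>x. x mod g) ` (P + P)) + 1"
    using kneser_mod[OF P(2,3), of "insert a P"] stab unfolding eq by simp
  then have le: "card ((\<lambda>x. x mod g) ` insert a P) \<le> card ((\<lambda>x. x mod g) ` P)"
    using cimg[OF P(1)] cimg[OF pPP] cPP by simp
  have "finite ((\<lambda>x. x mod g) ` insert a P)" by (rule finite_subset[of _ "{0..<g}"]) (use P(2) in auto)
  then have "(\<lambda>x. x mod g) ` P = (\<lambda>x. x mod g) ` insert a P" using le by (intro card_seteq) auto
  then obtain q where "q \<in> P" "a mod g = q mod g" by auto
  then show "a \<in> P" using periodic_mod[OF P(1)] by metis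
qed

section \<open>Realising density pairs\<close>

text \<open>\<open>R\<close> marks the jumps of a Beatty-type sequence. Since
  \<open>\<rho> \<le> 1\<close> each jump is by \<open>1\<close>, so the count telescopes.\<close>

lemma floor_density:
  assumes "0 \<le> \<rho>" "\<rho> \<le> 1"
  defines "R \<equiv> {j::nat. \<lfloor>real (Suc j) * \<rho>\<rfloor> \<noteq> \<lfloor>real j * \<rho>\<rfloor>}"
  shows "int (card (R \<inter> {..<n})) = \<lfloor>real n * \<rho>\<rfloor>"
proof (induction n)
  case (Suc n)
  have le: "real n * \<rho> \<le> real (Suc n) * \<rho>" "real (Suc n) * \<rho> \<le> real n * \<rho> + 1"
    using assms(1,2) by (simp_all add: algebra_simps)
  have "\<lfloor>real n * \<rho>\<rfloor> \<le> \<lfloor>real (Suc n) * \<rho>\<rfloor>" "\<lfloor>real (Suc n) * \<rho>\<rfloor> \<le> \<lfloor>real n * \<rho>\<rfloor> + 1"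
    using floor_mono[OF le(1)] floor_mono[OF le(2)] by auto
  then have fl: "\<lfloor>real (Suc n) * \<rho>\<rfloor> = \<lfloor>real n * \<rho>\<rfloor> + (if n \<in> R then 1 else 0)"
    by (auto simp: R_def)
  have "R \<inter> {..<Suc n} = (if n \<in> R then insert n (R \<inter> {..<n}) else R \<inter> {..<n})"
    by (auto simp: less_Suc_eq)
  then show ?case using Suc fl by (auto simp del: of_nat_Suc)
qed simp

lemma has_densityI_bounded:
  assumes "\<And>n. \<bar>real (card (A \<inter> {..<n})) - d * real n\<bar> \<le> B"
  shows "has_density A d"
  unfolding has_density_def
proof (rule LIM_zero_cancel, rule Lim_null_comparison)
  show "\<forall>\<^sub>F n in sequentially. norm (real (card (A \<inter> {1..n})) / real n - d) \<le> (B + \<bar>d\<bar> + 1) / real n"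
    using eventually_gt_at_top[of 0]
  proof eventually_elim
    case (elim n)
    have eq: "A \<inter> {..<Suc n} = (A \<inter> {1..n}) \<union> (A \<inter> {0})" by (auto simp: less_Suc_eq_le)
    have "card (A \<inter> {..<Suc n}) = card (A \<inter> {1..n}) + card (A \<inter> {0})"
      unfolding eq by (rule card_Un_disjoint) auto
    moreover have "card (A \<inter> {0}) \<le> 1" by (metis card.empty card_insert_le card_mono finite.emptyI finite_insert inf_le2 card_1_singleton_iff One_nat_def)
    ultimately have "\<bar>real (card (A \<inter> {1..n})) - d * real n\<bar> \<le> B + \<bar>d\<bar> + 1"
      using assms[of "Suc n"] by (auto simp: algebra_simps abs_le_iff)
    moreover have "real (card (A \<inter> {1..n})) / real n - d = (real (card (A \<inter> {1..n})) - d * real n) / real n"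
      using elim by (simp add: diff_divide_distrib)
    ultimately show ?case by (simp add: divide_right_mono)
  qed
  show "(\<lambda>n. (B + \<bar>d\<bar> + 1) / real n) \<longlonglongrightarrow> 0" by (rule lim_const_over_n)
qed

text \<open>Residues \<open>0, \<dots>, s - 2\<close> are taken completely and residue \<open>s - 1\<close> with relative density \<open>\<rho> > 1/2\<close>,
  so that the class \<open>2 s - 2\<close> of the sumset is cofinitely filled by the pigeonhole principle.\<close>

lemma density_pair_exists:
  fixes q s :: nat and \<alpha> :: real
  assumes s: "s \<ge> 1" "2 * s - 1 < q" and \<alpha>: "real (2 * s - 1) / (2 * real q) < \<alpha>" "\<alpha> \<le> real s / real q"
  shows "\<exists>A. has_density A \<alpha> \<and> has_density (A + A) (real (2 * s - 1) / real q)"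
proof -
  have q: "q > 0" using s by simp
  \<comment> \<open>The relative density that the class \<open>s - 1\<close> needs besides the
    \<open>s - 1\<close> full classes to reach \<open>\<alpha>\<close>; the bounds on
    \<open>\<alpha>\<close> say exactly \<open>1 / 2 < \<rho> \<le> 1\<close>.\<close>
  define \<rho> where "\<rho> = \<alpha> * q - (real s - 1)"
  have \<rho>: "1 / 2 < \<rho>" "\<rho> \<le> 1" using \<alpha> q s by (auto simp: \<rho>_def field_simps of_nat_diff)
  define R where "R = {j::nat. \<lfloor>real (Suc j) * \<rho>\<rfloor> \<noteq> \<lfloor>real j * \<rho>\<rfloor>}"
  have cR: "int (card (R \<inter> {..<n})) = \<lfloor>real n * \<rho>\<rfloor>" for n
    unfolding R_def by (rule floor_density) (use \<rho> in auto)
  define A where "A = {n. n mod q < s - 1 \<or> n mod q = s - 1 \<and> n div q \<in> R}"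
  have digits: "card ({n. Pr (n mod q) (n div q)} \<inter> {..<q * m}) = (\<Sum>r<q. card {j \<in> {..<m}. Pr r j})" for Pr m
  proof -
    have "bij_betw (\<lambda>(r, j). r + q * j) (SIGMA r:{..<q}. {j \<in> {..<m}. Pr r j}) ({n. Pr (n mod q) (n div q)} \<inter> {..<q * m})"
    proof (rule bij_betw_byWitness[where f' = "\<lambda>n. (n mod q, n div q)"])
      show "(\<lambda>(r, j). r + q * j) ` (SIGMA r:{..<q}. {j \<in> {..<m}. Pr r j}) \<subseteq> {n. Pr (n mod q) (n div q)} \<inter> {..<q * m}"
      proof clarify
        fix r j assume rj: "r < q" "j < m" "Pr r j"
        have "r + q * j < q * (j + 1)" using rj by simp
        also have "\<dots> \<le> q * m" using rj by (intro mult_left_mono) auto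
        finally show "r + q * j \<in> {n. Pr (n mod q) (n div q)} \<inter> {..<q * m}" using rj by simp
      qed
      show "(\<lambda>n. (n mod q, n div q)) ` ({n. Pr (n mod q) (n div q)} \<inter> {..<q * m}) \<subseteq> (SIGMA r:{..<q}. {j \<in> {..<m}. Pr r j})"
        using q by (auto simp: less_mult_imp_div_less mult.commute)
    qed auto
    then have "card (SIGMA r:{..<q}. {j \<in> {..<m}. Pr r j}) = card ({n. Pr (n mod q) (n div q)} \<inter> {..<q * m})"
      by (rule bij_betw_same_card)
    then show ?thesis by simp
  qed
  have period_bound: "\<bar>real (card (X \<inter> {..<n})) - d * real n\<bar> \<le> B + q * (1 + \<bar>d\<bar>)"
    if "\<And>m. \<bar>real (card (X \<inter> {..<q * m})) - d * real (q * m)\<bar> \<le> B" for X :: "nat set" and d B :: real and n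
  proof -
    define m where "m = n div q"
    have n: "n = q * m + n mod q" "n mod q < q" using q by (auto simp: m_def)
    have eq: "X \<inter> {..<n} = (X \<inter> {..<q * m}) \<union> (X \<inter> {q * m..<n})" using n(1) by auto
    have "card (X \<inter> {..<n}) = card (X \<inter> {..<q * m}) + card (X \<inter> {q * m..<n})"
      by (subst eq) (rule card_Un_disjoint, auto)
    moreover have "card (X \<inter> {q * m..<n}) \<le> card {q * m..<n}" by (intro card_mono) auto
    then have "card (X \<inter> {q * m..<n}) \<le> q" using n by simp
    moreover have "\<bar>d * real n - d * real (q * m)\<bar> \<le> \<bar>d\<bar> * q"
    proof -
      have "d * real n - d * real (q * m) = d * real (n mod q)" using n(1) by (metis add_diff_cancel_left' of_nat_add right_diff_distrib)
      then show ?thesis using n(2) by (simp add: abs_mult mult_left_mono)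
    qed
    ultimately show ?thesis using that[of m] by (auto simp: algebra_simps abs_le_iff)
  qed
  have "\<bar>real (card (A \<inter> {..<q * m})) - \<alpha> * real (q * m)\<bar> \<le> 1" for m
  proof -
    have "card (A \<inter> {..<q * m}) = (\<Sum>r<q. card {j \<in> {..<m}. r < s - 1 \<or> r = s - 1 \<and> j \<in> R})"
      unfolding A_def by (rule digits)
    also have "\<dots> = (\<Sum>r<q. if r < s - 1 then m else if r = s - 1 then card (R \<inter> {..<m}) else 0)"
      by (intro sum.cong refl) (auto simp: Int_def conj_commute)
    also have "\<dots> = (\<Sum>r\<in>{..<s}. if r < s - 1 then m else card (R \<inter> {..<m}))"
      using s by (intro sum.mono_neutral_cong_right) auto
    also have "{..<s} = insert (s - 1) {..<s - 1}" using s by auto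
    also have "(\<Sum>r\<in>insert (s - 1) {..<s - 1}. if r < s - 1 then m else card (R \<inter> {..<m})) = card (R \<inter> {..<m}) + (s - 1) * m"
      by simp
    finally have "real (card (A \<inter> {..<q * m})) = real_of_int \<lfloor>real m * \<rho>\<rfloor> + (real s - 1) * m"
      using cR[of m] s by (simp add: of_nat_diff)
    moreover have "\<alpha> * real (q * m) = real m * \<rho> + (real s - 1) * m" by (simp add: \<rho>_def algebra_simps)
    ultimately show ?thesis by linarith
  qed
  then have "has_density A \<alpha>" by (intro has_densityI_bounded[OF period_bound])
  moreover have "has_density (A + A) (real (2 * s - 1) / real q)"
  proof -
    define D where "D = {n. n mod q < 2 * s - 1}"
    have AD: "A + A \<subseteq> D"
    proof
      fix n assume "n \<in> A + A"
      then obtain a b where ab: "n = a + b" "a \<in> A" "b \<in> A" by (auto elim!: set_plus_elim)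
      then have "a mod q + b mod q < 2 * s - 1" using s by (auto simp: A_def)
      moreover have "n mod q = (a mod q + b mod q) mod q" using ab by (simp add: mod_add_eq)
      ultimately show "n \<in> D" using s by (simp add: D_def)
    qed
    \<comment> \<open>From \<open>m (2 \<rho> - 1) \<ge> 3\<close> on, \<open>R\<close> contains
      more than half of the numbers up to \<open>m\<close>, rounding included.\<close>
    define m0 where "m0 = nat \<lceil>3 / (2 * \<rho> - 1)\<rceil>"
    have big: "real (m + 1) < 2 * real_of_int \<lfloor>real (m + 1) * \<rho>\<rfloor>" if "m \<ge> m0" for m
    proof -
      have "3 / (2 * \<rho> - 1) \<le> real m" using that unfolding m0_def by linarith
      then have "3 \<le> real m * (2 * \<rho> - 1)" using \<rho> by (simp add: field_simps)
      then have "2 * (real (m + 1) * \<rho>) - 2 > real (m + 1) - 0 \<or> 2 * (real (m + 1) * \<rho>) \<ge> real (m + 1) + 3"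
        using \<rho> by (simp add: algebra_simps)
      then show ?thesis using \<rho> by linarith
    qed
    have pig: "\<exists>i\<in>R. \<exists>j\<in>R. i + j = m" if "m \<ge> m0" for m
    proof (rule ccontr)
      assume neg: "\<not> ?thesis"
      let ?U = "R \<inter> {..<m + 1}" and ?V = "(\<lambda>j. m - j) ` (R \<inter> {..<m + 1})"
      have disj: "?U \<inter> ?V = {}"
      proof (intro equals0I)
        fix i assume "i \<in> ?U \<inter> ?V"
        then obtain j where "i \<in> R" "j \<in> R" "j \<le> m" "i = m - j" by auto
        then show False using neg by force
      qed
      have "inj_on (\<lambda>j. m - j) (R \<inter> {..<m + 1})" by (auto simp: inj_on_def)
      then have "card ?V = card ?U" by (rule card_image)
      moreover have "card (?U \<union> ?V) = card ?U + card ?V" by (intro card_Un_disjoint disj) auto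
      moreover have "card (?U \<union> ?V) \<le> card {..<m + 1}" by (intro card_mono) auto
      ultimately have "2 * card ?U \<le> m + 1" by simp
      then show False using big[OF that] cR[of "m + 1"] by linarith
    qed
    obtain j0 where j0: "j0 \<in> R" using pig[of m0] by blast
    have DA: "n \<in> A + A" if n: "n \<in> D" "n \<ge> q * (m0 + j0 + 1)" for n
    proof -
      define r where "r = n mod q"
      define m where "m = n div q"
      have nr: "n = r + q * m" "r < 2 * s - 1" "r < q" using n q by (auto simp: r_def m_def D_def)
      have m: "m \<ge> m0 + j0 + 1" using n(2) q unfolding m_def by (simp add: less_eq_div_iff_mult_less_eq mult.commute)
      have inA: "i + q * j \<in> A" if "i < s - 1 \<or> i = s - 1 \<and> j \<in> R" for i j
      proof -
        have "i < q" using that s by auto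
        then show ?thesis using that by (simp add: A_def)
      qed
      \<comment> \<open>Low classes come from adding \<open>0\<close>, middle ones from a fixed
        element of the partial class plus a full class. The top class \<open>2 s - 2\<close> arises
        only from two elements of the partial class and needs \<open>pig\<close>.\<close>
      consider "r < s - 1" | "s - 1 \<le> r" "r < 2 * s - 2" | "r = 2 * s - 2" using nr(2) by linarith
      then show ?thesis
      proof cases
        case 1
        show ?thesis
        proof (cases "s = 1")
          case False
          have "0 + q * 0 \<in> A" by (rule inA, rule disjI1) (use 1 in linarith)
          moreover have "r + q * m \<in> A" by (rule inA) (use 1 in simp)
          ultimately
          have "(0 + q * 0) + (r + q * m) \<in> A + A" by (rule set_plus_intro)
          then show ?thesis using nr(1) by simp
        qed (use 1 in simp)
      next
        case 2
        have "r - (s - 1) < s - 1" using 2 by linarith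
        then have "(r - (s - 1)) + q * (m - j0) \<in> A" by (intro inA disjI1)
        moreover have "(s - 1) + q * j0 \<in> A" by (rule inA) (use j0 in simp)
        ultimately have "((s - 1) + q * j0) + ((r - (s - 1)) + q * (m - j0)) \<in> A + A" by (intro set_plus_intro)
        moreover have "((s - 1) + q * j0) + ((r - (s - 1)) + q * (m - j0)) = n"
        proof -
          have "q * j0 + q * (m - j0) = q * m" using m by (simp add: distrib_left[symmetric])
          then show ?thesis using 2 nr(1) by linarith
        qed
        ultimately show ?thesis by simp
      next
        case 3
        obtain i j where ij: "i \<in> R" "j \<in> R" "i + j = m" using pig[of m] m by auto
        have "(s - 1) + q * i \<in> A" "(s - 1) + q * j \<in> A" using ij by (auto intro!: inA)
        then have "((s - 1) + q * i) + ((s - 1) + q * j) \<in> A + A" by (rule set_plus_intro)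
        moreover have "((s - 1) + q * i) + ((s - 1) + q * j) = n"
          using 3 s nr(1) ij(3) by (auto simp: algebra_simps)
        ultimately show ?thesis by simp
      qed
    qed
    let ?n0 = "q * (m0 + j0 + 1)"
    have cD: "card (D \<inter> {..<q * m}) = (2 * s - 1) * m" for m
    proof -
      have "card (D \<inter> {..<q * m}) = (\<Sum>r<q. card {j \<in> {..<m}. r < 2 * s - 1})" unfolding D_def by (rule digits)
      also have "\<dots> = (\<Sum>r<q. if r < 2 * s - 1 then m else 0)" by (intro sum.cong refl) auto
      also have "\<dots> = (\<Sum>r\<in>{..<2 * s - 1}. m)" using s by (intro sum.mono_neutral_cong_right) auto
      finally show ?thesis by simp
    qed
    have "\<bar>real (card ((A + A) \<inter> {..<q * m})) - real (2 * s - 1) / real q * real (q * m)\<bar> \<le> real ?n0" for m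
    proof -
      have "card ((A + A) \<inter> {..<q * m}) \<le> card (D \<inter> {..<q * m})" using AD by (intro card_mono) auto
      moreover have "card (D \<inter> {..<q * m}) \<le> card (((A + A) \<inter> {..<q * m}) \<union> {..<?n0})"
        using DA by (intro card_mono) (auto simp: not_le)
      moreover have "card (((A + A) \<inter> {..<q * m}) \<union> {..<?n0}) \<le> card ((A + A) \<inter> {..<q * m}) + ?n0"
        using card_Un_le[of "(A + A) \<inter> {..<q * m}" "{..<?n0}"] by simp
      ultimately have "\<bar>real (card ((A + A) \<inter> {..<q * m})) - real ((2 * s - 1) * m)\<bar> \<le> real ?n0"
        unfolding cD by linarith
      moreover have "real (2 * s - 1) / real q * real (q * m) = real ((2 * s - 1) * m)" using q by simp
      ultimately show ?thesis by simp
    qed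
    then show ?thesis by (intro has_densityI_bounded[OF period_bound])
  qed
  ultimately show ?thesis by blast
qed

section \<open>Structure of sumsets of small density\<close>

text \<open>The bound on \<open>g\<close> does not involve \<open>tol\<close>, so for small
  \<open>tol\<close> the approximations to \<open>\<beta> * g\<close> become the equality
  \<open>\<beta> * g = 2 s - 1\<close>.\<close>

lemma structured_sumset:
  fixes A :: "nat set" and \<alpha> \<beta> tol :: real
  assumes dA: "has_density A \<alpha>" and dC: "has_density (A + A) \<beta>"
    and tol: "0 < tol" "tol \<le> 1" "64 * tol \<le> 2 * \<alpha> - \<beta>"
  shows "\<exists>g s :: nat. 0 < g \<and> real g \<le> 2 / (2 * \<alpha> - \<beta>) \<and> 2 * real s - 1 \<le> (\<beta> + tol) * g \<and>
    (\<alpha> - tol) * g \<le> real s \<and> \<beta> * g \<le> 2 * real s - 1 + 2 * tol * g"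
proof -
  obtain g d p :: nat and P \<rho> where gd: "g > 0" "real g \<le> 2 / (2 * \<alpha> - \<beta>)" "d > 0" and P: "periodic (int g) P" "P \<noteq> {}"
    and stab: "\<And>h. periodic h (P + P) \<longleftrightarrow> int g dvd h" and cPP: "cnt (P + P) 0 (int g) + 1 = 2 * cnt P 0 (int g)"
    and up: "real (cnt (P + P) 0 (int g)) \<le> (\<beta> + tol) * g" and lo: "(\<alpha> - tol) * g \<le> real (cnt P 0 (int g))"
    and \<rho>: "strict_mono (\<rho> :: nat \<Rightarrow> nat)"
    and bad: "\<forall>\<^sub>F k in sequentially. real (cnt (int ` A - P) (int p * int (fact (\<rho> k) div d)) (int (Suc p) * int (fact (\<rho> k) div d)))
      \<le> tol * real (fact (\<rho> k) div d)"
    by (rule structured_window[OF dA dC tol(1,2)]) (use tol in auto)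
  define s where "s = cnt P 0 (int g)"
  have s: "real (cnt (P + P) 0 (int g)) = 2 * real s - 1" using cPP unfolding s_def by linarith
  have sg: "real s \<le> real g" using cnt_le[of P 0 "int g"] by (simp add: s_def)
  have gpos: "real g > 0" using gd by simp
  define K where "K = 2 * (p + 1)"
  have top: "filterlim (\<lambda>k. fact (\<rho> k) div d :: nat) at_top sequentially" by (rule fact_div_at_top[OF \<rho> gd(3)])
  note uA = eventually_compose_filterlim[OF cnt_uniform[OF has_density_cnt[OF dA] tol(1), of K] top]
  note uC = eventually_compose_filterlim[OF cnt_uniform[OF has_density_cnt[OF dC] tol(1), of K] top]
  have big: "\<forall>\<^sub>F k in sequentially. nat \<lceil>100 + 3 * g / tol\<rceil> \<le> fact (\<rho> k) div d"
    using top unfolding filterlim_at_top by (rule spec)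
  obtain k where kbad: "real (cnt (int ` A - P) (int p * int (fact (\<rho> k) div d)) (int (Suc p) * int (fact (\<rho> k) div d)))
      \<le> tol * real (fact (\<rho> k) div d)"
    and kA: "\<forall>a b. a \<le> b \<longrightarrow> b \<le> K * (fact (\<rho> k) div d) \<longrightarrow>
      \<bar>real (cnt (int ` A) (int a) (int b)) - \<alpha> * (real b - real a)\<bar> \<le> tol * real (fact (\<rho> k) div d)"
    and kC: "\<forall>a b. a \<le> b \<longrightarrow> b \<le> K * (fact (\<rho> k) div d) \<longrightarrow>
      \<bar>real (cnt (int ` (A + A)) (int a) (int b)) - \<beta> * (real b - real a)\<bar> \<le> tol * real (fact (\<rho> k) div d)"
    and kbig: "nat \<lceil>100 + 3 * g / tol\<rceil> \<le> fact (\<rho> k) div d"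
    using eventually_happens'[OF sequentially_bot eventually_conj[OF bad eventually_conj[OF uA eventually_conj[OF uC big]]]] by blast
  define m where "m = (fact (\<rho> k) div d :: nat)"
  define w where "w = int ((p + 1) * m)"
  let ?A = "int ` A"
  have AA: "int ` (A + A) = ?A + ?A"
  proof
    show "int ` (A + A) \<subseteq> ?A + ?A" by (auto elim!: set_plus_elim intro!: set_plus_intro)
    show "?A + ?A \<subseteq> int ` (A + A)"
    proof
      fix x assume "x \<in> ?A + ?A"
      then obtain a b where "x = int (a + b)" "a \<in> A" "b \<in> A" by (auto elim!: set_plus_elim)
      then show "x \<in> int ` (A + A)" by (metis imageI set_plus_intro)
    qed
  qed
  have m1: "100 + 3 * g / tol \<le> real m" using kbig unfolding m_def[symmetric] by linarith
  have "tol * (100 + 3 * g / tol) \<le> tol * m" using m1 tol by (intro mult_left_mono) auto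
  then have tm: "100 * tol + 3 * g \<le> tol * m" using tol by (simp add: distrib_left)
  have "0 \<le> 3 * g / tol" using tol by simp
  then have m100: "m \<ge> 100" using m1 by linarith
  have Km: "int (K * m) = 2 * w" by (simp add: K_def w_def algebra_simps)
  have dnsA: "\<bar>real (cnt ?A a b) - \<alpha> * (b - a)\<bar> \<le> tol * m" if "0 \<le> a" "a \<le> b" "b \<le> 2 * w" for a b :: int
  proof -
    have "nat b \<le> K * m" using that Km by linarith
    moreover have "nat a \<le> nat b" using that by simp
    ultimately show ?thesis using kA[rule_format, of "nat a" "nat b"] that unfolding m_def[symmetric] by simp
  qed
  have dnsC: "\<bar>real (cnt (?A + ?A) a b) - \<beta> * (b - a)\<bar> \<le> tol * m" if "0 \<le> a" "a \<le> b" "b \<le> 2 * w" for a b :: int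
  proof -
    have "nat b \<le> K * m" using that Km by linarith
    moreover have "nat a \<le> nat b" using that by simp
    ultimately show ?thesis using kC[rule_format, of "nat a" "nat b"] that unfolding m_def[symmetric] AA by simp
  qed
  have w0: "w \<ge> 0" "int m \<le> w" by (simp_all add: w_def)
  have coef1: "63 * tol \<le> 2 * \<alpha> - (2 * real s - 1) / g"
  proof -
    have "(2 * real s - 1) / g \<le> \<beta> + tol" using up gpos unfolding s by (simp add: divide_le_eq)
    then show ?thesis using tol by linarith
  qed
  have coef2: "63 * tol \<le> \<alpha> + real s / g - \<beta>"
  proof -
    have "\<alpha> - tol \<le> real s / g" using lo gpos unfolding s_def[symmetric] by (simp add: le_divide_eq)
    then show ?thesis using tol by linarith
  qed
  \<comment> \<open>Confinement on \<open>[v, w)\<close> up to few exceptions becomes exact and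
    reaches one integer further, to \<open>v - 1\<close>; this drives the descent below. The
    constants \<open>1/4\<close>, \<open>1/8\<close>, \<open>63\<close> and \<open>100\<close>
    merely keep errors of size \<open>tol * m\<close> and \<open>g\<close> below the main
    terms.\<close>
  have step: "a \<in> P" if v: "0 \<le> v" "int m \<le> w - v" "real (cnt (?A - P) v w) \<le> tol * m"
    and a: "a \<in> ?A" "v - 1 \<le> a" "a < w" for a v
  proof -
    define h where "h = int m div 4"
    define l where "l = int m div 8"
    \<comment> \<open>The least \<open>y \<ge> v\<close> with \<open>a + y \<ge> 2 * v + h\<close>:
      then \<open>[a + y, a + y + l)\<close> lies where \<open>classes_filled\<close>
      applies.\<close>
    define y where "y = max v (2 * v + h - a)"
    have hl: "0 \<le> h" "0 \<le> l" "4 * h \<le> int m" "8 * l \<le> int m" "int m \<le> 4 * h + 3" "int m \<le> 8 * l + 7"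
      by (auto simp: h_def l_def)
    have a0: "0 \<le> a" using a(1) by auto
    have h4: "real m / 4 - 1 \<le> h" and l8: "real m / 8 - 1 \<le> l" using hl by linarith+
    have ylo: "v \<le> y" "2 * v + h \<le> a + y" by (auto simp: y_def)
    have yhi: "y + l \<le> w" "a + y + l \<le> 2 * w - h" "0 \<le> y" using a v hl m100 by (auto simp: y_def)
    show ?thesis
    proof (rule element_in_classes[where A = ?A and v = v and w = w and y = y and l = l and E = "tol * m" and B = "tol * m" and \<alpha> = \<alpha> and \<beta> = \<beta>, OF P(1) _ P(2) stab cPP a(1) ylo(1) yhi(1) hl(2)])
      show "int g > 0" using gd by simp
      show "x \<in> ?A + ?A" if x: "x \<in> P + P" "a + y \<le> x" "x < a + y + l" for x
      proof (rule classes_filled[where g = "int g" and P = P and v = v and w = w and h = h and E = "tol * m" and B = "tol * m" and \<alpha> = \<alpha>, OF P(1) _ x(1)])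
        show "\<alpha> * real_of_int (b - a) - tol * m \<le> real (cnt ?A a b)" if "v \<le> a" "a \<le> b" "b \<le> w" for a b
          using dnsA[of a b] that v(1) w0 by (simp add: abs_le_iff)
        show "2 * (tol * m) + 2 * (tol * m) + 2 * real (cnt P 0 (int g)) <
            (2 * \<alpha> - (2 * real (cnt P 0 (int g)) - 1) / real_of_int (int g)) * real_of_int h"
        proof -
          have "63 * tol * (real m / 4 - 1) \<le> (2 * \<alpha> - (2 * real s - 1) / g) * h"
            using coef1 h4 tol m100 by (intro mult_mono) auto
          moreover have "63 * tol * (real m / 4 - 1) = 63 / 4 * (tol * m) - 63 * tol" by (simp add: algebra_simps)
          ultimately show ?thesis using tm sg tol(1) unfolding s_def[symmetric] by simp
        qed
        show "0 \<le> 2 * \<alpha> - (2 * real (cnt P 0 (int g)) - 1) / real_of_int (int g)"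
          using coef1 tol unfolding s_def[symmetric] by simp
      qed (use x ylo yhi hl v gd in auto)
      show "\<alpha> * real_of_int l - tol * m \<le> real (cnt ?A y (y + l))"
        using dnsA[of y "y + l"] yhi hl(2) w0 by (simp add: abs_le_iff)
      show "real (cnt (?A + ?A) (a + y) (a + y + l)) \<le> \<beta> * real_of_int l + tol * m"
        using dnsC[of "a + y" "a + y + l"] yhi hl a0 by (simp add: abs_le_iff)
      show "real (cnt (?A - P) v w) \<le> tol * m" by (rule v(3))
      show "2 * (tol * m) + tol * m + 3 * real (cnt P 0 (int g)) <
          (\<alpha> + real (cnt P 0 (int g)) / real_of_int (int g) - \<beta>) * real_of_int l"
      proof -
        have "63 * tol * (real m / 8 - 1) \<le> (\<alpha> + real s / g - \<beta>) * l"
          using coef2 l8 tol m100 by (intro mult_mono) auto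
        moreover have "63 * tol * (real m / 8 - 1) = 63 / 8 * (tol * m) - 63 * tol" by (simp add: algebra_simps)
        ultimately show ?thesis using tm sg tol(1) unfolding s_def[symmetric] by simp
      qed
    qed
  qed
  define conf where "conf v \<longleftrightarrow> (\<forall>a\<in>?A. int v \<le> a \<longrightarrow> a < w \<longrightarrow> a \<in> P)" for v :: nat
  have conf0: "conf (p * m)"
    unfolding conf_def
  proof (intro ballI impI)
    fix a assume a: "a \<in> ?A" "int (p * m) \<le> a" "a < w"
    show "a \<in> P"
    proof (rule step[of "int (p * m)"])
      show "real (cnt (?A - P) (int (p * m)) w) \<le> tol * m"
        using kbad unfolding m_def[symmetric] by (simp add: w_def algebra_simps)
    qed (use a in \<open>auto simp: w_def algebra_simps\<close>)
  qed
  \<comment> \<open>Since \<open>step\<close> always gains \<open>v - 1\<close> while the right end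
    \<open>w\<close> stays, the least confined left end must be \<open>0\<close>.\<close>
  define v where "v = (LEAST v. conf v)"
  have v: "conf v" "v \<le> p * m" unfolding v_def using conf0 by (auto intro: LeastI Least_le)
  have "v = 0"
  proof (rule ccontr)
    assume v0: "v \<noteq> 0"
    have "conf (v - 1)"
      unfolding conf_def
    proof (intro ballI impI)
      fix a assume a: "a \<in> ?A" "int (v - 1) \<le> a" "a < w"
      show "a \<in> P"
      proof (rule step[of "int v"])
        have "(?A - P) \<inter> {int v..<w} = {}" using v(1) unfolding conf_def by auto
        then show "real (cnt (?A - P) (int v) w) \<le> tol * m" using tol by (simp add: cnt_def)
        have "int v \<le> int (p * m)" using v(2) by (simp only: of_nat_le_iff)
        then show "int m \<le> w - int v" by (simp add: w_def algebra_simps)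
      qed (use a v0 in auto)
    qed
    then have "v \<le> v - 1" unfolding v_def by (rule Least_le)
    then show False using v0 by simp
  qed
  then have inP: "a \<in> P" if "a \<in> ?A" "a < w" for a using v(1) that unfolding conf_def by auto
  have pPP: "periodic (int g) (P + P)" using stab by simp
  \<comment> \<open>Elements of \<open>A\<close> are nonnegative, so both summands of a sum below
    \<open>w\<close> are below \<open>w\<close> and hence in \<open>P\<close>.\<close>
  have "cnt (?A + ?A) 0 w \<le> cnt (P + P) 0 w"
  proof (rule cnt_mono_window, rule subsetI)
    fix x assume x: "x \<in> (?A + ?A) \<inter> {0..<w}"
    then obtain a b where ab: "x = a + b" "a \<in> ?A" "b \<in> ?A" by (auto elim!: set_plus_elim)
    moreover have "a < w" "b < w" using ab x by auto
    ultimately have "x \<in> P + P" using inP by (auto intro!: set_plus_intro)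
    then show "x \<in> (P + P) \<inter> {0..<w}" using x by simp
  qed
  moreover have "real (cnt (P + P) 0 w) \<le> (w / g + 1) * (2 * real s - 1)"
    using cnt_periodic_bounds(1)[OF pPP _ w0(1), of 0] gd unfolding s by simp
  moreover have "\<beta> * w - tol * m \<le> real (cnt (?A + ?A) 0 w)" using dnsC[of 0 w] w0 by (simp add: abs_le_iff)
  ultimately have "\<beta> * w \<le> (w / g + 1) * (2 * real s - 1) + tol * m" by linarith
  then have "\<beta> * w * g \<le> ((w / g + 1) * (2 * real s - 1) + tol * m) * g" by (rule mult_right_mono) simp
  also have "\<dots> = (2 * real s - 1) * w + (2 * real s - 1) * g + tol * m * g"
    using gpos by (simp add: field_simps)
  also have "(2 * real s - 1) * g \<le> tol * w * g"
  proof (rule mult_right_mono)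
    have "tol * m \<le> tol * w" using w0(2) tol by (intro mult_left_mono) auto
    then show "2 * real s - 1 \<le> tol * w" using tm sg tol by linarith
  qed simp
  also have "tol * m * g \<le> tol * w * g" using w0(2) tol by (intro mult_right_mono mult_left_mono) auto
  finally have "(\<beta> * g) * w \<le> (2 * real s - 1 + 2 * tol * g) * w" by (simp add: algebra_simps)
  moreover have "real_of_int w > 0" using w0 m100 by linarith
  ultimately have "\<beta> * g \<le> 2 * real s - 1 + 2 * tol * g" by (simp only: mult_le_cancel_right_pos)
  then show ?thesis using gd(1,2) up lo unfolding s s_def[symmetric] by blast
qed

theorem theorem1p4:
  fixes \<alpha> :: real and \<beta> :: rat and g0 :: nat
  assumes "0 < \<beta>" and "\<beta> < 1" and "v2 \<beta> \<le> 0"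
    and "0 < \<alpha>" and "\<alpha> < 1" and "real_of_rat \<beta> < 2 * \<alpha>"
    and "g0 = (LEAST g::nat. 1 \<le> g \<and> (\<exists>k::int. odd k \<and> of_nat g * \<beta> = of_int k))"
  shows "(\<exists>A::nat set. has_density A \<alpha> \<and> has_density (A + A) (real_of_rat \<beta>))
    \<longleftrightarrow> (real_of_rat \<beta> / 2 < \<alpha> \<and> \<alpha> \<le> real_of_rat \<beta> / 2 + 1 / (2 * real g0))"
proof -
  obtain p q where pq: "quotient_of \<beta> = (p, q)" by fastforce
  have q: "q > 0" and cop: "coprime p q" and \<beta>: "\<beta> = of_int p / of_int q"
    using quotient_of_denom_pos[OF pq] quotient_of_coprime[OF pq] quotient_of_div[OF pq] by auto
  define b where "b = real_of_rat \<beta>"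
  have b: "b = real_of_int p / real_of_int q" unfolding b_def \<beta> by (simp add: of_rat_divide)
  have ppos: "p > 0" using assms(1) q unfolding \<beta> by (simp add: zero_less_divide_iff)
  have plt: "p < q" using assms(2) q unfolding \<beta> by (simp add: divide_less_eq)
  have oddp: "odd p"
  proof
    assume ev: "even p"
    have "odd q" using coprime_common_divisor[OF cop ev] by auto
    then have "multiplicity 2 q = 0" by (rule not_dvd_imp_multiplicity_0)
    moreover have "multiplicity 2 p \<noteq> 0" using ev ppos by (subst multiplicity_eq_zero_iff) auto
    ultimately show False using assms(3) pq by (simp add: v2_def)
  qed
  \<comment> \<open>In lowest terms \<open>\<beta> = p / q\<close>, so \<open>g \<beta>\<close> is
    an integer only if \<open>q\<close> divides \<open>g\<close>, and \<open>q \<beta> = p\<close>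
    is odd. Hence \<open>g0 = q\<close>.\<close>
  let ?Q = "\<lambda>g::nat. 1 \<le> g \<and> (\<exists>k::int. odd k \<and> of_nat g * \<beta> = of_int k)"
  have Qq: "?Q (nat q)"
    using q oddp unfolding \<beta> by (intro conjI exI[of _ p]) auto
  have Qdvd: "nat q \<le> g" if Qg: "?Q g" for g
  proof -
    obtain k where "of_nat g * \<beta> = of_int k" using Qg by blast
    then have "rat_of_int (int g * p) = rat_of_int (k * q)" using q unfolding \<beta> by (simp add: field_simps)
    then have "int g * p = k * q" by (simp only: of_int_eq_iff)
    then have "q dvd int g * p" by simp
    then have "q dvd int g" using cop by (simp add: coprime_dvd_mult_left_iff coprime_commute)
    then show ?thesis using Qg by (intro nat_le_iff[THEN iffD2] zdvd_imp_le) auto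
  qed
  have g0: "g0 = nat q" unfolding assms(7) by (rule Least_equality[of ?Q "nat q", OF Qq Qdvd])
  have g0q: "real g0 = real_of_int q" using q g0 by simp
  define \<gamma> where "\<gamma> = 2 * \<alpha> - b"
  have \<gamma>: "\<gamma> > 0" using assms(6) by (simp add: \<gamma>_def b_def)
  show ?thesis
    unfolding b_def[symmetric]
  proof
    assume "\<exists>A::nat set. has_density A \<alpha> \<and> has_density (A + A) b"
    then obtain A :: "nat set" where A: "has_density A \<alpha>" "has_density (A + A) b" by blast
    \<comment> \<open>With \<open>g * \<gamma> \<le> 2\<close> the last term gives
      \<open>g * tol * q \<le> 1 / 4\<close>. The integers \<open>p * g\<close> and
      \<open>(2 * s - 1) * q\<close> then differ by less than \<open>1\<close>, so they
      coincide.\<close>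
    define tol0 where "tol0 = min 1 (min (\<gamma> / 64) (\<gamma> / (8 * q)))"
    have tol0: "tol0 > 0" using \<gamma> q by (simp add: tol0_def)
    have est: "\<alpha> \<le> b / 2 + 1 / (2 * real g0) + tol" if tol: "0 < tol" "tol \<le> tol0" for tol
    proof -
      have t: "tol \<le> 1" "64 * tol \<le> 2 * \<alpha> - b" "tol * (8 * q) \<le> \<gamma>"
        using tol q by (auto simp: tol0_def \<gamma>_def field_simps)
      obtain g s :: nat where gs: "0 < g" "real g \<le> 2 / (2 * \<alpha> - b)" "2 * real s - 1 \<le> (b + tol) * g"
        "(\<alpha> - tol) * g \<le> real s" "b * g \<le> 2 * real s - 1 + 2 * tol * g"
        using structured_sumset[OF A tol(1) t(1,2)] by blast
      have "real g * \<gamma> \<le> 2" using gs(2) \<gamma> unfolding \<gamma>_def[symmetric] by (simp add: le_divide_eq)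
      moreover have "real g * (tol * (8 * q)) \<le> real g * \<gamma>" using t(3) by (intro mult_left_mono) auto
      ultimately have small: "real g * tol * q \<le> 1 / 4" by simp
      have bq: "b * q = p" using q b by simp
      have "\<bar>b * g - (2 * real s - 1)\<bar> \<le> 2 * (real g * tol)"
        using gs(3,5) tol(1) by (auto simp: abs_le_iff algebra_simps)
      then have "\<bar>b * g - (2 * real s - 1)\<bar> * q \<le> 2 * (real g * tol) * q" using q by (intro mult_right_mono) auto
      also have "\<dots> < 1" using small by simp
      finally have "\<bar>(b * g - (2 * real s - 1)) * q\<bar> < 1" using q by (simp add: abs_mult)
      moreover have "(b * g - (2 * real s - 1)) * q = real_of_int (p * int g - (2 * int s - 1) * q)"
        using bq by (simp add: algebra_simps)
      ultimately have "\<bar>p * int g - (2 * int s - 1) * q\<bar> < 1" by linarith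
      then have eq: "p * int g = (2 * int s - 1) * q" by linarith
      have "of_nat g * \<beta> = rat_of_int (2 * int s - 1)"
      proof -
        have "rat_of_int (p * int g) = rat_of_int ((2 * int s - 1) * q)" using eq by simp
        then show ?thesis using q unfolding \<beta> by (simp add: field_simps)
      qed
      then have "?Q g" using gs(1) by (intro conjI exI[of _ "2 * int s - 1"]) auto
      then have "real g0 \<le> real g" using Qdvd g0 by simp
      then have inv: "1 / (2 * real g) \<le> 1 / (2 * real g0)" using g0q q by (intro divide_left_mono) auto
      have "real_of_int (p * int g) = real_of_int ((2 * int s - 1) * q)" using eq by simp
      then have "b * g = 2 * real s - 1" using q unfolding b by (simp add: field_simps)
      then have "real s / g = b / 2 + 1 / (2 * real g)" using gs(1) by (simp add: field_simps)
      moreover have "\<alpha> - tol \<le> real s / g" using gs(1,4) by (simp add: le_divide_eq)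
      ultimately show ?thesis using inv by linarith
    qed
    have "\<alpha> \<le> b / 2 + 1 / (2 * real g0)"
    proof (rule field_le_epsilon)
      fix e :: real assume "0 < e"
      then have "\<alpha> \<le> b / 2 + 1 / (2 * real g0) + min tol0 e" using tol0 by (intro est) auto
      also have "\<dots> \<le> b / 2 + 1 / (2 * real g0) + e" by (intro add_left_mono min.cobounded2)
      finally show "\<alpha> \<le> b / 2 + 1 / (2 * real g0) + e" .
    qed
    then show "b / 2 < \<alpha> \<and> \<alpha> \<le> b / 2 + 1 / (2 * real g0)" using \<gamma> by (simp add: \<gamma>_def)
  next
    assume \<alpha>: "b / 2 < \<alpha> \<and> \<alpha> \<le> b / 2 + 1 / (2 * real g0)"
    \<comment> \<open>With \<open>s = (p + 1) / 2\<close> one has \<open>2 s - 1 = p\<close>, and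
      \<open>s / q\<close> is the upper end \<open>\<beta>/2 + 1/(2 g0)\<close> of the
      range.\<close>
    obtain t where t: "p = 2 * t + 1" using oddp by (rule oddE)
    define s where "s = nat (t + 1)"
    have s: "s \<ge> 1" "int (2 * s - 1) = p" using t ppos by (auto simp: s_def nat_le_iff of_nat_diff)
    have rs: "real (2 * s - 1) = real_of_int p" using s(2) by linarith
    have rs2: "real s = (real_of_int p + 1) / 2" using t ppos by (simp add: s_def)
    have rq: "real (nat q) = real_of_int q" using q by simp
    have "\<exists>A. has_density A \<alpha> \<and> has_density (A + A) (real (2 * s - 1) / real (nat q))"
    proof (rule density_pair_exists[OF s(1)])
      show "2 * s - 1 < nat q" using s(2) plt by linarith
      show "real (2 * s - 1) / (2 * real (nat q)) < \<alpha>" using \<alpha> unfolding rs rq b by simp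
      show "\<alpha> \<le> real s / real (nat q)" using \<alpha> q unfolding rs2 rq b g0q by (simp add: field_simps)
    qed
    then show "\<exists>A::nat set. has_density A \<alpha> \<and> has_density (A + A) b" unfolding rs rq b .
  qed
qed

end
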